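(* Let $(g_j)_{j\ge1}$ be independent standard real Gaussian variables on a probability space $\Omega$. For any $d,l\in\mathbb N$ and any $C_1,\ldots,C_l\in M_d(\mathbb C)$, $$\left\|\sum_{j=1}^l C_j\otimes g_j\right\|_{L_1(\Omega;S_1^d)}\le\|(C_j)\|_{S_1^d(\ell_2)}\le\sqrt2\left\|\sum_{j=1}^l C_j\otimes g_j\right\|_{L_1(\Omega;S_1^d)} .$$ The constant $\sqrt2$ is optimal uniformly over $d$ and $l$: no smaller constant works in the second inequality for all $d$, $l$ and all $C_1,\dots,C_l\in M_d(\mathbb C)$.
   Context: $\operatorname{tr}$ is the usual unnormalized trace on $M_d(\mathbb C)$, $\|F\|_{L_1(\Omega;S_1^d)}=\mathbb E\operatorname{tr}|F|$ for an $M_d(\mathbb C)$-valued random variable $F$. For a finite family $(C_k)$ in $M_d(\mathbb C)$, $$\|(C_k)\|_{S_1^d(\ell_2)}=\inf\left\{\operatorname{tr}\Big(\sum_kX_k^*X_k\Big)^{1/2}+\operatorname{tr}\Big(\sum_kY_kY_k^*\Big)^{1/2}: C_k=X_k+Y_k,\ X_k,Y_k\in M_d(\mathbb C)\right\}.$$ *)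

theory Defs
  imports "HOL-Probability.Probability" "Jordan_Normal_Form.Schur_Decomposition"
begin

text \<open>
  Matrices are those of Jordan_Normal_Form, since the dimension is quantified inside the
  statement; \<open>carrier_mat d d\<close> over \<open>complex\<close> plays the role of $M_d(\mathbb C)$.
\<close>

definition mat_trace :: "complex mat \<Rightarrow> complex" where
  "mat_trace A = (\<Sum>i<dim_row A. A $$ (i, i))"

definition mat_sum :: "nat \<Rightarrow> ('i \<Rightarrow> complex mat) \<Rightarrow> 'i set \<Rightarrow> complex mat" where
  "mat_sum d A I = finsum (module_mat TYPE(complex) d d) A I"

text \<open>
  The order on \<open>complex\<close> is the one of Complex_Order: \<open>0 \<le> z\<close> says that \<open>z\<close> is a
  nonnegative real.
\<close>

definition psd_mat :: "nat \<Rightarrow> complex mat \<Rightarrow> bool" where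
  "psd_mat d A \<longleftrightarrow> A \<in> carrier_mat d d \<and> mat_adjoint A = A \<and>
     (\<forall>v \<in> carrier_vec d. 0 \<le> (A *\<^sub>v v) \<bullet>c v)"

text \<open>The square root is only meaningful for positive semidefinite \<open>A\<close>, where it exists uniquely.\<close>

definition psd_sqrt :: "complex mat \<Rightarrow> complex mat" where
  "psd_sqrt A = (THE B. psd_mat (dim_row A) B \<and> B * B = A)"

definition mat_abs :: "complex mat \<Rightarrow> complex mat" where
  "mat_abs A = psd_sqrt (mat_adjoint A * A)"

text \<open>
  The traces below are traces of positive semidefinite matrices, so taking real parts only
  changes the type.
\<close>

definition L1_S1_norm :: "'a measure \<Rightarrow> ('a \<Rightarrow> complex mat) \<Rightarrow> real" where
  "L1_S1_norm M F = (\<integral>\<omega>. Re (mat_trace (mat_abs (F \<omega>))) \<partial>M)"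

definition S1_l2_norm :: "nat \<Rightarrow> 'i set \<Rightarrow> ('i \<Rightarrow> complex mat) \<Rightarrow> real" where
  "S1_l2_norm d I C = Inf
     {Re (mat_trace (psd_sqrt (mat_sum d (\<lambda>k. mat_adjoint (X k) * X k) I))) +
      Re (mat_trace (psd_sqrt (mat_sum d (\<lambda>k. Y k * mat_adjoint (Y k)) I))) | X Y.
      \<forall>k\<in>I. X k \<in> carrier_mat d d \<and> Y k \<in> carrier_mat d d \<and> C k = X k + Y k}"

text \<open>The random matrix $\sum_{j=1}^l C_j \otimes g_j$.\<close>

definition gauss_sum ::
  "(nat \<Rightarrow> 'a \<Rightarrow> real) \<Rightarrow> nat \<Rightarrow> nat \<Rightarrow> (nat \<Rightarrow> complex mat) \<Rightarrow> 'a \<Rightarrow> complex mat" where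
  "gauss_sum g d l C \<omega> = mat_sum d (\<lambda>j. complex_of_real (g j \<omega>) \<cdot>\<^sub>m C j) {1..l}"

end

theory Submission
  imports Defs "Jordan_Normal_Form.Spectral_Radius"
begin

text \<open>
  Write \<open>X = \<Sum> g\<^sub>j X\<^sub>j\<close> and \<open>C = \<Sum> g\<^sub>j C\<^sub>j\<close>.

  Upper bound: choose \<open>X\<^sub>j\<close> such that \<open>C\<^sub>j = A X\<^sub>j + X\<^sub>j A'\<close> with \<open>A = E |X\<^sup>*|\<close> and \<open>A' = E |X|\<close>, up to an
  arbitrarily small error; this is a fixed point problem. Pairing \<open>C\<close> with the polar part of \<open>X\<close>
  gives \<open>\<parallel>A\<parallel>\<^sup>2 + \<parallel>A'\<parallel>\<^sup>2 \<le> E tr |C|\<close> in Hilbert--Schmidt norms, while the decomposition itself shows that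
  the norm of \<open>(C\<^sub>j)\<close> is at most \<open>(\<parallel>A\<parallel> + \<parallel>A'\<parallel>) (\<Sum> \<parallel>X\<^sub>j\<parallel>\<^sup>2)\<^sup>1\<^sup>/\<^sup>2\<close>. The constant \<open>\<surd>2\<close> then follows from
  \<open>\<Sum> \<parallel>X\<^sub>j\<parallel>\<^sup>2 \<le> \<parallel>A\<parallel>\<^sup>2 + \<parallel>A'\<parallel>\<^sup>2\<close>, a noncommutative version of the argument of Latala and Oleszkiewicz for
  the Khintchine inequality: \<open>2 Re tr X\<^sup>* X' \<le> tr |X| |X'| + tr |X\<^sup>*| |X'\<^sup>*|\<close> is applied to correlated
  copies \<open>X, X'\<close>, and the even functions \<open>|X|\<close> and \<open>|X\<^sup>*|\<close> of the Gaussian vector have no first chaos.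

  Lower bound: if \<open>C\<^sub>j = X\<^sub>j + Y\<^sub>j\<close>, then \<open>tr |C|\<close> is at most the sum of the column norms of \<open>X\<close> in an
  eigenbasis of \<open>\<Sum> X\<^sub>j\<^sup>* X\<^sub>j\<close> plus the analogous sum for \<open>Y\<^sup>*\<close>, whose expectations are bounded by
  Jensen's inequality.

  Optimality: for \<open>l = 2 k + 1\<close>, the fermionic creation operators restricted to the \<open>k\<close>-particle
  space force the constant to be at least \<open>((2 k + 1) / (k + 1))\<^sup>1\<^sup>/\<^sup>2\<close>.
\<close>

section \<open>Matrices and the Hilbert--Schmidt inner product\<close>

text \<open>With s^2 = ||A||^2 + ||A'||^2, the decomposition costs at most (||A|| + ||A'||) s <=
  sqrt 2 s^2, and the pairing gives s^2 <= E tr |C|; the constant is the price of comparing ||A|| +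
  ||A'|| with s. The point is therefore V = sum_j ||X_j||^2 <= s^2, and there the missing first
  chaos is decisive. Copies at angle t satisfy E <X, X'> = V cos t, while correlations of even
  functions are bounded by second moment and squared mean with the weights cos^2 t and sin^2 t. The
  weights cos t and 1 - cos t, valid for all functions, would cancel V and leave only 0 <= s^2. No
  Hermite expansion is used for this: stationarity in the angle and positivity of Gram matrices
  suffice. A and A' may be singular, so |A| + epsilon and |A'| + epsilon enter the equation for X_j.
  Its solution is then a Lipschitz function of A and A', which is what makes approximate fixed
  points accessible; the errors disappear in the final limit.\<close>

lemma mat_adjoint_dim [simp]:
  "dim_row (mat_adjoint A) = dim_col A" "dim_col (mat_adjoint A) = dim_row A"
  by (auto simp: mat_adjoint_def)

lemma mat_adjoint_carrier [simp]:
  "mat_adjoint A \<in> carrier_mat n m \<longleftrightarrow> A \<in> carrier_mat m n"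
  by (metis carrier_matD carrier_matI mat_adjoint_dim)

lemma mat_adjoint_index [simp]:
  "i < dim_col A \<Longrightarrow> j < dim_row A \<Longrightarrow> mat_adjoint A $$ (i, j) = conjugate (A $$ (j, i))"
  by (simp add: mat_adjoint_def mat_of_rows_def)

lemma mat_adjoint_adjoint [simp]: "mat_adjoint (mat_adjoint A) = A"
  by (rule eq_matI) auto

lemma mat_adjoint_mult:
  fixes A B :: "complex mat"
  assumes "A \<in> carrier_mat n m" "B \<in> carrier_mat m k"
  shows "mat_adjoint (A * B) = mat_adjoint B * mat_adjoint A"
  using assms
  by (intro eq_matI) (auto simp: scalar_prod_def cnj_sum mult.commute intro!: sum.cong)

lemma mat_adjoint_add:
  fixes A B :: "complex mat"
  assumes "A \<in> carrier_mat n m" "B \<in> carrier_mat n m"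
  shows "mat_adjoint (A + B) = mat_adjoint A + mat_adjoint B"
  using assms by (intro eq_matI) auto

lemma mat_adjoint_minus:
  fixes A B :: "complex mat"
  assumes "A \<in> carrier_mat n m" "B \<in> carrier_mat n m"
  shows "mat_adjoint (A - B) = mat_adjoint A - mat_adjoint B"
  using assms by (intro eq_matI) auto

lemma mat_adjoint_smult: "mat_adjoint (c \<cdot>\<^sub>m A) = cnj c \<cdot>\<^sub>m mat_adjoint (A :: complex mat)"
  by (intro eq_matI) auto

lemma mat_adjoint_one [simp]: "mat_adjoint (1\<^sub>m n :: complex mat) = 1\<^sub>m n"
  by (intro eq_matI) auto

lemma index_mult_mat_sum:
  assumes "A \<in> carrier_mat n m" "B \<in> carrier_mat m k" "i < n" "j < k"
  shows "(A * B) $$ (i, j) = (\<Sum>l<m. A $$ (i, l) * B $$ (l, j))"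
  using assms by (auto simp: scalar_prod_def lessThan_atLeast0)

lemma mat_trace_comm:
  assumes "A \<in> carrier_mat n m" "B \<in> carrier_mat m n"
  shows "mat_trace (A * B) = mat_trace (B * A)"
proof -
  have "mat_trace (A * B) = (\<Sum>i<n. \<Sum>l<m. A $$ (i, l) * B $$ (l, i))"
    using assms by (auto simp: mat_trace_def index_mult_mat_sum[OF assms] simp del: index_mult_mat(1))
  also have "\<dots> = (\<Sum>l<m. \<Sum>i<n. A $$ (i, l) * B $$ (l, i))"
    by (rule sum.swap)
  also have "\<dots> = mat_trace (B * A)"
    using assms
    by (auto simp: mat_trace_def index_mult_mat_sum[OF assms(2,1)] mult.commute simp del: index_mult_mat(1))
  finally show ?thesis .
qed

lemma mat_trace_adjoint: "A \<in> carrier_mat n n \<Longrightarrow> mat_trace (mat_adjoint A) = cnj (mat_trace A)"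
  by (auto simp: mat_trace_def)

lemma mat_trace_add:
  "A \<in> carrier_mat n n \<Longrightarrow> B \<in> carrier_mat n n \<Longrightarrow> mat_trace (A + B) = mat_trace A + mat_trace B"
  by (auto simp: mat_trace_def sum.distrib)

lemma mat_trace_smult: "A \<in> carrier_mat n n \<Longrightarrow> mat_trace (c \<cdot>\<^sub>m A) = c * mat_trace A"
  by (auto simp: mat_trace_def sum_distrib_left)

text \<open>The real part turns the complex pairing into the symmetric Euclidean one of the real
  space underlying M_d(C). The Gaussian coefficients are real, so real bilinearity suffices.\<close>

definition hs_inner :: "complex mat \<Rightarrow> complex mat \<Rightarrow> real" where
  "hs_inner A B = Re (mat_trace (mat_adjoint A * B))"

definition hs_norm :: "complex mat \<Rightarrow> real" where
  "hs_norm A = sqrt (hs_inner A A)"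

lemma hs_inner_sum:
  assumes "A \<in> carrier_mat n m" "B \<in> carrier_mat n m"
  shows "hs_inner A B = (\<Sum>i<n. \<Sum>j<m. Re (cnj (A $$ (i, j)) * B $$ (i, j)))"
proof -
  have "hs_inner A B = (\<Sum>j<m. \<Sum>i<n. Re (cnj (A $$ (i, j)) * B $$ (i, j)))"
    unfolding hs_inner_def mat_trace_def using assms
    by (auto simp: index_mult_mat_sum[of "mat_adjoint A" m n B m] simp del: index_mult_mat(1) intro!: sum.cong)
  thus ?thesis by (subst sum.swap)
qed

lemma hs_inner_self:
  assumes "A \<in> carrier_mat n m"
  shows "hs_inner A A = (\<Sum>i<n. \<Sum>j<m. (cmod (A $$ (i, j)))\<^sup>2)"
  unfolding hs_inner_sum[OF assms assms]
  by (intro sum.cong refl) (auto simp: cmod_def power2_eq_square)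

lemma hs_inner_nonneg: "hs_inner A A \<ge> 0"
  by (subst hs_inner_self[of _ "dim_row A" "dim_col A"]) (auto intro!: sum_nonneg)

lemma hs_norm_nonneg [simp]: "hs_norm A \<ge> 0"
  by (simp add: hs_norm_def hs_inner_nonneg)

lemma hs_norm_square: "(hs_norm A)\<^sup>2 = hs_inner A A"
  by (simp add: hs_norm_def hs_inner_nonneg)

text \<open>Flattening the entries to one family over pairs gives access to the triangle and
  Cauchy-Schwarz inequalities for \<open>L2_set\<close>.\<close>

lemma hs_norm_L2_set:
  assumes "A \<in> carrier_mat n m"
  shows "hs_norm A = L2_set (\<lambda>p. cmod (A $$ p)) ({..<n} \<times> {..<m})"
  unfolding hs_norm_def L2_set_def hs_inner_self[OF assms] sum.cartesian_product
  by (auto intro!: sum.cong arg_cong[where f = sqrt])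

lemma hs_norm_triangle:
  assumes "A \<in> carrier_mat n m" "B \<in> carrier_mat n m"
  shows "hs_norm (A + B) \<le> hs_norm A + hs_norm B"
proof -
  have "hs_norm (A + B) = L2_set (\<lambda>p. cmod ((A + B) $$ p)) ({..<n} \<times> {..<m})"
    using assms by (intro hs_norm_L2_set) auto
  also have "\<dots> \<le> L2_set (\<lambda>p. cmod (A $$ p) + cmod (B $$ p)) ({..<n} \<times> {..<m})"
    using assms by (intro L2_set_mono) (auto intro: norm_triangle_ineq)
  also have "\<dots> \<le> hs_norm A + hs_norm B"
    unfolding hs_norm_L2_set[OF assms(1)] hs_norm_L2_set[OF assms(2)] by (rule L2_set_triangle_ineq)
  finally show ?thesis .
qed

lemma hs_inner_le:
  assumes "A \<in> carrier_mat n m" "B \<in> carrier_mat n m"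
  shows "hs_inner A B \<le> hs_norm A * hs_norm B"
proof -
  have "hs_inner A B \<le> (\<Sum>p\<in>{..<n} \<times> {..<m}. \<bar>cmod (A $$ p)\<bar> * \<bar>cmod (B $$ p)\<bar>)"
    unfolding hs_inner_sum[OF assms] sum.cartesian_product
    by (intro sum_mono) (auto intro!: order_trans[OF complex_Re_le_cmod] simp: norm_mult simp del: times_complex.sel)
  also have "\<dots> \<le> hs_norm A * hs_norm B"
    unfolding hs_norm_L2_set[OF assms(1)] hs_norm_L2_set[OF assms(2)] by (rule L2_set_mult_ineq)
  finally show ?thesis .
qed

lemma hs_norm_adjoint [simp]: "hs_norm (mat_adjoint A) = hs_norm A"
  unfolding hs_norm_def hs_inner_def
  by (simp add: mat_trace_comm[of "mat_adjoint A" "dim_col A" "dim_row A" A])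

lemma hs_norm_smult: "hs_norm (c \<cdot>\<^sub>m A) = cmod c * hs_norm A"
proof -
  have "hs_inner (c \<cdot>\<^sub>m A) (c \<cdot>\<^sub>m A) = (cmod c)\<^sup>2 * hs_inner A A"
    by (auto simp: hs_inner_self[of _ "dim_row A" "dim_col A"] sum_distrib_left norm_mult power_mult_distrib)
  thus ?thesis by (simp add: hs_norm_def real_sqrt_mult)
qed

text \<open>Cauchy-Schwarz in each entry of the product; the resulting double sum factors into the
  two squared norms.\<close>

lemma hs_norm_mult:
  assumes "A \<in> carrier_mat n m" "B \<in> carrier_mat m k"
  shows "hs_norm (A * B) \<le> hs_norm A * hs_norm B"
proof -
  have "hs_inner (A * B) (A * B) = (\<Sum>i<n. \<Sum>j<k. (cmod (\<Sum>l<m. A $$ (i, l) * B $$ (l, j)))\<^sup>2)"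
    using assms by (auto simp: hs_inner_self[of _ n k] index_mult_mat_sum[OF assms] simp del: index_mult_mat(1))
  also have "\<dots> \<le> (\<Sum>i<n. \<Sum>j<k. (\<Sum>l<m. (cmod (A $$ (i, l)))\<^sup>2) * (\<Sum>l<m. (cmod (B $$ (l, j)))\<^sup>2))"
  proof (intro sum_mono)
    fix i j
    have "cmod (\<Sum>l<m. A $$ (i, l) * B $$ (l, j)) \<le> (\<Sum>l<m. \<bar>cmod (A $$ (i, l))\<bar> * \<bar>cmod (B $$ (l, j))\<bar>)"
      by (rule sum_norm_le) (auto simp: norm_mult)
    also have "\<dots> \<le> L2_set (\<lambda>l. cmod (A $$ (i, l))) {..<m} * L2_set (\<lambda>l. cmod (B $$ (l, j))) {..<m}"
      by (rule L2_set_mult_ineq)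
    finally have "(cmod (\<Sum>l<m. A $$ (i, l) * B $$ (l, j)))\<^sup>2 \<le>
        (L2_set (\<lambda>l. cmod (A $$ (i, l))) {..<m} * L2_set (\<lambda>l. cmod (B $$ (l, j))) {..<m})\<^sup>2"
      by (intro power_mono) auto
    thus "(cmod (\<Sum>l<m. A $$ (i, l) * B $$ (l, j)))\<^sup>2 \<le>
      (\<Sum>l<m. (cmod (A $$ (i, l)))\<^sup>2) * (\<Sum>l<m. (cmod (B $$ (l, j)))\<^sup>2)"
      by (simp add: power_mult_distrib L2_set_def sum_nonneg)
  qed
  also have "\<dots> = (\<Sum>i<n. \<Sum>l<m. (cmod (A $$ (i, l)))\<^sup>2) * (\<Sum>j<k. \<Sum>l<m. (cmod (B $$ (l, j)))\<^sup>2)"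
    by (simp add: sum_product)
  also have "(\<Sum>j<k. \<Sum>l<m. (cmod (B $$ (l, j)))\<^sup>2) = hs_inner B B"
    unfolding hs_inner_self[OF assms(2)] by (rule sum.swap)
  finally show ?thesis
    unfolding hs_norm_def hs_inner_self[OF assms(1)] real_sqrt_mult[symmetric] by simp
qed

lemma hs_norm_zero_iff:
  assumes "A \<in> carrier_mat n m"
  shows "hs_norm A = 0 \<longleftrightarrow> A = 0\<^sub>m n m"
proof
  assume "hs_norm A = 0"
  hence "\<forall>p\<in>{..<n} \<times> {..<m}. cmod (A $$ p) = 0"
    unfolding hs_norm_L2_set[OF assms] by (subst (asm) L2_set_eq_0_iff) auto
  thus "A = 0\<^sub>m n m" using assms by (intro eq_matI) auto
next
  assume "A = 0\<^sub>m n m"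
  thus "hs_norm A = 0" by (simp add: hs_norm_L2_set[of _ n m] L2_set_eq_0_iff)
qed

lemma cmod_index_le_hs_norm:
  assumes "A \<in> carrier_mat n m" "i < n" "j < m"
  shows "cmod (A $$ (i, j)) \<le> hs_norm A"
  unfolding hs_norm_L2_set[OF assms(1)]
  using member_le_L2_set[of "{..<n} \<times> {..<m}" "(i, j)" "\<lambda>p. cmod (A $$ p)"] assms by auto

section \<open>Sums of matrices over finite families\<close>

lemma mat_sum_carrier_index:
  assumes "finite I" "\<And>k. k \<in> I \<Longrightarrow> A k \<in> carrier_mat d d"
  shows "mat_sum d A I \<in> carrier_mat d d \<and>
    (\<forall>i<d. \<forall>j<d. mat_sum d A I $$ (i, j) = (\<Sum>k\<in>I. A k $$ (i, j)))"
  using assms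
proof (induction I rule: finite_induct)
  interpret M: abelian_group "module_mat TYPE(complex) d d" by (rule abelian_group_mat)
  {
    case empty
    show ?case by (simp add: mat_sum_def module_mat_simps)
  next
    case (insert x F)
    have "mat_sum d A (insert x F) = A x + mat_sum d A F"
      unfolding mat_sum_def using insert by (subst M.finsum_insert) (auto simp: module_mat_simps)
    thus ?case using insert by auto
  }
qed

lemma mat_sum_carrier [simp]:
  "finite I \<Longrightarrow> (\<And>k. k \<in> I \<Longrightarrow> A k \<in> carrier_mat d d) \<Longrightarrow> mat_sum d A I \<in> carrier_mat d d"
  using mat_sum_carrier_index by blast

lemma mat_sum_index:
  "finite I \<Longrightarrow> (\<And>k. k \<in> I \<Longrightarrow> A k \<in> carrier_mat d d) \<Longrightarrow> i < d \<Longrightarrow> j < d \<Longrightarrow>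
    mat_sum d A I $$ (i, j) = (\<Sum>k\<in>I. A k $$ (i, j))"
  using mat_sum_carrier_index by blast

lemma mat_sum_dim [simp]:
  assumes "finite I" "\<And>k. k \<in> I \<Longrightarrow> A k \<in> carrier_mat d d"
  shows "dim_row (mat_sum d A I) = d" "dim_col (mat_sum d A I) = d"
  using assms by (meson carrier_matD mat_sum_carrier)+

lemma mult_carrier_square [simp]:
  "A \<in> carrier_mat d d \<Longrightarrow> B \<in> carrier_mat d d \<Longrightarrow> A * B \<in> carrier_mat d d"
  by (rule mult_carrier_mat)

lemma mat_sum_mult_left:
  assumes "finite I" "\<And>k. k \<in> I \<Longrightarrow> A k \<in> carrier_mat d d" "B \<in> carrier_mat d d"
  shows "B * mat_sum d A I = mat_sum d (\<lambda>k. B * A k) I"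
proof (rule eq_matI)
  fix i j assume "i < dim_row (mat_sum d (\<lambda>k. B * A k) I)" "j < dim_col (mat_sum d (\<lambda>k. B * A k) I)"
  hence ij: "i < d" "j < d" using assms by auto
  have "(B * mat_sum d A I) $$ (i, j) = (\<Sum>l<d. \<Sum>k\<in>I. B $$ (i, l) * A k $$ (l, j))"
    using assms ij by (subst index_mult_mat_sum[of _ d d _ d]) (auto simp: mat_sum_index sum_distrib_left)
  also have "\<dots> = (\<Sum>k\<in>I. \<Sum>l<d. B $$ (i, l) * A k $$ (l, j))" by (rule sum.swap)
  also have "\<dots> = (\<Sum>k\<in>I. (B * A k) $$ (i, j))"
    using assms ij by (intro sum.cong refl, subst index_mult_mat_sum[of _ d d _ d]) auto
  also have "\<dots> = mat_sum d (\<lambda>k. B * A k) I $$ (i, j)"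
    using assms ij by (subst mat_sum_index) auto
  finally show "(B * mat_sum d A I) $$ (i, j) = mat_sum d (\<lambda>k. B * A k) I $$ (i, j)" .
qed (use assms in auto)

lemma mat_adjoint_mat_sum:
  assumes "finite I" "\<And>k. k \<in> I \<Longrightarrow> A k \<in> carrier_mat d d"
  shows "mat_adjoint (mat_sum d A I) = mat_sum d (\<lambda>k. mat_adjoint (A k)) I"
proof (rule eq_matI)
  fix i j assume "i < dim_row (mat_sum d (\<lambda>k. mat_adjoint (A k)) I)" "j < dim_col (mat_sum d (\<lambda>k. mat_adjoint (A k)) I)"
  hence ij: "i < d" "j < d" using assms by auto
  have "mat_adjoint (A k) $$ (i, j) = cnj (A k $$ (j, i))" if "k \<in> I" for k
    using assms(2)[OF that] ij by auto
  thus "mat_adjoint (mat_sum d A I) $$ (i, j) = mat_sum d (\<lambda>k. mat_adjoint (A k)) I $$ (i, j)"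
    using assms ij by (simp add: mat_sum_index)
qed (use assms in auto)

text \<open>Reduced to multiplication from the left by passing to adjoints.\<close>

lemma mat_sum_mult_right:
  assumes "finite I" "\<And>k. k \<in> I \<Longrightarrow> A k \<in> carrier_mat d d" "B \<in> carrier_mat d d"
  shows "mat_sum d A I * B = mat_sum d (\<lambda>k. A k * B) I"
proof -
  have "mat_adjoint (mat_sum d A I * B) = mat_sum d (\<lambda>k. mat_adjoint B * mat_adjoint (A k)) I"
    using assms by (subst mat_adjoint_mult[of _ d d _ d]) (auto simp: mat_adjoint_mat_sum mat_sum_mult_left)
  also have "\<dots> = mat_sum d (\<lambda>k. mat_adjoint (A k * B)) I"
    unfolding mat_sum_def using assms
    by (intro abelian_monoid.finsum_cong'[OF abelian_group.axioms(1)[OF abelian_group_mat]])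
       (auto simp: module_mat_simps mat_adjoint_mult[of _ d d _ d])
  also have "\<dots> = mat_adjoint (mat_sum d (\<lambda>k. A k * B) I)"
    using assms by (subst mat_adjoint_mat_sum) auto
  finally show ?thesis by (metis mat_adjoint_adjoint)
qed

lemma mat_sum_cong:
  assumes "finite I" "\<And>k. k \<in> I \<Longrightarrow> A k \<in> carrier_mat d d" "\<And>k. k \<in> I \<Longrightarrow> A k = B k"
  shows "mat_sum d A I = mat_sum d B I"
  using assms by (intro eq_matI) (auto simp: mat_sum_index)

lemma mat_trace_mat_sum:
  assumes "finite I" "\<And>k. k \<in> I \<Longrightarrow> A k \<in> carrier_mat d d"
  shows "mat_trace (mat_sum d A I) = (\<Sum>k\<in>I. mat_trace (A k))"
proof -
  have "mat_trace (mat_sum d A I) = (\<Sum>i<d. \<Sum>k\<in>I. A k $$ (i, i))"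
    using assms by (simp add: mat_trace_def mat_sum_index)
  also have "\<dots> = (\<Sum>k\<in>I. \<Sum>i<d. A k $$ (i, i))" by (rule sum.swap)
  also have "\<dots> = (\<Sum>k\<in>I. mat_trace (A k))"
    using assms by (intro sum.cong refl) (auto simp: mat_trace_def)
  finally show ?thesis .
qed

lemma mat_sum_add:
  assumes "finite I" "\<And>k. k \<in> I \<Longrightarrow> A k \<in> carrier_mat d d" "\<And>k. k \<in> I \<Longrightarrow> B k \<in> carrier_mat d d"
  shows "mat_sum d A I + mat_sum d B I = mat_sum d (\<lambda>k. A k + B k) I"
proof (rule eq_matI)
  fix i j assume "i < dim_row (mat_sum d (\<lambda>k. A k + B k) I)" "j < dim_col (mat_sum d (\<lambda>k. A k + B k) I)"
  hence ij: "i < d" "j < d" using assms by auto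
  have "(A k + B k) $$ (i, j) = A k $$ (i, j) + B k $$ (i, j)" if "k \<in> I" for k
    using carrier_matD[OF assms(3)[OF that]] ij by simp
  thus "(mat_sum d A I + mat_sum d B I) $$ (i, j) = mat_sum d (\<lambda>k. A k + B k) I $$ (i, j)"
    using assms ij by (simp add: mat_sum_index sum.distrib)
qed (use assms in auto)

lemma mat_sum_smult_cong:
  assumes "finite I" "\<And>k. k \<in> I \<Longrightarrow> A k \<in> carrier_mat d d" "\<And>k. k \<in> I \<Longrightarrow> B k = c \<cdot>\<^sub>m A k"
  shows "mat_sum d B I = c \<cdot>\<^sub>m mat_sum d A I"
proof (rule eq_matI)
  have B: "B k \<in> carrier_mat d d" if "k \<in> I" for k using assms(2,3)[OF that] by simp
  show "dim_row (mat_sum d B I) = dim_row (c \<cdot>\<^sub>m mat_sum d A I)" "dim_col (mat_sum d B I) = dim_col (c \<cdot>\<^sub>m mat_sum d A I)"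
    using assms(1,2) B by simp_all
  fix i j assume "i < dim_row (c \<cdot>\<^sub>m mat_sum d A I)" "j < dim_col (c \<cdot>\<^sub>m mat_sum d A I)"
  hence ij: "i < d" "j < d" using assms(1,2) by simp_all
  have "B k $$ (i, j) = c * A k $$ (i, j)" if "k \<in> I" for k
    using assms(3)[OF that] carrier_matD[OF assms(2)[OF that]] ij by simp
  thus "mat_sum d B I $$ (i, j) = (c \<cdot>\<^sub>m mat_sum d A I) $$ (i, j)"
    using assms(1,2) B ij by (simp add: mat_sum_index sum_distrib_left)
qed

lemma smult_smult_mat: "a \<cdot>\<^sub>m (b \<cdot>\<^sub>m A) = (a * b :: complex) \<cdot>\<^sub>m A"
  by (intro eq_matI) auto

section \<open>Diagonalization of Hermitian matrices\<close>

text \<open>Functional calculus is done by hand: a function of the Hermitian matrix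
  \<open>U * diag_real d f * mat_adjoint U\<close> is obtained by changing \<open>f\<close>, so real
  diagonals suffice.\<close>

definition diag_real :: "nat \<Rightarrow> (nat \<Rightarrow> real) \<Rightarrow> complex mat" where
  "diag_real d f = mat d d (\<lambda>(i, j). if i = j then complex_of_real (f i) else 0)"

lemma diag_real_carrier [simp]: "diag_real d f \<in> carrier_mat d d"
  by (simp add: diag_real_def)

lemma diag_real_dim [simp]: "dim_row (diag_real d f) = d" "dim_col (diag_real d f) = d"
  by (auto simp: diag_real_def)

lemma diag_real_index [simp]:
  "i < d \<Longrightarrow> j < d \<Longrightarrow> diag_real d f $$ (i, j) = (if i = j then complex_of_real (f i) else 0)"
  by (simp add: diag_real_def)

lemma diag_real_adjoint [simp]: "mat_adjoint (diag_real d f) = diag_real d f"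
  by (intro eq_matI) auto

lemma diag_real_cong: "(\<And>i. i < d \<Longrightarrow> f i = g i) \<Longrightarrow> diag_real d f = diag_real d g"
  by (intro eq_matI) auto

lemma index_diag_real_mult:
  assumes "A \<in> carrier_mat d m" "i < d" "j < m"
  shows "(diag_real d f * A) $$ (i, j) = complex_of_real (f i) * A $$ (i, j)"
proof -
  have "(diag_real d f * A) $$ (i, j) = (\<Sum>l<d. (if i = l then complex_of_real (f i) else 0) * A $$ (l, j))"
    using assms by (subst index_mult_mat_sum[of _ d d _ m]) simp_all
  also have "\<dots> = (\<Sum>l<d. if l = i then complex_of_real (f i) * A $$ (i, j) else 0)"
    by (rule sum.cong) auto
  finally show ?thesis using assms by (simp del: index_mult_mat(1))
qed

lemma index_mult_diag_real:
  assumes "A \<in> carrier_mat n d" "i < n" "j < d"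
  shows "(A * diag_real d f) $$ (i, j) = A $$ (i, j) * complex_of_real (f j)"
proof -
  have "(A * diag_real d f) $$ (i, j) = (\<Sum>l<d. A $$ (i, l) * (if l = j then complex_of_real (f l) else 0))"
    using assms by (subst index_mult_mat_sum[of _ n d _ d]) simp_all
  also have "\<dots> = (\<Sum>l<d. if l = j then A $$ (i, j) * complex_of_real (f j) else 0)"
    by (rule sum.cong) auto
  finally show ?thesis using assms by (simp del: index_mult_mat(1))
qed

lemma diag_real_mult: "diag_real d f * diag_real d g = diag_real d (\<lambda>i. f i * g i)"
  by (intro eq_matI) (auto simp: index_diag_real_mult[of _ d d] simp del: index_mult_mat(1))

lemma mat_trace_diag_real: "mat_trace (diag_real d f) = complex_of_real (\<Sum>i<d. f i)"
  by (auto simp: mat_trace_def)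

definition unitary_mat :: "nat \<Rightarrow> complex mat \<Rightarrow> bool" where
  "unitary_mat d U \<longleftrightarrow> U \<in> carrier_mat d d \<and> mat_adjoint U * U = 1\<^sub>m d \<and> U * mat_adjoint U = 1\<^sub>m d"

lemma unitary_matI:
  assumes "U \<in> carrier_mat d d" "mat_adjoint U * U = 1\<^sub>m d"
  shows "unitary_mat d U"
  using assms mat_mult_left_right_inverse[of "mat_adjoint U" d U] by (auto simp: unitary_mat_def)

lemma unitary_matD:
  assumes "unitary_mat d U"
  shows "U \<in> carrier_mat d d" "mat_adjoint U \<in> carrier_mat d d" "mat_adjoint U * U = 1\<^sub>m d" "U * mat_adjoint U = 1\<^sub>m d"
  using assms by (auto simp: unitary_mat_def)

lemma unitary_mat_adjoint: "unitary_mat d U \<Longrightarrow> unitary_mat d (mat_adjoint U)"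
  by (auto simp: unitary_mat_def)

lemma unitary_mult_cancel:
  assumes "unitary_mat d U" "A \<in> carrier_mat d m"
  shows "mat_adjoint U * (U * A) = A" "U * (mat_adjoint U * A) = A"
  using unitary_matD[OF assms(1)] assms(2)
  by (simp_all add: assoc_mult_mat[of _ d d _ d A m, symmetric])

lemma unitary_mult_cancel_right:
  assumes "unitary_mat d U" "A \<in> carrier_mat m d"
  shows "(A * U) * mat_adjoint U = A" "(A * mat_adjoint U) * U = A"
  using unitary_matD[OF assms(1)] assms(2)
  by (simp_all add: assoc_mult_mat[of A m d _ d _ d])

lemma unitary_mat_mult:
  assumes "unitary_mat d U" "unitary_mat d V"
  shows "unitary_mat d (U * V)"
proof (rule unitary_matI)
  note [simp] = unitary_matD(1,2)[OF assms(1)] unitary_matD(1,2)[OF assms(2)]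
  show "U * V \<in> carrier_mat d d" by simp
  have "mat_adjoint (U * V) * (U * V) = mat_adjoint V * (mat_adjoint U * (U * V))"
    by (simp add: mat_adjoint_mult[of _ d d _ d] assoc_mult_mat[of _ d d _ d _ d])
  thus "mat_adjoint (U * V) * (U * V) = 1\<^sub>m d"
    using unitary_mult_cancel(1)[OF assms(1), of V d] unitary_matD(3)[OF assms(2)] by simp
qed

lemma conj_mult_conj:
  assumes "unitary_mat d U" "A \<in> carrier_mat d d" "B \<in> carrier_mat d d"
  shows "(U * A * mat_adjoint U) * (U * B * mat_adjoint U) = U * (A * B) * mat_adjoint U"
proof -
  note [simp] = unitary_matD(1,2)[OF assms(1)] assms(2,3)
  have "(U * A * mat_adjoint U) * (U * B * mat_adjoint U) = U * A * (mat_adjoint U * (U * (B * mat_adjoint U)))"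
    by (simp add: assoc_mult_mat[of _ d d _ d _ d])
  also have "\<dots> = U * A * (B * mat_adjoint U)"
    using unitary_mult_cancel(1)[OF assms(1), of "B * mat_adjoint U" d] by simp
  finally show ?thesis by (simp add: assoc_mult_mat[of _ d d _ d _ d])
qed

lemma conj_adjoint:
  fixes U A :: "complex mat"
  assumes "U \<in> carrier_mat d d" "A \<in> carrier_mat d d"
  shows "mat_adjoint (U * A * mat_adjoint U) = U * mat_adjoint A * mat_adjoint U"
proof -
  note [simp] = assms
  have "mat_adjoint (U * A * mat_adjoint U) = U * mat_adjoint (U * A)"
    by (subst mat_adjoint_mult[of _ d d _ d]) simp_all
  also have "\<dots> = U * (mat_adjoint A * mat_adjoint U)"
    by (subst mat_adjoint_mult[of _ d d _ d]) simp_all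
  finally show ?thesis by (simp add: assoc_mult_mat[of _ d d _ d _ d])
qed

lemma mat_trace_conj:
  assumes "unitary_mat d U" "A \<in> carrier_mat d d"
  shows "mat_trace (U * A * mat_adjoint U) = mat_trace A"
proof -
  note [simp] = unitary_matD(1,2)[OF assms(1)] assms(2)
  have "mat_trace (U * A * mat_adjoint U) = mat_trace (mat_adjoint U * (U * A))"
    by (rule mat_trace_comm[of _ d d]) auto
  thus ?thesis using unitary_mult_cancel(1)[OF assms] by simp
qed

text \<open>The spectrum is nonempty over the complex numbers. The eigenvector is merely nonzero; it
  is normalized when it becomes a column of a unitary matrix.\<close>

lemma exists_unit_eigenvector:
  fixes A :: "complex mat"
  assumes "A \<in> carrier_mat d d" "d > 0"
  shows "\<exists>e v. v \<in> carrier_vec d \<and> v \<noteq> 0\<^sub>v d \<and> A *\<^sub>v v = e \<cdot>\<^sub>v v"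
proof -
  have "spectrum A \<noteq> {}" using spectrum_non_empty[OF assms(1)] assms(2) by auto
  then obtain e where "eigenvalue A e" by (auto simp: spectrum_def)
  thus ?thesis using assms by (auto simp: eigenvalue_def eigenvector_def)
qed

lemma cscalar_prod_self:
  fixes v :: "complex vec"
  shows "v \<bullet>c v = complex_of_real (\<Sum>i<dim_vec v. (cmod (v $ i))\<^sup>2)"
  by (auto simp: scalar_prod_def lessThan_atLeast0 complex_norm_square[symmetric] intro!: sum.cong)

text \<open>Complete \<open>v\<close> to a basis and orthogonalize; the Gram-Schmidt process keeps
  the first vector. It returns orthogonal vectors only, hence the division by the lengths
  \<open>n\<close> in \<open>W\<close>.\<close>

lemma exists_unitary_first_column:
  fixes v :: "complex vec"
  assumes v: "v \<in> carrier_vec d" "v \<noteq> 0\<^sub>v d"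
  shows "\<exists>W c. unitary_mat d W \<and> c \<noteq> 0 \<and> col W 0 = c \<cdot>\<^sub>v v"
proof -
  interpret cof_vec_space d "TYPE(complex)" .
  have d: "d > 0" using v by (cases d) auto
  define b where "b = basis_completion v"
  have span_b: "span (set b) = carrier_vec d" and dist_b: "distinct b"
    and indep: "\<not> lin_dep (set b)" and b: "set b \<subseteq> carrier_vec d" and hdb: "hd b = v"
    and len_b: "length b = d" using basis_completion[OF v, folded b_def] by auto
  define ws where "ws = gram_schmidt d b"
  have ws: "set ws \<subseteq> carrier_vec d" "corthogonal ws" "length ws = d"
    using gram_schmidt_result[OF b dist_b indep refl, folded ws_def] by (auto simp: len_b)
  from hdb len_b d obtain vs where bv: "b = v # vs" by (cases b) auto
  have hdws: "ws ! 0 = v"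
    using gram_schmidt_hd[OF v(1), of vs, folded bv] ws(3) d by (metis hd_conv_nth length_0_conv less_numeral_extra(3) ws_def)
  define n where "n w = sqrt (\<Sum>i<d. (cmod (w $ i))\<^sup>2)" for w :: "complex vec"
  have dimw: "dim_vec (ws ! j) = d" if "j < d" for j
    using ws that by (metis carrier_vecD nth_mem subsetD)
  have sp: "((ws ! j) \<bullet>c (ws ! i)) = (if i = j then complex_of_real ((n (ws ! i))\<^sup>2) else 0)" if "i < d" "j < d" for i j
    using corthogonalD[OF ws(2), of j i] that ws(3) dimw[OF that(2)]
    by (auto simp: cscalar_prod_self n_def sum_nonneg)
  have n0: "n (ws ! i) > 0" if "i < d" for i
  proof -
    have "((ws ! i) \<bullet>c (ws ! i)) \<noteq> 0" using corthogonalD[OF ws(2), of i i] that ws(3) by blast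
    hence "n (ws ! i) \<noteq> 0" using sp[OF that that] by auto
    thus ?thesis by (simp add: n_def less_le sum_nonneg)
  qed
  define W where "W = mat d d (\<lambda>(i, j). complex_of_real (1 / n (ws ! j)) * (ws ! j) $ i)"
  have "mat_adjoint W * W = 1\<^sub>m d"
  proof (rule eq_matI)
    fix i j assume "i < dim_row (1\<^sub>m d :: complex mat)" "j < dim_col (1\<^sub>m d :: complex mat)"
    hence ij: "i < d" "j < d" by auto
    have "(mat_adjoint W * W) $$ (i, j) = (\<Sum>l<d. cnj (W $$ (l, i)) * W $$ (l, j))"
      using ij by (subst index_mult_mat_sum[of _ d d _ d]) (auto simp: W_def)
    also have "\<dots> = (\<Sum>l<d. complex_of_real (1 / n (ws ! i) / n (ws ! j)) * ((ws ! j) $ l * cnj ((ws ! i) $ l)))"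
      using ij by (intro sum.cong) (auto simp: W_def field_simps)
    also have "\<dots> = complex_of_real (1 / n (ws ! i) / n (ws ! j)) * ((ws ! j) \<bullet>c (ws ! i))"
      using dimw ij by (simp add: scalar_prod_def sum_distrib_left lessThan_atLeast0)
    also have "\<dots> = (1\<^sub>m d) $$ (i, j)"
      using ij n0[OF ij(1)] n0[OF ij(2)] by (simp add: sp power2_eq_square)
    finally show "(mat_adjoint W * W) $$ (i, j) = (1\<^sub>m d) $$ (i, j)" .
  qed (auto simp: W_def)
  hence "unitary_mat d W" by (intro unitary_matI) (auto simp: W_def)
  moreover have "col W 0 = complex_of_real (1 / n v) \<cdot>\<^sub>v v"
    using d v hdws by (intro eq_vecI) (auto simp: W_def)
  moreover have "complex_of_real (1 / n v) \<noteq> 0" using n0[OF d] hdws by simp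
  ultimately show ?thesis by blast
qed

lemma four_block_diag_mult:
  fixes A A' B B' :: "complex mat"
  assumes "A \<in> carrier_mat n n" "A' \<in> carrier_mat n n" "B \<in> carrier_mat d d" "B' \<in> carrier_mat d d"
  shows "four_block_mat A (0\<^sub>m n d) (0\<^sub>m d n) B * four_block_mat A' (0\<^sub>m n d) (0\<^sub>m d n) B' =
    four_block_mat (A * A') (0\<^sub>m n d) (0\<^sub>m d n) (B * B')"
  using assms left_mult_zero_mat[OF assms(4), of n] right_mult_zero_mat[OF assms(3), of n]
    left_mult_zero_mat[OF assms(2), of d] right_mult_zero_mat[OF assms(1), of d]
  by (subst mult_four_block_mat[of _ n n _ d _ d _ _ n _ d]) auto

lemma four_block_unitary:
  assumes "unitary_mat d V"
  shows "unitary_mat (Suc d) (four_block_mat (1\<^sub>m 1) (0\<^sub>m 1 d) (0\<^sub>m d 1) V)"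
proof (rule unitary_matI)
  note [simp] = unitary_matD(1,2)[OF assms]
  let ?F = "four_block_mat (1\<^sub>m 1) (0\<^sub>m 1 d) (0\<^sub>m d 1) V"
  have F: "?F \<in> carrier_mat (1 + d) (1 + d)" by (rule four_block_carrier_mat) auto
  thus "?F \<in> carrier_mat (Suc d) (Suc d)" by simp
  have adj: "mat_adjoint ?F = four_block_mat (1\<^sub>m 1) (0\<^sub>m 1 d) (0\<^sub>m d 1) (mat_adjoint V)"
    using carrier_matD[OF unitary_matD(1)[OF assms]] by (intro eq_matI) auto
  have "mat_adjoint ?F * ?F = four_block_mat (1\<^sub>m 1) (0\<^sub>m 1 d) (0\<^sub>m d 1) (1\<^sub>m d)"
    unfolding adj by (subst four_block_diag_mult) (auto simp: unitary_matD[OF assms])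
  also have "\<dots> = 1\<^sub>m (Suc d)" by (intro eq_matI) auto
  finally show "mat_adjoint ?F * ?F = 1\<^sub>m (Suc d)" .
qed

text \<open>Deflation: in an orthonormal basis starting with an eigenvector the matrix has first
  column (e, 0, ..., 0). Being Hermitian, it has the same first row, and e is real. The remaining
  block is Hermitian of size \<open>d\<close>, so the induction applies.\<close>

theorem hermitian_diagonalization:
  assumes "A \<in> carrier_mat d d" "mat_adjoint A = A"
  shows "\<exists>U f. unitary_mat d U \<and> A = U * diag_real d f * mat_adjoint U"
  using assms
proof (induction d arbitrary: A)
  case 0
  thus ?case by (intro exI[of _ "1\<^sub>m 0"] exI[of _ "\<lambda>_. 0"]) (auto simp: unitary_mat_def intro!: eq_matI)
next
  case (Suc d)
  note A [simp] = Suc.prems(1)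
  obtain e v where v: "v \<in> carrier_vec (Suc d)" "v \<noteq> 0\<^sub>v (Suc d)" "A *\<^sub>v v = e \<cdot>\<^sub>v v"
    using exists_unit_eigenvector[OF Suc.prems(1)] by blast
  obtain W c where W: "unitary_mat (Suc d) W" "c \<noteq> 0" "col W 0 = c \<cdot>\<^sub>v v"
    using exists_unitary_first_column[OF v(1,2)] by blast
  note [simp] = unitary_matD(1,2)[OF W(1)]
  define B where "B = mat_adjoint W * (A * W)"
  have B [simp]: "B \<in> carrier_mat (Suc d) (Suc d)" by (simp add: B_def)
  note [simp] = carrier_matD[OF B]
  have hB: "mat_adjoint B = B"
    unfolding B_def using Suc.prems(2)
    by (simp add: mat_adjoint_mult[of _ "Suc d" "Suc d" _ "Suc d"] assoc_mult_mat[of _ "Suc d" "Suc d" _ "Suc d" _ "Suc d"])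
  have Wc: "W $$ (i, 0) = c * v $ i" if "i < Suc d" for i
    using arg_cong[OF W(3), of "\<lambda>x. x $ i"] that v carrier_matD[OF unitary_matD(1)[OF W(1)]] by simp
  have AW: "(A * W) $$ (i, 0) = e * W $$ (i, 0)" if "i < Suc d" for i
  proof -
    have "(A * W) $$ (i, 0) = c * (A *\<^sub>v v) $ i"
      using that v(1) Wc carrier_matD[OF A] by (subst index_mult_mat_sum[of _ "Suc d" "Suc d" _ "Suc d"])
         (auto simp: scalar_prod_def lessThan_atLeast0 sum_distrib_left mult_ac
           simp del: sum.op_ivl_Suc sum.lessThan_Suc intro!: sum.cong)
    thus ?thesis using v Wc[OF that] that by simp
  qed
  have B0: "B $$ (i, 0) = (if i = 0 then e else 0)" if "i < Suc d" for i
  proof -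
    have "B $$ (i, 0) = (\<Sum>l<Suc d. mat_adjoint W $$ (i, l) * (e * W $$ (l, 0)))"
      unfolding B_def using that AW
      by (subst index_mult_mat_sum[of _ "Suc d" "Suc d" _ "Suc d"]) (auto intro!: sum.cong simp del: index_mult_mat(1))
    also have "\<dots> = e * (mat_adjoint W * W) $$ (i, 0)"
      using that by (subst index_mult_mat_sum[of _ "Suc d" "Suc d" _ "Suc d"])
         (auto simp: sum_distrib_left mult_ac simp del: sum.lessThan_Suc intro!: sum.cong)
    finally show ?thesis using that unitary_matD(3)[OF W(1)] by simp
  qed
  have B0': "B $$ (0, i) = (if i = 0 then e else 0)" if "0 < i" "i < Suc d" for i
  proof -
    have "B $$ (0, i) = mat_adjoint B $$ (0, i)" by (simp add: hB)
    also have "\<dots> = cnj (B $$ (i, 0))" using that B by simp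
    finally show ?thesis using that B0[of i] by simp
  qed
  have e: "cnj e = e"
  proof -
    have "mat_adjoint B $$ (0, 0) = cnj (B $$ (0, 0))" using B by simp
    thus ?thesis by (simp add: hB B0)
  qed
  define B' where "B' = mat d d (\<lambda>(i, j). B $$ (Suc i, Suc j))"
  have B' [simp]: "B' \<in> carrier_mat d d" by (simp add: B'_def)
  have "mat_adjoint B' = B'"
  proof (rule eq_matI)
    fix i j assume "i < dim_row B'" "j < dim_col B'"
    hence ij: "i < d" "j < d" using B' by auto
    have "mat_adjoint B $$ (Suc i, Suc j) = cnj (B $$ (Suc j, Suc i))" using ij B by simp
    thus "mat_adjoint B' $$ (i, j) = B' $$ (i, j)" using ij by (simp add: B'_def hB)
  qed (simp_all add: B'_def)
  then obtain V f where V: "unitary_mat d V" and f: "B' = V * diag_real d f * mat_adjoint V"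
    using Suc.IH[OF B'] by blast
  note [simp] = unitary_matD(1,2)[OF V]
  let ?F = "four_block_mat (1\<^sub>m 1) (0\<^sub>m 1 d) (0\<^sub>m d 1) V"
  let ?D = "four_block_mat (mat 1 1 (\<lambda>_. e)) (0\<^sub>m 1 d) (0\<^sub>m d 1) (diag_real d f)"
  have F: "unitary_mat (Suc d) ?F" using four_block_unitary[OF V] .
  have adj: "mat_adjoint ?F = four_block_mat (1\<^sub>m 1) (0\<^sub>m 1 d) (0\<^sub>m d 1) (mat_adjoint V)"
    using carrier_matD[OF unitary_matD(1)[OF V]] by (intro eq_matI) auto
  have D: "?D = diag_real (Suc d) (\<lambda>i. if i = 0 then Re e else f (i - 1))"
    using e by (intro eq_matI) (auto simp: complex_eq_iff)
  have "?F * ?D * mat_adjoint ?F = four_block_mat (mat 1 1 (\<lambda>_. e)) (0\<^sub>m 1 d) (0\<^sub>m d 1) (V * diag_real d f * mat_adjoint V)"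
    unfolding adj
    by (subst four_block_diag_mult, simp_all)+
  also have "\<dots> = B"
    unfolding f[symmetric] using B B0 B0'
    by (intro eq_matI) (auto simp: B'_def)
  finally have BF: "B = ?F * ?D * mat_adjoint ?F" by simp
  have "A = W * B * mat_adjoint W"
    unfolding B_def using unitary_mult_cancel(2)[OF W(1), of "A * W" "Suc d"] unitary_mult_cancel_right(1)[OF W(1) A]
    by simp
  also have "\<dots> = (W * ?F) * ?D * mat_adjoint (W * ?F)"
    unfolding BF using unitary_matD(1,2)[OF F] D
    by (simp add: mat_adjoint_mult[of _ "Suc d" "Suc d" _ "Suc d"] assoc_mult_mat[of _ "Suc d" "Suc d" _ "Suc d" _ "Suc d"])
  finally have "A = (W * ?F) * ?D * mat_adjoint (W * ?F)" .
  thus ?case unfolding D using unitary_mat_mult[OF W(1) F] by blast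
qed

lemma diag_real_smult: "complex_of_real a \<cdot>\<^sub>m diag_real d f = diag_real d (\<lambda>i. a * f i)"
  by (intro eq_matI) auto

section \<open>Positive semidefinite matrices and the polar decomposition\<close>

lemma adjoint_cscalar_prod:
  fixes M :: "complex mat"
  assumes "M \<in> carrier_mat n m" "w \<in> carrier_vec n" "v \<in> carrier_vec m"
  shows "(mat_adjoint M *\<^sub>v w) \<bullet>c v = w \<bullet>c (M *\<^sub>v v)"
proof -
  note [simp] = carrier_matD[OF assms(1)] carrier_vecD[OF assms(2)] carrier_vecD[OF assms(3)]
  have "(mat_adjoint M *\<^sub>v w) \<bullet>c v = (\<Sum>j<m. \<Sum>i<n. cnj (M $$ (i, j)) * w $ i * cnj (v $ j))"
    by (simp add: scalar_prod_def lessThan_atLeast0 sum_distrib_right)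
  also have "\<dots> = (\<Sum>i<n. \<Sum>j<m. cnj (M $$ (i, j)) * w $ i * cnj (v $ j))"
    by (rule sum.swap)
  also have "\<dots> = w \<bullet>c (M *\<^sub>v v)"
    by (simp add: scalar_prod_def lessThan_atLeast0 sum_distrib_left mult_ac)
  finally show ?thesis .
qed

lemma psd_matD:
  assumes "psd_mat d A"
  shows "A \<in> carrier_mat d d" "mat_adjoint A = A"
  using assms by (auto simp: psd_mat_def)

lemma psd_mat_gram:
  assumes "M \<in> carrier_mat n d"
  shows "psd_mat d (mat_adjoint M * M)"
  unfolding psd_mat_def
proof (intro conjI ballI)
  show c: "mat_adjoint M * M \<in> carrier_mat d d" using assms by (intro mult_carrier_mat[of _ d n]) simp_all
  show "mat_adjoint (mat_adjoint M * M) = mat_adjoint M * M"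
    using assms by (simp add: mat_adjoint_mult[of _ d n _ d])
  fix v :: "complex vec" assume v: "v \<in> carrier_vec d"
  have "(mat_adjoint M * M *\<^sub>v v) \<bullet>c v = (M *\<^sub>v v) \<bullet>c (M *\<^sub>v v)"
    using assms v by (simp add: assoc_mult_mat_vec[of _ d n _ d] adjoint_cscalar_prod[of M n d])
  also have "\<dots> \<ge> 0"
    by (simp add: cscalar_prod_self sum_nonneg less_eq_complex_def del: dim_mult_mat_vec)
  finally show "0 \<le> (mat_adjoint M * M *\<^sub>v v) \<bullet>c v" .
qed

text \<open>Exhibits the matrix as a Gram matrix, from which positivity is read off.\<close>

lemma conj_diag_real_eq_gram:
  assumes "unitary_mat d U" "\<And>i. i < d \<Longrightarrow> f i \<ge> 0"
  shows "U * diag_real d f * mat_adjoint U =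
    mat_adjoint (diag_real d (\<lambda>i. sqrt (f i)) * mat_adjoint U) * (diag_real d (\<lambda>i. sqrt (f i)) * mat_adjoint U)"
proof -
  note [simp] = unitary_matD(1,2)[OF assms(1)]
  have "diag_real d (\<lambda>i. sqrt (f i)) * diag_real d (\<lambda>i. sqrt (f i)) = diag_real d f"
    unfolding diag_real_mult using assms(2) by (intro diag_real_cong) simp
  hence "diag_real d (\<lambda>i. sqrt (f i)) * (diag_real d (\<lambda>i. sqrt (f i)) * mat_adjoint U) = diag_real d f * mat_adjoint U"
    by (simp add: assoc_mult_mat[of _ d d _ d _ d, symmetric])
  thus ?thesis by (simp add: mat_adjoint_mult[of _ d d _ d] assoc_mult_mat[of _ d d _ d _ d])
qed

lemma psd_mat_conj_diag:
  assumes "unitary_mat d U" "\<And>i. i < d \<Longrightarrow> f i \<ge> 0"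
  shows "psd_mat d (U * diag_real d f * mat_adjoint U)"
proof -
  have "psd_mat d (mat_adjoint (diag_real d (\<lambda>i. sqrt (f i)) * mat_adjoint U) * (diag_real d (\<lambda>i. sqrt (f i)) * mat_adjoint U))"
    using unitary_matD(1)[OF assms(1)] by (intro psd_mat_gram[of _ d]) simp
  thus ?thesis using conj_diag_real_eq_gram[OF assms] by simp
qed

text \<open>The eigenvalues are the values of the quadratic form at the columns of
  \<open>U\<close>.\<close>

lemma psd_mat_diagonalization:
  assumes "psd_mat d A"
  shows "\<exists>U f. unitary_mat d U \<and> (\<forall>i. f i \<ge> 0) \<and> A = U * diag_real d f * mat_adjoint U"
proof -
  obtain U f where U: "unitary_mat d U" and A: "A = U * diag_real d f * mat_adjoint U"
    using hermitian_diagonalization[OF psd_matD[OF assms]] by blast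
  note [simp] = unitary_matD(1,2)[OF U] carrier_matD[OF unitary_matD(1)[OF U]]
  have "f i \<ge> 0" if i: "i < d" for i
  proof -
    have AU: "A * U = U * diag_real d f"
      unfolding A using unitary_mult_cancel_right(2)[OF U, of "U * diag_real d f" d] by simp
    have "(A *\<^sub>v col U i) \<bullet>c col U i = (\<Sum>l<d. (A * U) $$ (l, i) * cnj (U $$ (l, i)))"
      using i carrier_matD[OF psd_matD(1)[OF assms]]
      by (simp add: scalar_prod_def lessThan_atLeast0)
    also have "\<dots> = (\<Sum>l<d. mat_adjoint U $$ (i, l) * (U * diag_real d f) $$ (l, i))"
      unfolding AU using i by (intro sum.cong) (auto simp: mult_ac)
    also have "\<dots> = (mat_adjoint U * (U * diag_real d f)) $$ (i, i)"
      using i by (subst index_mult_mat_sum[of _ d d _ d]) simp_all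
    also have "\<dots> = complex_of_real (f i)"
      using unitary_mult_cancel(1)[OF U, of "diag_real d f" d] i by simp
    finally have "(A *\<^sub>v col U i) \<bullet>c col U i = complex_of_real (f i)" .
    moreover have "0 \<le> (A *\<^sub>v col U i) \<bullet>c col U i"
      using assms i unfolding psd_mat_def by (auto intro!: carrier_vecI)
    ultimately show ?thesis by (simp add: less_eq_complex_def)
  qed
  \<comment> \<open>Only the indices below \<open>d\<close> matter; truncating at 0 makes
    \<open>f\<close> nonnegative everywhere and spares later side conditions.\<close>
  moreover have "diag_real d f = diag_real d (\<lambda>i. max 0 (f i))"
    using calculation by (intro diag_real_cong) (auto simp: max_def)
  ultimately show ?thesis using U A by (intro exI[of _ U] exI[of _ "\<lambda>i. max 0 (f i)"]) auto
qed

text \<open>In the eigenbases of \<open>B\<close> and \<open>C\<close> the hypothesis says (b_i^2 -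
  c_j^2) M_ij = 0 for the change of basis \<open>M\<close>. As b_i and c_j are nonnegative, (b_i -
  c_j) M_ij = 0 follows, which is \<open>B = C\<close>. Multiple eigenvalues need no separate
  treatment.\<close>

lemma psd_sqrt_unique:
  assumes "psd_mat d B" "psd_mat d C" "B * B = C * C"
  shows "B = C"
proof -
  obtain U b where U: "unitary_mat d U" and b: "\<And>i. b i \<ge> 0" and B: "B = U * diag_real d b * mat_adjoint U"
    using psd_mat_diagonalization[OF assms(1)] by blast
  obtain V c where V: "unitary_mat d V" and c: "\<And>i. c i \<ge> 0" and C: "C = V * diag_real d c * mat_adjoint V"
    using psd_mat_diagonalization[OF assms(2)] by blast
  note [simp] = unitary_matD(1,2)[OF U] unitary_matD(1,2)[OF V]
  define M where "M = mat_adjoint U * V"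
  have M [simp]: "M \<in> carrier_mat d d" by (simp add: M_def)
  \<comment> \<open>Two diagonalized matrices are equal exactly if \<open>M\<close> intertwines
    their diagonals; this is used once for the squares and once for the roots.\<close>
  have key: "diag_real d f * M = M * diag_real d g \<longleftrightarrow> U * diag_real d f * mat_adjoint U = V * diag_real d g * mat_adjoint V"
    for f g
  proof -
    have *: "diag_real d f * M = mat_adjoint U * ((U * diag_real d f * mat_adjoint U) * V)"
      using unitary_mult_cancel(1)[OF U, of "diag_real d f * (mat_adjoint U * V)" d]
      by (simp add: M_def assoc_mult_mat[of _ d d _ d _ d])
    have **: "M * diag_real d g = mat_adjoint U * ((V * diag_real d g * mat_adjoint V) * V)"
      using unitary_mult_cancel_right(2)[OF V, of "V * diag_real d g" d]
      by (simp add: M_def assoc_mult_mat[of _ d d _ d _ d])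
    show ?thesis
    proof
      assume "diag_real d f * M = M * diag_real d g"
      hence "U * (mat_adjoint U * ((U * diag_real d f * mat_adjoint U) * V)) * mat_adjoint V =
             U * (mat_adjoint U * ((V * diag_real d g * mat_adjoint V) * V)) * mat_adjoint V"
        using * ** by simp
      thus "U * diag_real d f * mat_adjoint U = V * diag_real d g * mat_adjoint V"
        using unitary_mult_cancel(2)[OF U, of "(U * diag_real d f * mat_adjoint U) * V" d]
          unitary_mult_cancel(2)[OF U, of "(V * diag_real d g * mat_adjoint V) * V" d]
          unitary_mult_cancel_right(1)[OF V, of "U * diag_real d f * mat_adjoint U" d]
          unitary_mult_cancel_right(1)[OF V, of "V * diag_real d g * mat_adjoint V" d]
        by simp
    next
      assume "U * diag_real d f * mat_adjoint U = V * diag_real d g * mat_adjoint V"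
      thus "diag_real d f * M = M * diag_real d g" by (simp add: * **)
    qed
  qed
  have "U * diag_real d (\<lambda>i. b i * b i) * mat_adjoint U = V * diag_real d (\<lambda>i. c i * c i) * mat_adjoint V"
    using assms(3) unfolding B C conj_mult_conj[OF U diag_real_carrier diag_real_carrier]
      conj_mult_conj[OF V diag_real_carrier diag_real_carrier] diag_real_mult .
  hence 1: "diag_real d (\<lambda>i. b i * b i) * M = M * diag_real d (\<lambda>i. c i * c i)" using key by blast
  have "diag_real d b * M = M * diag_real d c"
  proof (rule eq_matI)
    fix i j assume "i < dim_row (M * diag_real d c)" "j < dim_col (M * diag_real d c)"
    hence ij: "i < d" "j < d" using carrier_matD[OF M] by auto
    have "(complex_of_real (b i))\<^sup>2 * M $$ (i, j) = M $$ (i, j) * (complex_of_real (c j))\<^sup>2"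
      using arg_cong[OF 1, of "\<lambda>A. A $$ (i, j)"] ij
      by (simp add: index_diag_real_mult[OF M ij] index_mult_diag_real[OF M ij] power2_eq_square del: index_mult_mat(1))
    hence "M $$ (i, j) = 0 \<or> (complex_of_real (b i))\<^sup>2 = (complex_of_real (c j))\<^sup>2" by auto
    hence "M $$ (i, j) = 0 \<or> b i = c j"
      using b[of i] c[of j] by (metis of_real_eq_iff of_real_power power2_eq_imp_eq)
    thus "(diag_real d b * M) $$ (i, j) = (M * diag_real d c) $$ (i, j)"
      by (auto simp: index_diag_real_mult[OF M ij] index_mult_diag_real[OF M ij] simp del: index_mult_mat(1))
  qed (use carrier_matD[OF M] in auto)
  thus ?thesis using key B C by blast
qed

lemma psd_sqrt_eqI:
  assumes "psd_mat d B" "B * B = A"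
  shows "psd_sqrt A = B"
proof -
  have d: "dim_row A = d" using assms psd_matD(1)[OF assms(1)] by auto
  show ?thesis unfolding psd_sqrt_def d
    by (rule the_equality) (use assms psd_sqrt_unique in auto)
qed

lemma psd_sqrt_conj_diag:
  assumes "unitary_mat d U" "\<And>i. i < d \<Longrightarrow> f i \<ge> 0"
  shows "psd_sqrt (U * diag_real d f * mat_adjoint U) = U * diag_real d (\<lambda>i. sqrt (f i)) * mat_adjoint U"
proof (rule psd_sqrt_eqI)
  show "psd_mat d (U * diag_real d (\<lambda>i. sqrt (f i)) * mat_adjoint U)"
    using assms by (intro psd_mat_conj_diag) auto
  have "diag_real d (\<lambda>i. sqrt (f i) * sqrt (f i)) = diag_real d f"
    using assms(2) by (intro diag_real_cong) auto
  thus "U * diag_real d (\<lambda>i. sqrt (f i)) * mat_adjoint U * (U * diag_real d (\<lambda>i. sqrt (f i)) * mat_adjoint U) =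
    U * diag_real d f * mat_adjoint U"
    unfolding conj_mult_conj[OF assms(1) diag_real_carrier diag_real_carrier] diag_real_mult by simp
qed

lemma psd_sqrt:
  assumes "psd_mat d A"
  shows "psd_mat d (psd_sqrt A)" "psd_sqrt A * psd_sqrt A = A"
proof -
  obtain U f where U: "unitary_mat d U" and f: "\<And>i. f i \<ge> 0" and A: "A = U * diag_real d f * mat_adjoint U"
    using psd_mat_diagonalization[OF assms] by blast
  have s: "psd_sqrt A = U * diag_real d (\<lambda>i. sqrt (f i)) * mat_adjoint U"
    unfolding A using U f by (intro psd_sqrt_conj_diag)
  show "psd_mat d (psd_sqrt A)" unfolding s using U f by (intro psd_mat_conj_diag) auto
  show "psd_sqrt A * psd_sqrt A = A"
    unfolding s conj_mult_conj[OF U diag_real_carrier diag_real_carrier] diag_real_mult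
    using f by (simp add: A)
qed

lemma psd_mat_trace_nonneg:
  assumes "psd_mat d A"
  shows "Re (mat_trace A) \<ge> 0"
proof -
  obtain U f where "unitary_mat d U" "\<And>i. f i \<ge> 0" "A = U * diag_real d f * mat_adjoint U"
    using psd_mat_diagonalization[OF assms] by blast
  thus ?thesis by (simp add: mat_trace_conj mat_trace_diag_real sum_nonneg)
qed

lemma psd_mat_zero: "psd_mat d (0\<^sub>m d d)"
  using psd_mat_gram[of "0\<^sub>m d d" d d] by simp

lemma psd_mat_add:
  assumes "psd_mat d A" "psd_mat d B"
  shows "psd_mat d (A + B)"
proof -
  note AB = psd_matD[OF assms(1)] psd_matD[OF assms(2)]
  have "((A + B) *\<^sub>v v) \<bullet>c v = (A *\<^sub>v v) \<bullet>c v + (B *\<^sub>v v) \<bullet>c v" if "v \<in> carrier_vec d" for v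
    using AB that by (simp add: add_mult_distrib_mat_vec[of _ d d] add_scalar_prod_distrib[of _ d])
  thus ?thesis using assms AB unfolding psd_mat_def by (auto simp: mat_adjoint_add[of _ d d])
qed

lemma psd_mat_mat_sum:
  assumes "finite I" "\<And>k. k \<in> I \<Longrightarrow> psd_mat d (A k)"
  shows "psd_mat d (mat_sum d A I)"
  using assms
proof (induction I rule: finite_induct)
  interpret M: abelian_group "module_mat TYPE(complex) d d" by (rule abelian_group_mat)
  {
    case empty
    show ?case by (simp add: mat_sum_def module_mat_simps psd_mat_zero)
  next
    case (insert x F)
    have "mat_sum d A (insert x F) = A x + mat_sum d A F"
      unfolding mat_sum_def using insert psd_matD(1)
      by (subst M.finsum_insert) (auto simp: module_mat_simps)
    thus ?case using insert by (auto intro: psd_mat_add)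
  }
qed

lemma mat_abs_psd:
  assumes "X \<in> carrier_mat d d"
  shows "psd_mat d (mat_abs X)" "mat_abs X * mat_abs X = mat_adjoint X * X"
  unfolding mat_abs_def using psd_sqrt[OF psd_mat_gram[OF assms]] by auto

lemma mat_abs_carrier [simp]: "X \<in> carrier_mat d d \<Longrightarrow> mat_abs X \<in> carrier_mat d d"
  using mat_abs_psd psd_matD by blast

lemma mat_abs_adjoint [simp]: "X \<in> carrier_mat d d \<Longrightarrow> mat_adjoint (mat_abs X) = mat_abs X"
  using mat_abs_psd psd_matD by blast

lemma mat_abs_of_psd: "psd_mat d A \<Longrightarrow> mat_abs A = A"
  unfolding mat_abs_def by (rule psd_sqrt_eqI) (auto simp: psd_matD)

definition partial_isometry :: "nat \<Rightarrow> complex mat \<Rightarrow> bool" where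
  "partial_isometry d W \<longleftrightarrow> W \<in> carrier_mat d d \<and> W * mat_adjoint W * W = W"

lemma partial_isometry_adjoint:
  assumes "partial_isometry d W"
  shows "partial_isometry d (mat_adjoint W)"
proof -
  have W [simp]: "W \<in> carrier_mat d d" and eq: "W * mat_adjoint W * W = W"
    using assms by (auto simp: partial_isometry_def)
  have "mat_adjoint W = mat_adjoint (W * mat_adjoint W * W)" by (simp add: eq)
  also have "\<dots> = mat_adjoint W * W * mat_adjoint W"
    by (simp add: mat_adjoint_mult[of _ d d _ d] assoc_mult_mat[of _ d d _ d _ d])
  finally show ?thesis by (simp add: partial_isometry_def)
qed

text \<open>\<open>W\<close> is the adjoint of the usual polar factor, namely the pseudo-inverse of
  |X| times X^*. The same \<open>W\<close> turns \<open>X\<close> into |X| from the left and into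
  |X^*| from the right, which is how it is used below. A partial isometry suffices, so no extension
  to a unitary is needed.\<close>

theorem polar_decomposition:
  assumes X: "X \<in> carrier_mat d d"
  obtains W where "partial_isometry d W" "W * X = mat_abs X" "X * W = mat_abs (mat_adjoint X)"
    "mat_adjoint W * mat_abs X = X"
proof -
  obtain V s where V: "unitary_mat d V" and s: "\<And>i. s i \<ge> 0" and A: "mat_abs X = V * diag_real d s * mat_adjoint V"
    using psd_mat_diagonalization[OF mat_abs_psd(1)[OF X]] by blast
  \<comment> \<open>\<open>t\<close> inverts the nonzero singular values and \<open>p\<close> marks
    them: \<open>c t\<close> is the pseudo-inverse of |X|, and \<open>c p\<close> the projection
    onto its range.\<close>
  define t where "t i = (if s i = 0 then 0 else 1 / s i)" for i
  define p where "p i = (if s i = 0 then 0 else 1 :: real)" for i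
  define c where "c f = V * diag_real d f * mat_adjoint V" for f
  have c [simp]: "c f \<in> carrier_mat d d" for f using V by (auto simp: c_def unitary_mat_def)
  have cc: "c f * c g = c (\<lambda>i. f i * g i)" for f g
    unfolding c_def conj_mult_conj[OF V diag_real_carrier diag_real_carrier] diag_real_mult ..
  have cadj [simp]: "mat_adjoint (c f) = c f" for f
    unfolding c_def using conj_adjoint[OF unitary_matD(1)[OF V], of "diag_real d f"] by simp
  have [simp]: "X \<in> carrier_mat d d" by fact
  have XX: "mat_adjoint X * X = c (\<lambda>i. s i * s i)"
    using mat_abs_psd(2)[OF X] cc[of s s] by (simp add: A c_def)
  have c1: "c (\<lambda>_. 1) = 1\<^sub>m d"
  proof -
    have "diag_real d (\<lambda>_. 1) = 1\<^sub>m d" by (intro eq_matI) auto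
    thus ?thesis using unitary_matD[OF V] by (simp add: c_def)
  qed
  have cminus: "c f - c g = c (\<lambda>i. f i - g i)" for f g
  proof -
    have "diag_real d (\<lambda>i. f i - g i) = diag_real d f - diag_real d g" by (intro eq_matI) auto
    thus ?thesis using unitary_matD(1,2)[OF V]
      by (simp add: c_def minus_mult_distrib_mat[of _ d d _ _ d] mult_minus_distrib_mat[of _ d d _ d])
  qed
  \<comment> \<open>\<open>X\<close> vanishes on the kernel of |X| because X^* X = |X|^2;
    concretely, the product of \<open>X\<close> with \<open>c p - 1\<close> has Gram matrix
    0.\<close>
  have Xp: "X * c p = X"
  proof -
    have "X * c p - X = X * c (\<lambda>i. p i - 1)"
      unfolding cminus[symmetric] c1 by (simp add: mult_minus_distrib_mat[of _ d d _ d] right_mult_one_mat[OF X])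
    moreover have "hs_norm (X * c (\<lambda>i. p i - 1)) = 0"
    proof -
      have "mat_adjoint (X * c (\<lambda>i. p i - 1)) * (X * c (\<lambda>i. p i - 1)) = c (\<lambda>i. p i - 1) * (mat_adjoint X * X) * c (\<lambda>i. p i - 1)"
        by (simp add: mat_adjoint_mult[of _ d d _ d] assoc_mult_mat[of _ d d _ d _ d])
      also have "\<dots> = c (\<lambda>_. 0)"
        unfolding XX cc by (rule arg_cong[where f = c]) (auto simp: p_def)
      also have "\<dots> = 0\<^sub>m d d"
        using cminus[of p p] c[of p] by simp
      finally show ?thesis by (simp add: hs_norm_def hs_inner_def mat_trace_def)
    qed
    ultimately have "X * c p - X = 0\<^sub>m d d" by (subst (asm) hs_norm_zero_iff[of _ d d]) auto
    hence "(X * c p - X) $$ (i, j) = 0" if "i < d" "j < d" for i j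
      using that by simp
    thus ?thesis using carrier_matD[OF X] carrier_matD[OF c]
      by (intro eq_matI) (auto simp del: index_mult_mat(1))
  qed
  define W where "W = c t * mat_adjoint X"
  have [simp]: "W \<in> carrier_mat d d" by (simp add: W_def)
  have adjW: "mat_adjoint W = X * c t" by (simp add: W_def mat_adjoint_mult[of _ d d _ d])
  have WX: "W * X = c s"
  proof -
    have "W * X = c t * (mat_adjoint X * X)" by (simp add: W_def assoc_mult_mat[of _ d d _ d _ d])
    also have "\<dots> = c s" unfolding XX cc by (rule arg_cong[where f = c]) (auto simp: t_def)
    finally show ?thesis .
  qed
  have WW: "W * mat_adjoint W = c p"
  proof -
    have "W * mat_adjoint W = W * X * c t" unfolding adjW by (simp add: assoc_mult_mat[of _ d d _ d _ d])
    also have "\<dots> = c p" unfolding WX cc by (rule arg_cong[where f = c]) (auto simp: t_def p_def)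
    finally show ?thesis .
  qed
  have pt: "c p * c t = c t" unfolding cc by (rule arg_cong[where f = c]) (auto simp: t_def p_def)
  show thesis
  proof (rule that)
    have "c p * W = W" using pt by (simp add: W_def assoc_mult_mat[of _ d d _ d _ d, symmetric])
    thus "partial_isometry d W" by (simp add: partial_isometry_def WW)
    show "W * X = mat_abs X" by (simp add: WX A c_def)
    have "mat_adjoint W * c s = X * (c t * c s)" unfolding adjW by (simp add: assoc_mult_mat[of _ d d _ d _ d])
    also have "c t * c s = c p" unfolding cc by (rule arg_cong[where f = c]) (auto simp: t_def p_def)
    finally show "mat_adjoint W * mat_abs X = X" by (simp add: Xp A c_def[symmetric])
    \<comment> \<open>Uniqueness of the square root: \<open>X * W\<close> is positive, being X t X^*
      with the pseudo-inverse t, and its square is X X^* because the projection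
      \<open>c s * c t\<close> is absorbed by \<open>X\<close>.\<close>
    have "mat_abs (mat_adjoint X) = X * W"
      unfolding mat_abs_def
    proof (rule psd_sqrt_eqI)
      define T where "T = diag_real d (\<lambda>i. sqrt (t i)) * mat_adjoint V * mat_adjoint X"
      have [simp]: "V \<in> carrier_mat d d" "T \<in> carrier_mat d d" using unitary_matD[OF V] by (auto simp: T_def)
      have t0: "t i \<ge> 0" for i using s[of i] by (simp add: t_def)
      have "c t = mat_adjoint (diag_real d (\<lambda>i. sqrt (t i)) * mat_adjoint V) * (diag_real d (\<lambda>i. sqrt (t i)) * mat_adjoint V)"
        unfolding c_def using V t0 by (intro conj_diag_real_eq_gram)
      hence "X * W = mat_adjoint T * T"
        by (simp add: W_def T_def mat_adjoint_mult[of _ d d _ d] assoc_mult_mat[of _ d d _ d _ d])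
      thus "psd_mat d (X * W)" using psd_mat_gram[of T d d] by simp
      have "X * W * (X * W) = X * (c s * c t) * mat_adjoint X"
        unfolding WX[symmetric] by (simp add: W_def assoc_mult_mat[of _ d d _ d _ d])
      also have "c s * c t = c p" unfolding cc by (rule arg_cong[where f = c]) (auto simp: t_def p_def)
      finally show "X * W * (X * W) = mat_adjoint (mat_adjoint X) * mat_adjoint X" by (simp add: Xp)
    qed
    thus "X * W = mat_abs (mat_adjoint X)" ..
  qed
qed

section \<open>Trace inequalities\<close>

lemma hs_inner_commute:
  assumes "A \<in> carrier_mat n m" "B \<in> carrier_mat n m"
  shows "hs_inner A B = hs_inner B A"
  using assms by (simp add: hs_inner_sum[of _ n m] mult.commute)

lemma hs_inner_add_right:
  assumes "A \<in> carrier_mat n m" "B \<in> carrier_mat n m" "C \<in> carrier_mat n m"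
  shows "hs_inner A (B + C) = hs_inner A B + hs_inner A C"
  using assms by (simp add: hs_inner_sum[of _ n m] sum.distrib algebra_simps)

lemma hs_inner_minus_right:
  assumes "A \<in> carrier_mat n m" "B \<in> carrier_mat n m" "C \<in> carrier_mat n m"
  shows "hs_inner A (B - C) = hs_inner A B - hs_inner A C"
  using assms by (simp add: hs_inner_sum[of _ n m] minus_carrier_mat sum_subtractf sum.distrib algebra_simps)

lemma hs_inner_minus_left:
  assumes "A \<in> carrier_mat n m" "B \<in> carrier_mat n m" "C \<in> carrier_mat n m"
  shows "hs_inner (A - B) C = hs_inner A C - hs_inner B C"
  using assms by (simp add: hs_inner_sum[of _ n m] minus_carrier_mat sum_subtractf sum.distrib algebra_simps)

lemma hs_inner_diff_self:
  assumes "A \<in> carrier_mat n m" "B \<in> carrier_mat n m"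
  shows "hs_inner (A - B) (A - B) = hs_inner A A + hs_inner B B - 2 * hs_inner A B"
  using assms hs_inner_commute[OF assms]
  by (simp add: hs_inner_minus_right[of _ n m] hs_inner_minus_left[of _ n m] minus_carrier_mat)

lemma hs_inner_mult_left:
  assumes "A \<in> carrier_mat d d" "B \<in> carrier_mat d d" "C \<in> carrier_mat d d"
  shows "hs_inner (A * B) C = hs_inner B (mat_adjoint A * C)"
  using assms by (simp add: hs_inner_def mat_adjoint_mult[of _ d d _ d] assoc_mult_mat[of _ d d _ d _ d])

lemma hs_inner_mult_right:
  assumes "A \<in> carrier_mat d d" "B \<in> carrier_mat d d" "C \<in> carrier_mat d d"
  shows "hs_inner (A * B) C = hs_inner A (C * mat_adjoint B)"
proof -
  have "mat_trace (mat_adjoint B * (mat_adjoint A * C)) = mat_trace (mat_adjoint A * C * mat_adjoint B)"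
    using assms by (intro mat_trace_comm[of _ d d]) auto
  thus ?thesis
    using assms by (simp add: hs_inner_def mat_adjoint_mult[of _ d d _ d] assoc_mult_mat[of _ d d _ d _ d])
qed

lemma hs_inner_adjoint:
  assumes "A \<in> carrier_mat d d" "B \<in> carrier_mat d d"
  shows "hs_inner (mat_adjoint A) (mat_adjoint B) = hs_inner A B"
proof -
  have "hs_inner (mat_adjoint A) (mat_adjoint B) = hs_inner B A"
    using assms mat_trace_comm[of A d d "mat_adjoint B"] by (simp add: hs_inner_def)
  thus ?thesis using hs_inner_commute[OF assms] by simp
qed

lemma partial_isometry_carrier: "partial_isometry d W \<Longrightarrow> W \<in> carrier_mat d d"
  by (simp add: partial_isometry_def)

text \<open>Since ||W^* W A|| = ||W A||, Cauchy-Schwarz bounds ||W A||^2 = <A, W^* W A> by ||A|| ||W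
  A||.\<close>

lemma partial_isometry_hs_norm_le:
  assumes "partial_isometry d W" "A \<in> carrier_mat d d"
  shows "hs_norm (W * A) \<le> hs_norm A"
proof -
  have W [simp]: "W \<in> carrier_mat d d" using assms(1) by (rule partial_isometry_carrier)
  note [simp] = assms(2)
  have "hs_inner (W * A) (W * A) = hs_inner A (mat_adjoint W * (W * A))"
    by (rule hs_inner_mult_left[of _ d]) auto
  moreover have "hs_inner (mat_adjoint W * (W * A)) (mat_adjoint W * (W * A)) = hs_inner (W * A) (W * A)"
  proof -
    have "hs_inner (mat_adjoint W * (W * A)) (mat_adjoint W * (W * A)) = hs_inner (W * A) (W * (mat_adjoint W * (W * A)))"
      by (subst hs_inner_mult_left[of _ d]) auto
    also have "W * (mat_adjoint W * (W * A)) = W * mat_adjoint W * W * A"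
      by (simp add: assoc_mult_mat[of _ d d _ d _ d])
    also have "\<dots> = W * A" using assms(1) by (simp add: partial_isometry_def)
    finally show ?thesis .
  qed
  moreover have "hs_inner A (mat_adjoint W * (W * A)) \<le> hs_norm A * hs_norm (mat_adjoint W * (W * A))"
    by (rule hs_inner_le[of _ d d]) auto
  ultimately have "(hs_norm (W * A))\<^sup>2 \<le> hs_norm A * hs_norm (W * A)"
    unfolding hs_norm_square by (simp add: hs_norm_def[of "mat_adjoint W * (W * A)"] hs_norm_def[of "W * A"])
  thus ?thesis
    by (metis hs_norm_nonneg mult_right_le_imp_le order_le_less power2_eq_square)
qed

text \<open>A diagonal entry p is the squared norm of its column, so p >= p^2.\<close>

lemma projection_diag_le_one:
  assumes "P \<in> carrier_mat d d" "mat_adjoint P = P" "P * P = P" "i < d"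
  shows "Re (P $$ (i, i)) \<le> 1"
proof -
  have "(P * P) $$ (i, i) = (\<Sum>k<d. mat_adjoint P $$ (i, k) * P $$ (k, i))"
    using assms by (subst index_mult_mat_sum[of _ d d _ d]) auto
  also have "\<dots> = (\<Sum>k<d. cnj (P $$ (k, i)) * P $$ (k, i))"
    using assms(1,4) by (intro sum.cong) auto
  finally have "Re (P $$ (i, i)) = (\<Sum>k<d. (cmod (P $$ (k, i)))\<^sup>2)"
    using assms(3) by (simp add: cmod_def power2_eq_square del: index_mult_mat(1))
  moreover have "(cmod (P $$ (i, i)))\<^sup>2 \<le> (\<Sum>k<d. (cmod (P $$ (k, i)))\<^sup>2)"
    using assms(4) by (intro member_le_sum) auto
  ultimately have "(Re (P $$ (i, i)))\<^sup>2 \<le> Re (P $$ (i, i))"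
    using cmod_power2[of "P $$ (i, i)"] zero_le_power2[of "Im (P $$ (i, i))"] by linarith
  moreover have "Re (P $$ (i, i)) * 1 < Re (P $$ (i, i)) * Re (P $$ (i, i))" if "Re (P $$ (i, i)) > 1"
    using that by (intro mult_strict_left_mono) auto
  ultimately show ?thesis
    by (cases "Re (P $$ (i, i)) > 1") (auto simp: power2_eq_square)
qed

definition col_norm :: "complex mat \<Rightarrow> nat \<Rightarrow> real" where
  "col_norm A i = L2_set (\<lambda>k. cmod (A $$ (k, i))) {..<dim_row A}"

lemma col_norm_nonneg [simp]: "col_norm A i \<ge> 0"
  by (simp add: col_norm_def)

lemma col_norm_square:
  assumes "A \<in> carrier_mat n m" "i < m"
  shows "(col_norm A i)\<^sup>2 = Re ((mat_adjoint A * A) $$ (i, i))"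
proof -
  have "(mat_adjoint A * A) $$ (i, i) = (\<Sum>k<n. cnj (A $$ (k, i)) * A $$ (k, i))"
    using assms by (subst index_mult_mat_sum[of _ m n _ m]) auto
  thus ?thesis using assms
    by (simp add: col_norm_def L2_set_def sum_nonneg cmod_def power2_eq_square[of "Re _"] power2_eq_square[of "Im _"])
qed

text \<open>With u_i the columns of \<open>U\<close>, the trace is the sum of <W^* u_i, M u_i>, and
  W^* does not lengthen u_i. The freedom in \<open>U\<close> matters: an eigenbasis of |M| gives the
  trace norm, while the lower bound needs one basis for all outcomes.\<close>

lemma trace_partial_isometry_le:
  assumes W: "partial_isometry d W" and U: "unitary_mat d U" and M: "M \<in> carrier_mat d d"
  shows "Re (mat_trace (W * M)) \<le> (\<Sum>i<d. col_norm (M * U) i)"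
proof -
  note [simp] = partial_isometry_carrier[OF W] unitary_matD(1,2)[OF U] M
    carrier_matD[OF partial_isometry_carrier[OF W]] carrier_matD[OF unitary_matD(1)[OF U]] carrier_matD[OF M]
  \<comment> \<open>A projection whose diagonal entries are the squared lengths of the vectors W^*
    u_i.\<close>
  define P where "P = mat_adjoint U * (W * mat_adjoint W) * U"
  have "mat_trace (W * M) = mat_trace (mat_adjoint U * (W * M) * mat_adjoint (mat_adjoint U))"
    using mat_trace_conj[OF unitary_mat_adjoint[OF U], of "W * M"] by simp
  also have "\<dots> = mat_trace ((mat_adjoint U * W) * (M * U))"
    by (simp add: assoc_mult_mat[of _ d d _ d _ d])
  also have "\<dots> = (\<Sum>i<d. \<Sum>k<d. (mat_adjoint U * W) $$ (i, k) * (M * U) $$ (k, i))"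
    unfolding mat_trace_def
    by (intro sum.cong) (auto simp: index_mult_mat_sum[of "mat_adjoint U * W" d d "M * U" d] simp del: index_mult_mat(1))
  finally have "Re (mat_trace (W * M)) = (\<Sum>i<d. Re (\<Sum>k<d. (mat_adjoint U * W) $$ (i, k) * (M * U) $$ (k, i)))"
    by simp
  also have "\<dots> \<le> (\<Sum>i<d. col_norm (M * U) i)"
  proof (intro sum_mono)
    fix i assume "i \<in> {..<d}"
    hence i: "i < d" by simp
    have UWW: "mat_adjoint (mat_adjoint U * W) = mat_adjoint W * U"
      by (simp add: mat_adjoint_mult[of _ d d _ d])
    have P: "P = mat_adjoint (mat_adjoint W * U) * (mat_adjoint W * U)"
      by (simp add: P_def mat_adjoint_mult[of _ d d _ d] assoc_mult_mat[of _ d d _ d _ d])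
    have "P * P = mat_adjoint U * ((W * mat_adjoint W) * (W * mat_adjoint W)) * U"
      using conj_mult_conj[OF unitary_mat_adjoint[OF U], of "W * mat_adjoint W" "W * mat_adjoint W"] by (simp add: P_def)
    also have "(W * mat_adjoint W) * (W * mat_adjoint W) = W * mat_adjoint W * W * mat_adjoint W"
      by (simp add: assoc_mult_mat[of _ d d _ d _ d])
    also have "\<dots> = W * mat_adjoint W" using W by (simp add: partial_isometry_def)
    finally have PP: "P * P = P" by (simp add: P_def)
    have "mat_adjoint P = P" unfolding P by (simp add: mat_adjoint_mult[of _ d d _ d])
    hence "Re (P $$ (i, i)) \<le> 1" using PP i by (intro projection_diag_le_one) (auto simp: P_def)
    hence "(col_norm (mat_adjoint W * U) i)\<^sup>2 \<le> 1"
      using col_norm_square[of "mat_adjoint W * U" d d i] i by (simp add: P)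
    hence c1: "col_norm (mat_adjoint W * U) i \<le> 1" using power2_le_imp_le[of "col_norm (mat_adjoint W * U) i" 1] by simp
    have "Re (\<Sum>k<d. (mat_adjoint U * W) $$ (i, k) * (M * U) $$ (k, i)) \<le>
      (\<Sum>k<d. \<bar>cmod ((mat_adjoint W * U) $$ (k, i))\<bar> * \<bar>cmod ((M * U) $$ (k, i))\<bar>)"
    proof -
      have "cmod ((mat_adjoint U * W) $$ (i, k)) = cmod ((mat_adjoint W * U) $$ (k, i))" if "k < d" for k
        using UWW i that mat_adjoint_index[of k "mat_adjoint U * W" i] carrier_matD[of "mat_adjoint U * W" d d]
        by (metis complex_mod_cnj conjugate_complex_def mult_carrier_square unitary_matD(2)[OF U] partial_isometry_carrier[OF W])
      thus ?thesis
        by (intro order_trans[OF complex_Re_le_cmod] sum_norm_le) (auto simp: norm_mult simp del: index_mult_mat(1))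
    qed
    also have "\<dots> \<le> col_norm (mat_adjoint W * U) i * col_norm (M * U) i"
      unfolding col_norm_def using L2_set_mult_ineq[of "\<lambda>k. cmod ((mat_adjoint W * U) $$ (k, i))" "\<lambda>k. cmod ((M * U) $$ (k, i))" "{..<d}"]
      by (simp add: carrier_matD[OF partial_isometry_carrier[OF W]] carrier_matD[OF M] del: index_mult_mat(1))
    also have "\<dots> \<le> 1 * col_norm (M * U) i" using c1 by (intro mult_right_mono) auto
    finally show "Re (\<Sum>k<d. (mat_adjoint U * W) $$ (i, k) * (M * U) $$ (k, i)) \<le> col_norm (M * U) i" by simp
  qed
  finally show ?thesis .
qed

lemma trace_partial_isometry_le':
  assumes "partial_isometry d W" "unitary_mat d U" "M \<in> carrier_mat d d"
  shows "Re (mat_trace (W * M)) \<le> (\<Sum>i<d. col_norm (mat_adjoint M * U) i)"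
proof -
  note [simp] = partial_isometry_carrier[OF assms(1)] assms(3)
  have "mat_trace (W * M) = cnj (mat_trace (mat_adjoint (W * M)))"
    by (subst mat_trace_adjoint[of _ d]) auto
  also have "mat_trace (mat_adjoint (W * M)) = mat_trace (mat_adjoint W * mat_adjoint M)"
    by (simp add: mat_adjoint_mult[of _ d d _ d] mat_trace_comm[of "mat_adjoint M" d d])
  finally show ?thesis
    using trace_partial_isometry_le[OF partial_isometry_adjoint[OF assms(1)] assms(2), of "mat_adjoint M"] by simp
qed

text \<open>In an eigenbasis of |X| the vectors X u_i have the singular values as lengths, so the
  column bound of \<open>trace_partial_isometry_le\<close> adds up to the trace norm.\<close>

lemma mat_abs_diagonalization:
  assumes X: "X \<in> carrier_mat d d"
  obtains U s where "unitary_mat d U" "\<And>i. s i \<ge> 0" "mat_abs X = U * diag_real d s * mat_adjoint U"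
    "\<And>i. i < d \<Longrightarrow> col_norm (X * U) i = s i"
proof -
  obtain U s where U: "unitary_mat d U" and s: "\<And>i. s i \<ge> 0" and A: "mat_abs X = U * diag_real d s * mat_adjoint U"
    using psd_mat_diagonalization[OF mat_abs_psd(1)[OF X]] by blast
  note [simp] = X unitary_matD(1,2)[OF U]
  have "mat_adjoint (X * U) * (X * U) = mat_adjoint U * (mat_adjoint X * X) * U"
    by (simp add: mat_adjoint_mult[of _ d d _ d] assoc_mult_mat[of _ d d _ d _ d])
  also have "mat_adjoint X * X = U * diag_real d (\<lambda>i. s i * s i) * mat_adjoint U"
    unfolding mat_abs_psd(2)[OF X, symmetric] A conj_mult_conj[OF U diag_real_carrier diag_real_carrier] diag_real_mult ..
  also have "mat_adjoint U * \<dots> * U = diag_real d (\<lambda>i. s i * s i)"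
    using unitary_mult_cancel(1)[OF U, of "diag_real d (\<lambda>i. s i * s i)" d]
      unitary_mult_cancel(1)[OF U, of "diag_real d (\<lambda>i. s i * s i) * mat_adjoint U" d]
      unitary_mult_cancel_right(2)[OF U, of "diag_real d (\<lambda>i. s i * s i)" d]
    by (simp add: assoc_mult_mat[of U d d _ d _ d])
  finally have "mat_adjoint (X * U) * (X * U) = diag_real d (\<lambda>i. s i * s i)" .
  hence "(col_norm (X * U) i)\<^sup>2 = (s i)\<^sup>2" if "i < d" for i
    using that by (subst col_norm_square[of _ d d]) (auto simp: power2_eq_square)
  hence "col_norm (X * U) i = s i" if "i < d" for i
    using that s by (simp add: power2_eq_iff_nonneg)
  thus thesis using that U s A by blast
qed

lemma trace_partial_isometry_le_trace_abs:
  assumes "partial_isometry d W" and X: "X \<in> carrier_mat d d"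
  shows "Re (mat_trace (W * X)) \<le> Re (mat_trace (mat_abs X))"
proof -
  obtain U s where U: "unitary_mat d U" "mat_abs X = U * diag_real d s * mat_adjoint U"
    and c: "\<And>i. i < d \<Longrightarrow> col_norm (X * U) i = s i"
    by (rule mat_abs_diagonalization[OF X]) blast
  have "Re (mat_trace (W * X)) \<le> (\<Sum>i<d. col_norm (X * U) i)"
    by (intro trace_partial_isometry_le assms U)
  also have "\<dots> = Re (mat_trace (mat_abs X))"
    using U c by (simp add: mat_trace_conj mat_trace_diag_real)
  finally show ?thesis .
qed

lemma hs_inner_mat_abs_self:
  assumes "X \<in> carrier_mat d d"
  shows "hs_inner (mat_abs X) (mat_abs X) = hs_inner X X"
  using assms by (simp add: hs_inner_def mat_abs_psd(2))

lemma hs_norm_mat_abs: "X \<in> carrier_mat d d \<Longrightarrow> hs_norm (mat_abs X) = hs_norm X"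
  by (simp add: hs_norm_def hs_inner_mat_abs_self)

text \<open>Expand 0 <= ||Q P - L||^2, where P and Q are the square roots of |X| and |Y|, and L is Q
  P with the polar factors inserted in the middle. The two squares give the right-hand side, and the
  mixed term is <X, Y>. Equality holds for X = Y, so little is lost for nearly equal copies.\<close>

theorem hs_inner_mat_abs_ge:
  assumes X: "X \<in> carrier_mat d d" and Y: "Y \<in> carrier_mat d d"
  shows "2 * hs_inner X Y \<le>
    hs_inner (mat_abs X) (mat_abs Y) + hs_inner (mat_abs (mat_adjoint X)) (mat_abs (mat_adjoint Y))"
proof -
  obtain W where W: "partial_isometry d W" "W * X = mat_abs X" "X * W = mat_abs (mat_adjoint X)"
    "mat_adjoint W * mat_abs X = X" by (rule polar_decomposition[OF X])
  obtain V where V: "partial_isometry d V" "V * Y = mat_abs Y" "Y * V = mat_abs (mat_adjoint Y)"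
    "mat_adjoint V * mat_abs Y = Y" by (rule polar_decomposition[OF Y])
  define P where "P = psd_sqrt (mat_abs X)"
  define Q where "Q = psd_sqrt (mat_abs Y)"
  have PP: "psd_mat d P" "P * P = mat_abs X" and QQ: "psd_mat d Q" "Q * Q = mat_abs Y"
    unfolding P_def Q_def using psd_sqrt mat_abs_psd(1) X Y by blast+
  note [simp] = X Y partial_isometry_carrier[OF W(1)] partial_isometry_carrier[OF V(1)] psd_matD[OF PP(1)] psd_matD[OF QQ(1)]
  note [simp] = mat_abs_carrier[OF X] mat_abs_carrier[OF Y] mat_abs_adjoint[OF X] mat_abs_adjoint[OF Y]
  note assoc = assoc_mult_mat[of _ d d _ d _ d]
  define L where "L = Q * V * mat_adjoint W * P"
  have [simp]: "L \<in> carrier_mat d d" by (simp add: L_def)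
  have VY: "mat_abs Y * V = mat_adjoint Y"
    using arg_cong[OF V(4), of mat_adjoint] by (simp add: mat_adjoint_mult[of _ d d _ d])
  have WX: "mat_abs X * W = mat_adjoint X"
    using arg_cong[OF W(4), of mat_adjoint] by (simp add: mat_adjoint_mult[of _ d d _ d])
  have 1: "hs_inner (Q * P) (Q * P) = hs_inner (mat_abs X) (mat_abs Y)"
  proof -
    have "hs_inner (Q * P) (Q * P) = hs_inner P (mat_abs Y * P)"
      by (subst hs_inner_mult_left[of _ d]) (auto simp: assoc[symmetric] QQ)
    also have "\<dots> = hs_inner (mat_abs Y * P) P" by (rule hs_inner_commute[of _ d d]) auto
    also have "\<dots> = hs_inner (mat_abs Y) (mat_abs X)"
      by (subst hs_inner_mult_right[of _ d]) (auto simp: PP)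
    finally show ?thesis by (simp add: hs_inner_commute[of _ d d])
  qed
  have 2: "hs_inner L L = hs_inner (mat_abs (mat_adjoint X)) (mat_abs (mat_adjoint Y))"
  proof -
    have "hs_inner L L = hs_inner L (Q * (V * (mat_adjoint W * P)))" by (simp add: L_def assoc)
    also have "\<dots> = hs_inner (Q * (V * (mat_adjoint W * P))) L" by (rule hs_inner_commute[of _ d d]) auto
    also have "\<dots> = hs_inner (mat_adjoint W * P) (mat_adjoint V * (Q * L))"
      by (simp add: hs_inner_mult_left[of _ d])
    also have "mat_adjoint V * (Q * L) = mat_adjoint V * mat_abs Y * V * (mat_adjoint W * P)"
      by (simp add: L_def assoc QQ(2)[symmetric])
    also have "\<dots> = mat_abs (mat_adjoint Y) * (mat_adjoint W * P)"
      by (simp add: V)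
    also have "hs_inner (mat_adjoint W * P) (mat_abs (mat_adjoint Y) * (mat_adjoint W * P)) =
       hs_inner (mat_abs (mat_adjoint Y) * (mat_adjoint W * P)) (mat_adjoint W * P)"
      by (rule hs_inner_commute[of _ d d]) auto
    also have "\<dots> = hs_inner (mat_abs (mat_adjoint Y)) (mat_adjoint W * mat_abs X * W)"
      by (subst hs_inner_mult_right[of _ d]) (auto simp: mat_adjoint_mult[of _ d d _ d] PP(2)[symmetric] assoc)
    also have "\<dots> = hs_inner (mat_abs (mat_adjoint Y)) (mat_abs (mat_adjoint X))" by (simp add: W)
    finally show ?thesis by (simp add: hs_inner_commute[of _ d d])
  qed
  have 3: "hs_inner (Q * P) L = hs_inner X Y"
  proof -
    have "hs_inner (Q * P) L = hs_inner P (mat_abs Y * V * (mat_adjoint W * P))"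
      by (subst hs_inner_mult_left[of _ d]) (auto simp: L_def assoc QQ(2)[symmetric])
    also have "\<dots> = hs_inner (mat_adjoint Y * mat_adjoint W * P) P"
      by (subst hs_inner_commute[of _ d d]) (auto simp: VY assoc)
    also have "\<dots> = hs_inner (mat_adjoint Y * mat_adjoint W) (mat_abs X)"
      by (subst hs_inner_mult_right[of _ d]) (auto simp: PP)
    also have "\<dots> = hs_inner (mat_adjoint Y) (mat_adjoint X)"
      by (subst hs_inner_mult_right[of _ d]) (auto simp: WX)
    also have "\<dots> = hs_inner Y X" by (rule hs_inner_adjoint[of _ d]) auto
    finally show ?thesis by (simp add: hs_inner_commute[of _ d d])
  qed
  have "hs_inner (Q * P - L) (Q * P - L) \<ge> 0" by (rule hs_inner_nonneg)
  thus ?thesis by (simp add: hs_inner_diff_self[of _ d d] 1 2 3)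
qed

text \<open>Because |X| and X have equal norms, the preceding inequality says that the squared
  distances of |X|, |Y| and of |X^*|, |Y^*| add up to at most 2 ||X - Y||^2. Measurability,
  integrability and the fixed point argument all rest on this bound.\<close>

lemma mat_abs_lipschitz:
  assumes "X \<in> carrier_mat d d" "Y \<in> carrier_mat d d"
  shows "hs_norm (mat_abs X - mat_abs Y) \<le> sqrt 2 * hs_norm (X - Y)"
proof -
  note [simp] = assms
  have "hs_inner (mat_abs X - mat_abs Y) (mat_abs X - mat_abs Y) +
      hs_inner (mat_abs (mat_adjoint X) - mat_abs (mat_adjoint Y)) (mat_abs (mat_adjoint X) - mat_abs (mat_adjoint Y))
    \<le> 2 * hs_inner (X - Y) (X - Y)"
    using hs_inner_mat_abs_ge[OF assms]
    by (simp add: hs_inner_diff_self[of _ d d] hs_inner_mat_abs_self[of _ d] hs_inner_adjoint[of _ d])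
  hence "hs_inner (mat_abs X - mat_abs Y) (mat_abs X - mat_abs Y) \<le> 2 * hs_inner (X - Y) (X - Y)"
    using hs_inner_nonneg[of "mat_abs (mat_adjoint X) - mat_abs (mat_adjoint Y)"] by linarith
  thus ?thesis by (simp add: hs_norm_def real_sqrt_mult[symmetric])
qed

text \<open>The root is |T Y| with T the square root of \<open>R\<close>. Its trace pairs
  \<open>Y\<close> with a matrix of norm at most ||T||, and ||T||^2 = tr R.\<close>

lemma trace_sqrt_sandwich_le:
  assumes R: "psd_mat d R" and Y: "Y \<in> carrier_mat d d"
  shows "Re (mat_trace (psd_sqrt (mat_adjoint Y * R * Y))) \<le> sqrt (Re (mat_trace R)) * hs_norm Y"
proof -
  define T where "T = psd_sqrt R"
  have T: "psd_mat d T" "T * T = R" unfolding T_def using psd_sqrt[OF R] by auto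
  note [simp] = psd_matD[OF T(1)] Y psd_matD[OF R]
  have "mat_adjoint Y * R * Y = mat_adjoint (T * Y) * (T * Y)"
    by (simp add: mat_adjoint_mult[of _ d d _ d] assoc_mult_mat[of _ d d _ d _ d] T(2)[symmetric])
  hence abs: "psd_sqrt (mat_adjoint Y * R * Y) = mat_abs (T * Y)" by (simp add: mat_abs_def)
  obtain W where W: "partial_isometry d W" "W * (T * Y) = mat_abs (T * Y)"
    by (rule polar_decomposition[of "T * Y" d]) auto
  note [simp] = partial_isometry_carrier[OF W(1)]
  have "Re (mat_trace (mat_abs (T * Y))) = hs_inner (mat_adjoint (W * T)) Y"
    unfolding W(2)[symmetric] by (simp add: hs_inner_def assoc_mult_mat[of _ d d _ d _ d])
  also have "\<dots> \<le> hs_norm (mat_adjoint (W * T)) * hs_norm Y"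
    by (rule hs_inner_le[of _ d d]) auto
  also have "\<dots> \<le> hs_norm T * hs_norm Y"
    using partial_isometry_hs_norm_le[OF W(1), of T] by (intro mult_right_mono) auto
  also have "hs_norm T = sqrt (Re (mat_trace R))" by (simp add: hs_norm_def hs_inner_def T)
  finally show ?thesis by (simp add: abs)
qed

section \<open>Correlations of even functions of Gaussian variables\<close>

lemma nn_integral_shear1:
  fixes u :: "real \<times> real \<Rightarrow> ennreal"
  assumes [measurable]: "u \<in> borel_measurable (borel \<Otimes>\<^sub>M borel)"
  shows "(\<integral>\<^sup>+p. u (fst p + t * snd p, snd p) \<partial>(lborel \<Otimes>\<^sub>M lborel)) = (\<integral>\<^sup>+p. u p \<partial>(lborel \<Otimes>\<^sub>M lborel))"
proof -
  have "(\<integral>\<^sup>+p. u (fst p + t * snd p, snd p) \<partial>(lborel \<Otimes>\<^sub>M lborel)) =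
    (\<integral>\<^sup>+y. \<integral>\<^sup>+x. u (x + t * y, y) \<partial>lborel \<partial>lborel)"
    by (subst lborel_pair.nn_integral_snd[symmetric]) auto
  also have "\<dots> = (\<integral>\<^sup>+y. \<integral>\<^sup>+x. u (x, y) \<partial>lborel \<partial>lborel)"
  proof (rule nn_integral_cong)
    fix y :: real
    show "(\<integral>\<^sup>+x. u (x + t * y, y) \<partial>lborel) = (\<integral>\<^sup>+x. u (x, y) \<partial>lborel)"
      using nn_integral_real_affine[of "\<lambda>x. u (x, y)" 1 "t * y"] by (simp add: add.commute)
  qed
  also have "\<dots> = (\<integral>\<^sup>+p. u p \<partial>(lborel \<Otimes>\<^sub>M lborel))"
    by (subst lborel_pair.nn_integral_snd) auto
  finally show ?thesis .
qed

lemma nn_integral_shear2: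
  fixes u :: "real \<times> real \<Rightarrow> ennreal"
  assumes [measurable]: "u \<in> borel_measurable (borel \<Otimes>\<^sub>M borel)"
  shows "(\<integral>\<^sup>+p. u (fst p, snd p + t * fst p) \<partial>(lborel \<Otimes>\<^sub>M lborel)) = (\<integral>\<^sup>+p. u p \<partial>(lborel \<Otimes>\<^sub>M lborel))"
proof -
  have "(\<integral>\<^sup>+p. u (fst p, snd p + t * fst p) \<partial>(lborel \<Otimes>\<^sub>M lborel)) =
    (\<integral>\<^sup>+x. \<integral>\<^sup>+y. u (x, y + t * x) \<partial>lborel \<partial>lborel)"
    by (subst lborel.nn_integral_fst[symmetric]) auto
  also have "\<dots> = (\<integral>\<^sup>+x. \<integral>\<^sup>+y. u (x, y) \<partial>lborel \<partial>lborel)"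
  proof (rule nn_integral_cong)
    fix x :: real
    show "(\<integral>\<^sup>+y. u (x, y + t * x) \<partial>lborel) = (\<integral>\<^sup>+y. u (x, y) \<partial>lborel)"
      using nn_integral_real_affine[of "\<lambda>y. u (x, y)" 1 "t * x"] by (simp add: add.commute)
  qed
  also have "\<dots> = (\<integral>\<^sup>+p. u p \<partial>(lborel \<Otimes>\<^sub>M lborel))"
    by (subst lborel.nn_integral_fst) auto
  finally show ?thesis .
qed

definition rot :: "real \<Rightarrow> real \<times> real \<Rightarrow> real \<times> real" where
  "rot a p = (cos a * fst p + sin a * snd p, cos a * snd p - sin a * fst p)"

lemma rot_measurable [measurable]: "rot a \<in> borel \<Otimes>\<^sub>M borel \<rightarrow>\<^sub>M borel \<Otimes>\<^sub>M borel"
  unfolding rot_def by measurable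

text \<open>A rotation is a product of three shears.\<close>

lemma nn_integral_rot:
  fixes u :: "real \<times> real \<Rightarrow> ennreal"
  assumes [measurable]: "u \<in> borel_measurable (borel \<Otimes>\<^sub>M borel)" and a: "\<bar>a\<bar> < pi"
  shows "(\<integral>\<^sup>+p. u (rot a p) \<partial>(lborel \<Otimes>\<^sub>M lborel)) = (\<integral>\<^sup>+p. u p \<partial>(lborel \<Otimes>\<^sub>M lborel))"
proof -
  \<comment> \<open>The shears have the parameters tan (a / 2), - sin a and tan (a / 2);
    \<open>e1\<close> and \<open>e2\<close> are the identities behind this factorization. The
    restriction on \<open>a\<close> keeps the tangent finite.\<close>
  define t where "t = tan (a / 2)"
  have c: "cos (a / 2) > 0" using a by (intro cos_gt_zero_pi) auto
  have sa: "sin a = 2 * sin (a / 2) * cos (a / 2)" using sin_double[of "a / 2"] by simp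
  have ca: "cos a = 1 - 2 * (sin (a / 2))\<^sup>2" "cos a = 2 * (cos (a / 2))\<^sup>2 - 1"
    using cos_double_sin[of "a / 2"] cos_double_cos[of "a / 2"] by simp_all
  have e1: "1 - sin a * t = cos a"
    using c by (simp add: t_def tan_def sa ca(1) power2_eq_square)
  have e2: "t + t * cos a = sin a"
    using c by (simp add: t_def tan_def sa ca(2) power2_eq_square field_simps)
  define u1 where "u1 p = u (fst p + t * snd p, snd p)" for p
  define u2 where "u2 p = u1 (fst p, snd p + (- sin a) * fst p)" for p
  have [measurable]: "u1 \<in> borel_measurable (borel \<Otimes>\<^sub>M borel)" unfolding u1_def by measurable
  have [measurable]: "u2 \<in> borel_measurable (borel \<Otimes>\<^sub>M borel)" unfolding u2_def by measurable
  have "u (rot a p) = u2 (fst p + t * snd p, snd p)" for p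
  proof -
    have y: "snd p + (- sin a) * (fst p + t * snd p) = cos a * snd p - sin a * fst p"
      unfolding e1[symmetric] by (simp add: algebra_simps)
    have x: "fst p + t * snd p + t * (cos a * snd p - sin a * fst p) = cos a * fst p + sin a * snd p"
    proof -
      have "fst p + t * snd p + t * (cos a * snd p - sin a * fst p) = (1 - sin a * t) * fst p + (t + t * cos a) * snd p"
        by (simp add: algebra_simps)
      thus ?thesis by (simp add: e1 e2)
    qed
    show ?thesis by (simp only: u2_def u1_def rot_def fst_conv snd_conv y x)
  qed
  hence "(\<integral>\<^sup>+p. u (rot a p) \<partial>(lborel \<Otimes>\<^sub>M lborel)) = (\<integral>\<^sup>+p. u2 (fst p + t * snd p, snd p) \<partial>(lborel \<Otimes>\<^sub>M lborel))"
    by simp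
  also have "\<dots> = (\<integral>\<^sup>+p. u2 p \<partial>(lborel \<Otimes>\<^sub>M lborel))" by (rule nn_integral_shear1) measurable
  also have "\<dots> = (\<integral>\<^sup>+p. u1 p \<partial>(lborel \<Otimes>\<^sub>M lborel))"
    unfolding u2_def by (rule nn_integral_shear2) measurable
  also have "\<dots> = (\<integral>\<^sup>+p. u p \<partial>(lborel \<Otimes>\<^sub>M lborel))"
    unfolding u1_def by (rule nn_integral_shear1) measurable
  finally show ?thesis .
qed

definition std_normal_pair :: "(real \<times> real) measure" where
  "std_normal_pair = density (lborel \<Otimes>\<^sub>M lborel) (\<lambda>(x, y). ennreal (std_normal_density x) * ennreal (std_normal_density y))"

lemma sets_std_normal_pair [measurable_cong]: "sets std_normal_pair = sets (borel \<Otimes>\<^sub>M borel)"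
  unfolding std_normal_pair_def by simp

text \<open>Rotations preserve Lebesgue measure, and the density depends on x^2 + y^2 only.\<close>

lemma distr_std_normal_pair_rot:
  assumes "\<bar>a\<bar> < pi"
  shows "distr std_normal_pair (borel \<Otimes>\<^sub>M borel) (rot a) = std_normal_pair"
proof (rule measure_eqI)
  fix A assume "A \<in> sets (distr std_normal_pair (borel \<Otimes>\<^sub>M borel) (rot a))"
  hence A [measurable]: "A \<in> sets (borel \<Otimes>\<^sub>M borel)" by simp
  define \<psi> where "\<psi> p = ennreal (std_normal_density (fst p)) * ennreal (std_normal_density (snd p))" for p
  have [measurable]: "\<psi> \<in> borel_measurable (borel \<Otimes>\<^sub>M borel)" unfolding \<psi>_def by measurable
  have s: "std_normal_pair = density (lborel \<Otimes>\<^sub>M lborel) \<psi>"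
    unfolding std_normal_pair_def \<psi>_def by (simp add: case_prod_beta')
  have inv: "\<psi> (rot a p) = \<psi> p" for p
  proof -
    have sq: "(cos a * x + sin a * y)\<^sup>2 + (cos a * y - sin a * x)\<^sup>2 = x\<^sup>2 + y\<^sup>2" for x y :: real
    proof -
      have "(c * x + t * y)\<^sup>2 + (c * y - t * x)\<^sup>2 = (t\<^sup>2 + c\<^sup>2) * (x\<^sup>2 + y\<^sup>2)" for c t :: real
        by (simp add: power2_eq_square algebra_simps)
      from this[of "cos a" "sin a"]
      show ?thesis by simp
    qed
    have "\<psi> p = ennreal (1 / (2 * pi) * exp (- ((fst p)\<^sup>2 + (snd p)\<^sup>2) / 2))" for p
      unfolding \<psi>_def std_normal_density_def
      by (subst ennreal_mult[symmetric]) (auto simp: exp_add[symmetric] field_simps real_sqrt_mult)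
    thus ?thesis by (simp only: rot_def fst_conv snd_conv sq)
  qed
  have "emeasure (distr std_normal_pair (borel \<Otimes>\<^sub>M borel) (rot a)) A =
      (\<integral>\<^sup>+p. indicator A p \<partial>(distr std_normal_pair (borel \<Otimes>\<^sub>M borel) (rot a)))"
    by simp
  also have "\<dots> = (\<integral>\<^sup>+p. indicator A (rot a p) \<partial>std_normal_pair)"
    by (subst nn_integral_distr) auto
  also have "\<dots> = (\<integral>\<^sup>+p. \<psi> (rot a p) * indicator A (rot a p) \<partial>(lborel \<Otimes>\<^sub>M lborel))"
    unfolding s inv by (subst nn_integral_density) auto
  also have "\<dots> = (\<integral>\<^sup>+p. \<psi> p * indicator A p \<partial>(lborel \<Otimes>\<^sub>M lborel))"
    using assms by (intro nn_integral_rot) auto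
  also have "\<dots> = emeasure std_normal_pair A"
    unfolding s by (subst emeasure_density) auto
  finally show "emeasure (distr std_normal_pair (borel \<Otimes>\<^sub>M borel) (rot a)) A = emeasure std_normal_pair A" .
qed (simp add: sets_std_normal_pair)

section \<open>Lipschitz functions of finitely many coordinates\<close>

definition sum_lipschitz :: "nat \<Rightarrow> ((nat \<Rightarrow> real) \<Rightarrow> real) \<Rightarrow> bool" where
  "sum_lipschitz l f \<longleftrightarrow> (\<exists>K\<ge>0. \<forall>x y. \<bar>f x - f y\<bar> \<le> K * (\<Sum>j=1..l. \<bar>x j - y j\<bar>))"

text \<open>The Lipschitz bound involves only the coordinates in \<open>{1..l}\<close>, so
  \<open>f\<close> ignores all others. This allows full sequences as arguments without restricting
  them.\<close>

lemma sum_lipschitz_eq: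
  assumes "sum_lipschitz l f" "\<And>j. j \<in> {1..l} \<Longrightarrow> x j = y j"
  shows "f x = f y"
proof -
  obtain K where "\<bar>f x - f y\<bar> \<le> K * (\<Sum>j=1..l. \<bar>x j - y j\<bar>)"
    using assms(1) unfolding sum_lipschitz_def by blast
  thus ?thesis using assms(2) by simp
qed

lemma sum_lipschitz_continuous:
  assumes "sum_lipschitz l f"
  shows "continuous_on UNIV f"
proof -
  obtain K where K: "\<And>x y. \<bar>f x - f y\<bar> \<le> K * (\<Sum>j=1..l. \<bar>x j - y j\<bar>)"
    using assms unfolding sum_lipschitz_def by blast
  have "(f \<longlongrightarrow> f x) (at x)" for x
  proof (rule Lim_null_comparison[where g = "\<lambda>y. K * (\<Sum>j=1..l. \<bar>y j - x j\<bar>)", THEN LIM_zero_cancel])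
    show "eventually (\<lambda>y. norm (f y - f x) \<le> K * (\<Sum>j=1..l. \<bar>y j - x j\<bar>)) (at x)"
      using K by simp
    have c: "((\<lambda>y::nat \<Rightarrow> real. y j) \<longlongrightarrow> x j) (at x)" for j
    proof -
      have "continuous_on UNIV (\<lambda>y::nat \<Rightarrow> real. y j)" by (rule continuous_on_product_coordinates)
      thus ?thesis by (simp add: continuous_on_def)
    qed
    have "((\<lambda>y. K * (\<Sum>j=1..l. \<bar>y j - x j\<bar>)) \<longlongrightarrow> K * (\<Sum>j=1..l. \<bar>x j - x j\<bar>)) (at x)"
      by (intro tendsto_intros c)
    thus "((\<lambda>y. K * (\<Sum>j=1..l. \<bar>y j - x j\<bar>)) \<longlongrightarrow> 0) (at x)" by simp
  qed
  thus ?thesis by (simp add: continuous_on_def)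
qed

text \<open>A point of the product space carries no information outside \<open>{1..l}\<close>;
  overwriting the other coordinates with 0 gives a measurable map into the space of sequences, on
  which \<open>f\<close> is continuous.\<close>

lemma sum_lipschitz_measurable:
  assumes "sum_lipschitz l f"
  shows "f \<in> borel_measurable (PiM {1..l} (\<lambda>_. borel))"
proof -
  let ?e = "\<lambda>x::nat \<Rightarrow> real. \<lambda>j. if j \<in> {1..l} then x j else 0"
  have [measurable]: "f \<in> borel_measurable borel"
    using sum_lipschitz_continuous[OF assms] by (intro borel_measurable_continuous_onI)
  have [measurable]: "?e \<in> PiM {1..l} (\<lambda>_. borel) \<rightarrow>\<^sub>M borel"
  proof (rule measurable_coordinatewise_then_product)
    fix i show "(\<lambda>x. ?e x i) \<in> borel_measurable (PiM {1..l} (\<lambda>_. borel))"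
      by (cases "i \<in> {1..l}") auto
  qed
  have "(\<lambda>x. f (?e x)) \<in> borel_measurable (PiM {1..l} (\<lambda>_. borel))" by measurable
  moreover have "f (?e x) = f x" for x by (rule sum_lipschitz_eq[OF assms]) auto
  ultimately show ?thesis by simp
qed

section \<open>The Gaussian sequence and its correlated copies\<close>

locale gaussian_sequence = prob_space M for M :: "'a measure" +
  fixes g :: "nat \<Rightarrow> 'a \<Rightarrow> real"
  assumes indep: "indep_vars (\<lambda>_. borel) g {1..}"
    and normal: "\<And>j. j \<ge> 1 \<Longrightarrow> distributed M lborel (g j) std_normal_density"
begin

lemma g_measurable [measurable]: "j \<ge> 1 \<Longrightarrow> g j \<in> borel_measurable M"
  using distributed_measurable[OF normal] by simp

lemma g_integrable_power: "j \<ge> 1 \<Longrightarrow> integrable M (\<lambda>\<omega>. g j \<omega> ^ k)"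
  using distributed_integrable[OF normal, of j "\<lambda>x. x ^ k"] integrable_std_normal_moment[of k] by simp

lemma g_expectation_square: "j \<ge> 1 \<Longrightarrow> expectation (\<lambda>\<omega>. (g j \<omega>)\<^sup>2) = 1"
  using distributed_integral[OF normal, of j "\<lambda>x. x\<^sup>2"] integral_std_normal_moment_even[of 1] by simp

lemma g_expectation: "j \<ge> 1 \<Longrightarrow> expectation (g j) = 0"
  using distributed_integral[OF normal, of j "\<lambda>x. x"] integral_std_normal_moment_odd[of 0] by simp

lemma g_indep:
  assumes "1 \<le> i" "1 \<le> j" "i \<noteq> j"
  shows "indep_var borel (g i) borel (g j)"
proof -
  have "indep_var borel ((\<lambda>x. x i) \<circ> (\<lambda>\<omega>. restrict (\<lambda>k. g k \<omega>) {i})) borel ((\<lambda>x. x j) \<circ> (\<lambda>\<omega>. restrict (\<lambda>k. g k \<omega>) {j}))"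
    using assms by (intro indep_var_compose[OF indep_var_restrict[OF indep]]) auto
  thus ?thesis by (simp add: comp_def)
qed

lemma g_expectation_mult:
  assumes "i \<ge> 1" "j \<ge> 1"
  shows "integrable M (\<lambda>\<omega>. g i \<omega> * g j \<omega>)" "expectation (\<lambda>\<omega>. g i \<omega> * g j \<omega>) = (if i = j then 1 else 0)"
proof -
  have g1: "integrable M (g k)" if "k \<ge> 1" for k using g_integrable_power[OF that, of 1] by simp
  have "integrable M (\<lambda>\<omega>. g i \<omega> * g j \<omega>) \<and> expectation (\<lambda>\<omega>. g i \<omega> * g j \<omega>) = (if i = j then 1 else 0)"
  proof (cases "i = j")
    case True
    thus ?thesis using assms g_integrable_power[of i 2] g_expectation_square[of i] by (simp add: power2_eq_square)
  next
    case False
    thus ?thesis using assms indep_var_integrable[OF g_indep g1 g1] indep_var_lebesgue_integral[OF g_indep g1 g1]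
      by (simp add: g_expectation)
  qed
  thus "integrable M (\<lambda>\<omega>. g i \<omega> * g j \<omega>)" "expectation (\<lambda>\<omega>. g i \<omega> * g j \<omega>) = (if i = j then 1 else 0)"
    by auto
qed

lemma distr_g_pair:
  assumes "i \<ge> 1" "j \<ge> 1" "i \<noteq> j"
  shows "distr M (borel \<Otimes>\<^sub>M borel) (\<lambda>\<omega>. (g i \<omega>, g j \<omega>)) = std_normal_pair"
proof -
  have pair_sets: "sets (lborel \<Otimes>\<^sub>M lborel) = sets (borel \<Otimes>\<^sub>M borel :: (real \<times> real) measure)"
    by (intro sets_pair_measure_cong) auto
  have lb: "distr M lborel X = distr M borel X" for X :: "'a \<Rightarrow> real"
    by (rule distr_cong) auto
  have "distr M lborel (g i) \<Otimes>\<^sub>M distr M lborel (g j) = distr M (lborel \<Otimes>\<^sub>M lborel) (\<lambda>\<omega>. (g i \<omega>, g j \<omega>))"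
    using g_indep[OF assms] distr_cong[OF refl pair_sets refl, of M]
    unfolding lb indep_var_distribution_eq by simp
  hence "distributed M (lborel \<Otimes>\<^sub>M lborel) (\<lambda>\<omega>. (g i \<omega>, g j \<omega>))
     (\<lambda>(x, y). ennreal (std_normal_density x) * ennreal (std_normal_density y))"
    using assms by (intro distributed_joint_indep' normal lborel.sigma_finite_measure_axioms)
  hence "distr M (lborel \<Otimes>\<^sub>M lborel) (\<lambda>\<omega>. (g i \<omega>, g j \<omega>)) = std_normal_pair"
    by (simp add: std_normal_pair_def distributed_distr_eq_density)
  moreover have "distr M (lborel \<Otimes>\<^sub>M lborel) (\<lambda>\<omega>. (g i \<omega>, g j \<omega>)) = distr M (borel \<Otimes>\<^sub>M borel) (\<lambda>\<omega>. (g i \<omega>, g j \<omega>))"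
    by (intro distr_cong refl pair_sets)
  ultimately show ?thesis by simp
qed

text \<open>The pairs of g_j and g_(l+j) are independent, each with rotation invariant law; their
  joint law is a product measure and does not change when all pairs are turned by the same
  angle.\<close>

lemma expectation_rot:
  fixes h :: "(nat \<Rightarrow> real \<times> real) \<Rightarrow> real"
  assumes h [measurable]: "h \<in> borel_measurable (PiM {1..l} (\<lambda>_. borel \<Otimes>\<^sub>M borel))" and a: "\<bar>a\<bar> < pi"
  shows "expectation (\<lambda>\<omega>. h (\<lambda>j\<in>{1..l}. rot a (g j \<omega>, g (l + j) \<omega>))) =
         expectation (\<lambda>\<omega>. h (\<lambda>j\<in>{1..l}. (g j \<omega>, g (l + j) \<omega>)))"
proof (cases "l = 0")
  case False
  let ?T = "borel \<Otimes>\<^sub>M borel :: (real \<times> real) measure"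
  let ?P = "\<lambda>j \<omega>. (g j \<omega>, g (l + j) \<omega>)"
  have I: "{1..l} \<noteq> {}" using False by simp
  have meas: "?P j \<in> M \<rightarrow>\<^sub>M ?T" if "j \<in> {1..l}" for j using that by auto
  have ind: "indep_vars (\<lambda>_. ?T) ?P {1..l}"
  proof -
    have "indep_vars (\<lambda>j. PiM {j, l + j} (\<lambda>_. borel)) (\<lambda>j \<omega>. restrict (\<lambda>i. g i \<omega>) {j, l + j}) {1..l}"
      using indep by (rule indep_vars_restrict) (auto simp: disjoint_family_on_def)
    hence "indep_vars (\<lambda>_. ?T) (\<lambda>j \<omega>. (\<lambda>x. (x j, x (l + j))) (restrict (\<lambda>i. g i \<omega>) {j, l + j})) {1..l}"
      by (rule indep_vars_compose2[where Y = "\<lambda>j x. (x j, x (l + j))"]) measurable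
    thus ?thesis by simp
  qed
  have ind': "indep_vars (\<lambda>_. ?T) (\<lambda>j \<omega>. rot a (?P j \<omega>)) {1..l}"
    using ind by (rule indep_vars_compose2) measurable
  have d: "distr M ?T (?P j) = std_normal_pair" if "j \<in> {1..l}" for j
    using that False by (intro distr_g_pair) auto
  have d': "distr M ?T (\<lambda>\<omega>. rot a (?P j \<omega>)) = std_normal_pair" if "j \<in> {1..l}" for j
  proof -
    have "distr M ?T (\<lambda>\<omega>. rot a (?P j \<omega>)) = distr (distr M ?T (?P j)) ?T (rot a)"
      using meas[OF that] by (subst distr_distr) (auto simp: comp_def)
    thus ?thesis using d[OF that] distr_std_normal_pair_rot[OF a] by simp
  qed
  have "distr M (PiM {1..l} (\<lambda>_. ?T)) (\<lambda>\<omega>. \<lambda>j\<in>{1..l}. ?P j \<omega>) = PiM {1..l} (\<lambda>j. distr M ?T (?P j))"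
    using ind by (subst (asm) indep_vars_iff_distr_eq_PiM'[OF I meas]) auto
  also have "\<dots> = PiM {1..l} (\<lambda>j. distr M ?T (\<lambda>\<omega>. rot a (?P j \<omega>)))"
    by (intro PiM_cong) (auto simp: d d')
  also have "\<dots> = distr M (PiM {1..l} (\<lambda>_. ?T)) (\<lambda>\<omega>. \<lambda>j\<in>{1..l}. rot a (?P j \<omega>))"
    using ind' meas by (subst (asm) indep_vars_iff_distr_eq_PiM'[OF I]) auto
  finally have eq: "distr M (PiM {1..l} (\<lambda>_. ?T)) (\<lambda>\<omega>. \<lambda>j\<in>{1..l}. ?P j \<omega>) =
    distr M (PiM {1..l} (\<lambda>_. ?T)) (\<lambda>\<omega>. \<lambda>j\<in>{1..l}. rot a (?P j \<omega>))" .
  have int: "integral\<^sup>L (distr M (PiM {1..l} (\<lambda>_. ?T)) X) h = expectation (\<lambda>\<omega>. h (X \<omega>))"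
    if "X \<in> M \<rightarrow>\<^sub>M PiM {1..l} (\<lambda>_. ?T)" for X
    using that h by (rule integral_distr)
  have X1: "(\<lambda>\<omega>. \<lambda>j\<in>{1..l}. ?P j \<omega>) \<in> M \<rightarrow>\<^sub>M PiM {1..l} (\<lambda>_. ?T)"
    using meas by (intro measurable_restrict)
  have X2: "(\<lambda>\<omega>. \<lambda>j\<in>{1..l}. rot a (?P j \<omega>)) \<in> M \<rightarrow>\<^sub>M PiM {1..l} (\<lambda>_. ?T)"
    using meas by (intro measurable_restrict) (auto intro: measurable_compose[OF _ rot_measurable])
  show ?thesis using int[OF X1] int[OF X2] eq by simp
qed (simp add: restrict_def)


lemma square_integrable_add:
  fixes X Y :: "'a \<Rightarrow> real"
  assumes [measurable]: "X \<in> borel_measurable M" "Y \<in> borel_measurable M"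
    and "integrable M (\<lambda>\<omega>. (X \<omega>)\<^sup>2)" "integrable M (\<lambda>\<omega>. (Y \<omega>)\<^sup>2)"
  shows "integrable M (\<lambda>\<omega>. (X \<omega> + Y \<omega>)\<^sup>2)"
proof (rule Bochner_Integration.integrable_bound)
  show "integrable M (\<lambda>\<omega>. 2 * (X \<omega>)\<^sup>2 + 2 * (Y \<omega>)\<^sup>2)" using assms by auto
  have "(X \<omega> + Y \<omega>)\<^sup>2 \<le> 2 * (X \<omega>)\<^sup>2 + 2 * (Y \<omega>)\<^sup>2" for \<omega>
    using zero_le_power2[of "X \<omega> - Y \<omega>"] by (simp add: power2_eq_square algebra_simps)
  thus "AE \<omega> in M. norm ((X \<omega> + Y \<omega>)\<^sup>2) \<le> norm (2 * (X \<omega>)\<^sup>2 + 2 * (Y \<omega>)\<^sup>2)" by simp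
qed measurable

lemma square_integrable_sum:
  fixes X :: "'i \<Rightarrow> 'a \<Rightarrow> real"
  assumes "finite I" "\<And>i. i \<in> I \<Longrightarrow> X i \<in> borel_measurable M" "\<And>i. i \<in> I \<Longrightarrow> integrable M (\<lambda>\<omega>. (X i \<omega>)\<^sup>2)"
  shows "integrable M (\<lambda>\<omega>. (\<Sum>i\<in>I. X i \<omega>)\<^sup>2)"
  using assms
proof (induction I rule: finite_induct)
  case (insert i I)
  hence "integrable M (\<lambda>\<omega>. (X i \<omega> + (\<Sum>i\<in>I. X i \<omega>))\<^sup>2)"
    by (intro square_integrable_add) auto
  thus ?case using insert by simp
qed simp

lemma integrable_mult_of_square_integrable:
  fixes X Y :: "'a \<Rightarrow> real"
  assumes [measurable]: "X \<in> borel_measurable M" "Y \<in> borel_measurable M"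
    and "integrable M (\<lambda>\<omega>. (X \<omega>)\<^sup>2)" "integrable M (\<lambda>\<omega>. (Y \<omega>)\<^sup>2)"
  shows "integrable M (\<lambda>\<omega>. X \<omega> * Y \<omega>)"
proof (rule Bochner_Integration.integrable_bound)
  show "integrable M (\<lambda>\<omega>. (X \<omega>)\<^sup>2 + (Y \<omega>)\<^sup>2)" using assms by auto
  have "\<bar>X \<omega> * Y \<omega>\<bar> \<le> (X \<omega>)\<^sup>2 + (Y \<omega>)\<^sup>2" for \<omega>
  proof -
    have "2 * \<bar>X \<omega> * Y \<omega>\<bar> \<le> (X \<omega>)\<^sup>2 + (Y \<omega>)\<^sup>2"
      using zero_le_power2[of "\<bar>X \<omega>\<bar> - \<bar>Y \<omega>\<bar>"] by (simp add: power2_eq_square algebra_simps abs_mult)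
    thus ?thesis using abs_ge_zero[of "X \<omega> * Y \<omega>"] by linarith
  qed
  thus "AE \<omega> in M. norm (X \<omega> * Y \<omega>) \<le> norm ((X \<omega>)\<^sup>2 + (Y \<omega>)\<^sup>2)" by simp
qed measurable

lemma square_integrable_abs_bound:
  fixes X Y :: "'a \<Rightarrow> real"
  assumes [measurable]: "X \<in> borel_measurable M"
    and "integrable M (\<lambda>\<omega>. (Y \<omega>)\<^sup>2)" "\<And>\<omega>. \<bar>X \<omega>\<bar> \<le> Y \<omega>"
  shows "integrable M (\<lambda>\<omega>. (X \<omega>)\<^sup>2)"
proof (rule Bochner_Integration.integrable_bound)
  show "integrable M (\<lambda>\<omega>. (Y \<omega>)\<^sup>2)" by fact
  have "(X \<omega>)\<^sup>2 \<le> (Y \<omega>)\<^sup>2" for \<omega> using assms(3)[of \<omega>] by (metis abs_ge_zero power2_abs power_mono)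
  thus "AE \<omega> in M. norm ((X \<omega>)\<^sup>2) \<le> norm ((Y \<omega>)\<^sup>2)" by simp
qed measurable

text \<open>The Ornstein-Uhlenbeck interpolation with an angle as parameter:
  \<open>g (l + 1), ..., g (2 * l)\<close> serve as an independent copy, the vectors at angles s and
  t have correlation cos (t - s), and adding pi to the angle negates the vector.\<close>

definition mix :: "nat \<Rightarrow> real \<Rightarrow> 'a \<Rightarrow> nat \<Rightarrow> real" where
  "mix l s \<omega> = (\<lambda>j. cos s * g j \<omega> + sin s * g (l + j) \<omega>)"

lemma mix_zero [simp]: "mix l 0 \<omega> = (\<lambda>j. g j \<omega>)"
  by (simp add: mix_def)

lemma sum_lipschitz_mix_measurable:
  assumes "sum_lipschitz l f"
  shows "(\<lambda>\<omega>. f (mix l s \<omega>)) \<in> borel_measurable M"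
proof -
  have fm: "f \<in> borel_measurable (PiM {1..l} (\<lambda>_. borel))" using assms by (rule sum_lipschitz_measurable)
  have "(\<lambda>\<omega>. f (\<lambda>j\<in>{1..l}. mix l s \<omega> j)) \<in> borel_measurable M"
    by (rule measurable_compose[OF measurable_restrict fm]) (auto simp: mix_def)
  moreover have "f (\<lambda>j\<in>{1..l}. mix l s \<omega> j) = f (mix l s \<omega>)" for \<omega>
    by (rule sum_lipschitz_eq[OF assms]) auto
  ultimately show ?thesis by simp
qed

lemma sum_lipschitz_mix_square_integrable:
  assumes "sum_lipschitz l f"
  shows "integrable M (\<lambda>\<omega>. (f (mix l s \<omega>))\<^sup>2)"
proof -
  obtain K where K: "K \<ge> 0" "\<And>x y. \<bar>f x - f y\<bar> \<le> K * (\<Sum>j=1..l. \<bar>x j - y j\<bar>)"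
    using assms unfolding sum_lipschitz_def by blast
  have int: "integrable M (\<lambda>\<omega>. (\<bar>f (\<lambda>_. 0)\<bar> + (\<Sum>j=1..l. K * \<bar>mix l s \<omega> j\<bar>))\<^sup>2)"
  proof (rule square_integrable_add[OF _ _ _ square_integrable_sum])
    fix j assume j: "j \<in> {1..l}"
    have "integrable M (\<lambda>\<omega>. (mix l s \<omega> j)\<^sup>2)"
      unfolding mix_def using j g_integrable_power[of j 2] g_integrable_power[of "l + j" 2]
      by (intro square_integrable_add) (auto simp: power_mult_distrib)
    thus "integrable M (\<lambda>\<omega>. (K * \<bar>mix l s \<omega> j\<bar>)\<^sup>2)" by (simp add: power_mult_distrib)
  qed (auto simp: mix_def)
  have "\<bar>f (mix l s \<omega>)\<bar> \<le> \<bar>f (\<lambda>_. 0)\<bar> + (\<Sum>j=1..l. K * \<bar>mix l s \<omega> j\<bar>)" for \<omega>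
    using K(2)[of "mix l s \<omega>" "\<lambda>_. 0"] by (simp add: sum_distrib_left)
  thus ?thesis
    using square_integrable_abs_bound[OF sum_lipschitz_mix_measurable[OF assms] int] by blast
qed

lemma sum_lipschitz_integrable:
  assumes "sum_lipschitz l f"
  shows "integrable M (\<lambda>\<omega>. f (\<lambda>j. g j \<omega>))"
  using integrable_mult_of_square_integrable[OF sum_lipschitz_mix_measurable[OF assms, of 0], of "\<lambda>_. 1"]
    sum_lipschitz_mix_square_integrable[OF assms, of 0] by simp

lemma rot_mix:
  "cos s * fst (rot a (x, y)) + sin s * snd (rot a (x, y)) = cos (s + a) * x + sin (s + a) * y"
  by (simp add: rot_def cos_add sin_add algebra_simps)

text \<open>Turning every pair by \<open>a\<close> shifts both angles by \<open>a\<close>;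
  correlations depend on the difference of the angles only.\<close>

lemma expectation_mix_shift:
  assumes f: "sum_lipschitz l f" and a: "\<bar>a\<bar> < pi"
  shows "expectation (\<lambda>\<omega>. f (mix l s \<omega>) * f (mix l t \<omega>)) =
         expectation (\<lambda>\<omega>. f (mix l (s + a) \<omega>) * f (mix l (t + a) \<omega>))"
proof -
  let ?T = "borel \<Otimes>\<^sub>M borel :: (real \<times> real) measure"
  define h where "h p = f (\<lambda>j\<in>{1..l}. cos s * fst (p j) + sin s * snd (p j)) *
      f (\<lambda>j\<in>{1..l}. cos t * fst (p j) + sin t * snd (p j))" for p :: "nat \<Rightarrow> real \<times> real"
  have [measurable]: "f \<in> borel_measurable (PiM {1..l} (\<lambda>_. borel))" using f by (rule sum_lipschitz_measurable)
  have h: "h \<in> borel_measurable (PiM {1..l} (\<lambda>_. ?T))"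
    unfolding h_def by measurable
  have e: "f x = f y" if "\<And>j. j \<in> {1..l} \<Longrightarrow> x j = y j" for x y
    using sum_lipschitz_eq[OF f that] .
  have 1: "h (\<lambda>j\<in>{1..l}. (g j \<omega>, g (l + j) \<omega>)) = f (mix l s \<omega>) * f (mix l t \<omega>)" for \<omega>
    unfolding h_def by (intro arg_cong2[where f = "(*)"] e) (auto simp: mix_def)
  have 2: "h (\<lambda>j\<in>{1..l}. rot a (g j \<omega>, g (l + j) \<omega>)) = f (mix l (s + a) \<omega>) * f (mix l (t + a) \<omega>)" for \<omega>
    unfolding h_def by (intro arg_cong2[where f = "(*)"] e) (auto simp: mix_def rot_mix)
  show ?thesis using expectation_rot[OF h a] by (simp only: 1 2)
qed

text \<open>At angle pi / 2 only the second half of the sequence remains, so the two values are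
  independent; a rotation by pi / 2 identifies their expectations.\<close>

lemma expectation_mix_orthogonal:
  assumes f: "sum_lipschitz l f"
  shows "expectation (\<lambda>\<omega>. f (mix l 0 \<omega>) * f (mix l (pi / 2) \<omega>)) = (expectation (\<lambda>\<omega>. f (\<lambda>j. g j \<omega>)))\<^sup>2"
proof -
  let ?T = "borel \<Otimes>\<^sub>M borel :: (real \<times> real) measure"
  have fm [measurable]: "f \<in> borel_measurable (PiM {1..l} (\<lambda>_. borel))" using f by (rule sum_lipschitz_measurable)
  have e: "f x = f y" if "\<And>j. j \<in> {1..l} \<Longrightarrow> x j = y j" for x y
    using sum_lipschitz_eq[OF f that] .
  have h: "(\<lambda>p. f (\<lambda>j\<in>{1..l}. fst (p j))) \<in> borel_measurable (PiM {1..l} (\<lambda>_. ?T))"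
    by measurable
  have "expectation (\<lambda>\<omega>. f (mix l (pi / 2) \<omega>)) = expectation (\<lambda>\<omega>. f (\<lambda>j\<in>{1..l}. fst ((\<lambda>j\<in>{1..l}. rot (pi / 2) (g j \<omega>, g (l + j) \<omega>)) j)))"
    by (intro Bochner_Integration.integral_cong refl e) (auto simp: mix_def rot_def)
  also have "\<dots> = expectation (\<lambda>\<omega>. f (\<lambda>j\<in>{1..l}. fst ((\<lambda>j\<in>{1..l}. (g j \<omega>, g (l + j) \<omega>)) j)))"
    by (rule expectation_rot[OF h]) simp
  also have "\<dots> = expectation (\<lambda>\<omega>. f (\<lambda>j. g j \<omega>))"
    by (intro Bochner_Integration.integral_cong refl e) auto
  finally have same: "expectation (\<lambda>\<omega>. f (mix l (pi / 2) \<omega>)) = expectation (\<lambda>\<omega>. f (\<lambda>j. g j \<omega>))" .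
  have "indep_var borel (f \<circ> (\<lambda>\<omega>. restrict (\<lambda>i. g i \<omega>) {1..l})) borel
      ((\<lambda>x. f (\<lambda>j\<in>{1..l}. x (l + j))) \<circ> (\<lambda>\<omega>. restrict (\<lambda>i. g i \<omega>) {l + 1..2 * l}))"
  proof (rule indep_var_compose[OF indep_var_restrict[OF indep]])
    show "(\<lambda>x. f (\<lambda>j\<in>{1..l}. x (l + j))) \<in> PiM {l + 1..2 * l} (\<lambda>_. borel) \<rightarrow>\<^sub>M borel"
      by (rule measurable_compose[OF measurable_restrict fm]) auto
  qed (use fm in auto)
  moreover have "f \<circ> (\<lambda>\<omega>. restrict (\<lambda>i. g i \<omega>) {1..l}) = (\<lambda>\<omega>. f (mix l 0 \<omega>))"
    by (rule ext) (auto intro!: e)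
  moreover have "(\<lambda>x. f (\<lambda>j\<in>{1..l}. x (l + j))) \<circ> (\<lambda>\<omega>. restrict (\<lambda>i. g i \<omega>) {l + 1..2 * l}) = (\<lambda>\<omega>. f (mix l (pi / 2) \<omega>))"
    by (rule ext) (auto intro!: e simp: mix_def)
  ultimately have ind: "indep_var borel (\<lambda>\<omega>. f (mix l 0 \<omega>)) borel (\<lambda>\<omega>. f (mix l (pi / 2) \<omega>))" by simp
  have int: "integrable M (\<lambda>\<omega>. f (mix l s \<omega>))" for s
    using integrable_mult_of_square_integrable[OF sum_lipschitz_mix_measurable[OF f, of s], of "\<lambda>_. 1"]
      sum_lipschitz_mix_square_integrable[OF f, of s] by simp
  show ?thesis
    using indep_var_lebesgue_integral[OF ind int int] same by (simp add: power2_eq_square)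
qed


text \<open>The second moment of the sum of the c_i X_i. Suitable coefficients give linear
  inequalities between correlations at different angles, in place of a spectral analysis of the
  process.\<close>

lemma gram_nonneg:
  fixes X :: "'i \<Rightarrow> 'a \<Rightarrow> real"
  assumes "finite I" and int: "\<And>i j. i \<in> I \<Longrightarrow> j \<in> I \<Longrightarrow> integrable M (\<lambda>\<omega>. X i \<omega> * X j \<omega>)"
  shows "0 \<le> (\<Sum>i\<in>I. \<Sum>j\<in>I. c i * c j * expectation (\<lambda>\<omega>. X i \<omega> * X j \<omega>))"
proof -
  have "(\<Sum>i\<in>I. \<Sum>j\<in>I. c i * c j * expectation (\<lambda>\<omega>. X i \<omega> * X j \<omega>)) =
    expectation (\<lambda>\<omega>. \<Sum>i\<in>I. \<Sum>j\<in>I. c i * c j * (X i \<omega> * X j \<omega>))"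
    using int by (simp add: Bochner_Integration.integral_sum)
  also have "(\<lambda>\<omega>. \<Sum>i\<in>I. \<Sum>j\<in>I. c i * c j * (X i \<omega> * X j \<omega>)) = (\<lambda>\<omega>. (\<Sum>i\<in>I. c i * X i \<omega>)\<^sup>2)"
    by (simp add: power2_eq_square sum_product mult_ac)
  finally show ?thesis by simp
qed

text \<open>
  A spectral gap for even functions on Gaussian space: the Ornstein-Uhlenbeck correlations of an
  even function are those of a function without first chaos. Since \<open>t \<mapsto> f (mix l t)\<close> is a
  stationary process of period \<open>\<pi>\<close>, its component that is antiperiodic under a shift by \<open>\<pi> / 2\<close> has
  no frequency below 2; this is proved by halving the angle, starting from \<open>\<pi> / 4\<close>.
\<close>

theorem even_correlation_le:
  assumes f: "sum_lipschitz l f" and even: "\<And>x. f (\<lambda>j. - x j) = f x"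
  defines "\<theta> \<equiv> \<lambda>m. pi / 2 ^ (m + 2)"
  shows "expectation (\<lambda>\<omega>. f (\<lambda>j. g j \<omega>) * f (mix l (\<theta> m) \<omega>)) \<le>
    (cos (\<theta> m))\<^sup>2 * expectation (\<lambda>\<omega>. (f (\<lambda>j. g j \<omega>))\<^sup>2) +
    (sin (\<theta> m))\<^sup>2 * (expectation (\<lambda>\<omega>. f (\<lambda>j. g j \<omega>)))\<^sup>2"
proof -
  define F where "F t \<omega> = f (mix l t \<omega>)" for t \<omega>
  have Fm [measurable]: "F t \<in> borel_measurable M" for t
    unfolding F_def using f by (rule sum_lipschitz_mix_measurable)
  have FF [simp]: "integrable M (\<lambda>\<omega>. F s \<omega> * F t \<omega>)" for s t
    unfolding F_def using f
    by (intro integrable_mult_of_square_integrable sum_lipschitz_mix_measurable sum_lipschitz_mix_square_integrable)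
  define k where "k u = expectation (\<lambda>\<omega>. F 0 \<omega> * F u \<omega>)" for u
  have stat: "expectation (\<lambda>\<omega>. F s \<omega> * F t \<omega>) = k (t - s)" if "\<bar>s\<bar> < pi" for s t
    unfolding k_def F_def using expectation_mix_shift[OF f, of "-s" s t] that by simp
  \<comment> \<open>Adding pi negates the vector, and \<open>f\<close> is even.\<close>
  have per': "F (t + pi) = F t" for t
    unfolding F_def fun_eq_iff
    using even[of "mix l t _"] by (simp add: mix_def)
  have per: "k (t + pi) = k t" for t by (simp add: k_def per')
  have per2: "k (t - pi / 2) = k (t + pi / 2)" for t using per[of "t - pi / 2"] by (simp add: field_simps)
  have sym: "k (- u) = k u" if "\<bar>u\<bar> < pi" for u
    using stat[of u 0] that by (simp add: k_def mult.commute)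
  \<comment> \<open>\<open>X\<close> is the part that changes sign under a shift by pi / 2; only the
    frequencies 2, 6, 10, ... can occur in it.\<close>
  define X where "X t \<omega> = F t \<omega> - F (t + pi / 2) \<omega>" for t \<omega>
  define r where "r u = k u - k (u + pi / 2)" for u
  have XX: "integrable M (\<lambda>\<omega>. X s \<omega> * X t \<omega>)" for s t
    unfolding X_def left_diff_distrib right_diff_distrib by simp
  have EX: "expectation (\<lambda>\<omega>. X s \<omega> * X t \<omega>) = 2 * r (t - s)" if "\<bar>s\<bar> < pi / 2" for s t
  proof -
    have s: "\<bar>s\<bar> < pi" "\<bar>s + pi / 2\<bar> < pi" using that by auto
    have "expectation (\<lambda>\<omega>. X s \<omega> * X t \<omega>) = k (t - s) - k (t - s - pi / 2) - (k (t - s + pi / 2) - k (t - s))"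
      unfolding X_def left_diff_distrib right_diff_distrib
      using s by (simp add: stat) (simp add: algebra_simps)
    thus ?thesis by (simp add: r_def per2)
  qed
  have rsym: "r (- u) = r u" if "\<bar>u\<bar> < pi / 2" for u
  proof -
    have "k (- u + pi / 2) = k (u - pi / 2)" using sym[of "u - pi / 2"] that by simp
    thus ?thesis using sym[of u] that by (simp add: r_def per2)
  qed
  have r0: "r 0 \<ge> 0"
  proof -
    have "0 \<le> expectation (\<lambda>\<omega>. X 0 \<omega> * X 0 \<omega>)" by (intro integral_nonneg_AE) auto
    thus ?thesis by (simp add: EX)
  qed
  \<comment> \<open>At pi / 4 both sides vanish, and the step passes from an angle to its half. The
    bound is consistent with every frequency 2, 6, 10, ..., because an odd multiple of
    \<open>2 * \<theta> m\<close> stays at distance at least \<open>2 * \<theta> m\<close> from the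
    multiples of 2 pi.\<close>
  have rb: "r (\<theta> m) \<le> cos (2 * \<theta> m) * r 0" for m
  proof (induction m)
    case 0
    have "k (pi / 4 + pi / 2) = k (pi / 4)"
      using per2[of "pi / 4"] sym[of "pi / 4"] by simp
    thus ?case by (simp add: \<theta>_def r_def)
  next
    case (Suc m)
    define \<alpha> where "\<alpha> = \<theta> (Suc m)"
    have "\<alpha> = pi / 8 / 2 ^ m" by (simp add: \<alpha>_def \<theta>_def)
    moreover have "pi / 8 / 2 ^ m \<le> pi / 8" using one_le_power[of "2::real" m] by (simp add: field_simps)
    ultimately have \<alpha>: "0 < \<alpha>" "\<alpha> \<le> pi / 8" by auto
    have \<theta>: "\<theta> m = 2 * \<alpha>" by (simp add: \<alpha>_def \<theta>_def)
    define c where "c = cos (2 * \<alpha>)"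
    have c: "c > 0" unfolding c_def using \<alpha> by (intro cos_gt_zero_pi) auto
    have c4: "cos (2 * \<theta> m) = 2 * c\<^sup>2 - 1" unfolding \<theta> c_def using cos_double_cos[of "2 * \<alpha>"] by simp
    \<comment> \<open>The combination X(alpha) + X(-alpha) - 2 cos (2 alpha) X(0) annihilates the
      frequency 2, so the positivity of its second moment loses nothing in the extremal
      case.\<close>
    define t :: "nat \<Rightarrow> real" where "t i = [\<alpha>, -\<alpha>, 0] ! i" for i
    define d :: "nat \<Rightarrow> real" where "d i = [1, 1, - (2 * c)] ! i" for i
    have "0 \<le> (\<Sum>i<3. \<Sum>j<3. d i * d j * expectation (\<lambda>\<omega>. X (t i) \<omega> * X (t j) \<omega>))"
      by (rule gram_nonneg) (auto intro: XX)
    also have "\<dots> = 4 * r 0 + 8 * c\<^sup>2 * r 0 + 4 * r (2 * \<alpha>) - 16 * c * r \<alpha>"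
      using \<alpha> rsym[of \<alpha>] rsym[of "2 * \<alpha>"]
      by (simp add: numeral_3_eq_3 t_def d_def EX power2_eq_square algebra_simps)
    finally have "16 * c * r \<alpha> \<le> 4 * r 0 + 8 * c\<^sup>2 * r 0 + 4 * r (2 * \<alpha>)" by simp
    also have "r (2 * \<alpha>) \<le> (2 * c\<^sup>2 - 1) * r 0" using Suc.IH unfolding c4 unfolding \<theta> .
    finally have "16 * c * r \<alpha> \<le> 16 * c * (c * r 0)" by (simp add: algebra_simps power2_eq_square)
    hence "r \<alpha> \<le> c * r 0" using c by simp
    thus ?case by (simp add: c_def \<alpha>_def)
  qed
  define u where "u = \<theta> m"
  have "u = pi / 4 / 2 ^ m" by (simp add: u_def \<theta>_def)
  moreover have "pi / 4 / 2 ^ m \<le> pi / 4" using one_le_power[of "2::real" m] by (simp add: field_simps)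
  ultimately have u: "0 < u" "u \<le> pi / 4" by auto
  \<comment> \<open>The complementary part, of period pi / 2. For it the positivity of the second
    moment of Y(0) - Y(u) is enough.\<close>
  define Y where "Y t \<omega> = F t \<omega> + F (t + pi / 2) \<omega>" for t \<omega>
  have YY: "integrable M (\<lambda>\<omega>. Y s \<omega> * Y t \<omega>)" for s t
    unfolding Y_def distrib_left distrib_right by simp
  have EY: "expectation (\<lambda>\<omega>. Y s \<omega> * Y t \<omega>) = 2 * (k (t - s) + k (t - s + pi / 2))" if "\<bar>s\<bar> < pi / 2" for s t
  proof -
    have s: "\<bar>s\<bar> < pi" "\<bar>s + pi / 2\<bar> < pi" using that by auto
    have "expectation (\<lambda>\<omega>. Y s \<omega> * Y t \<omega>) = k (t - s) + k (t - s - pi / 2) + (k (t - s + pi / 2) + k (t - s))"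
      unfolding Y_def distrib_left distrib_right
      using s by (simp add: stat) (simp add: algebra_simps)
    thus ?thesis by (simp add: per2)
  qed
  have "k (- u + pi / 2) = k (u + pi / 2)" using sym[of "u - pi / 2"] per2[of u] u by simp
  moreover have "k (- u) = k u" using sym[of u] u by simp
  moreover have "0 \<le> (\<Sum>i<2. \<Sum>j<2. [1, -1] ! i * [1, -1] ! j * expectation (\<lambda>\<omega>. Y ([0, u] ! i) \<omega> * Y ([0, u] ! j) \<omega>))"
    by (rule gram_nonneg) (auto intro: YY)
  ultimately have "k u + k (u + pi / 2) \<le> k 0 + k (pi / 2)"
    using u by (simp add: numeral_2_eq_2 EY algebra_simps)
  moreover have "k u - k (u + pi / 2) \<le> (1 - 2 * (sin u)\<^sup>2) * (k 0 - k (pi / 2))"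
    using rb[of m] unfolding u_def[symmetric] r_def cos_double_sin by simp
  \<comment> \<open>The sum of the bounds for the two parts; the value at pi / 2 is later replaced
    by the squared mean.\<close>
  ultimately have "2 * k u \<le> 2 * ((1 - (sin u)\<^sup>2) * k 0 + (sin u)\<^sup>2 * k (pi / 2))"
    by (simp add: algebra_simps)
  hence "k u \<le> (cos u)\<^sup>2 * k 0 + (sin u)\<^sup>2 * k (pi / 2)" by (simp add: cos_squared_eq)
  thus ?thesis
    using expectation_mix_orthogonal[OF f] by (simp add: k_def F_def u_def power2_eq_square)
qed

end

section \<open>Approximate fixed points\<close>

text \<open>
  Only Lipschitz maps are needed below, for which Kuhn's combinatorial lemma yields approximate
  fixed points without any compactness argument. The dimension is a natural number here, so
  that the version of Brouwer's theorem for Euclidean spaces does not apply.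
\<close>

theorem approximate_fixed_point:
  fixes f :: "(nat \<Rightarrow> real) \<Rightarrow> nat \<Rightarrow> real"
  assumes lip: "\<And>x y \<delta>. \<lbrakk>\<And>i. i < n \<Longrightarrow> x i \<in> {0..1}; \<And>i. i < n \<Longrightarrow> y i \<in> {0..1};
      \<And>i. i < n \<Longrightarrow> \<bar>x i - y i\<bar> \<le> \<delta>\<rbrakk> \<Longrightarrow> \<forall>i<n. \<bar>f x i - f y i\<bar> \<le> L * \<delta>"
    and maps: "\<And>x i. \<lbrakk>\<And>i. i < n \<Longrightarrow> x i \<in> {0..1}; i < n\<rbrakk> \<Longrightarrow> f x i \<in> {0..1}"
    and "\<epsilon> > 0"
  shows "\<exists>x. (\<forall>i<n. x i \<in> {0..1} \<and> \<bar>f x i - x i\<bar> \<le> \<epsilon>)"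
proof -
  \<comment> \<open>The mesh 1 / p is so fine that within one cell f(x) - x varies by at most
    epsilon in each coordinate.\<close>
  obtain p :: nat where p: "real p > (\<bar>L\<bar> + 1) / \<epsilon>" using reals_Archimedean2 by blast
  moreover have "(\<bar>L\<bar> + 1) / \<epsilon> > 0" using \<open>\<epsilon> > 0\<close> by (intro divide_pos_pos) auto
  ultimately have p0: "p > 0" by (metis gr0I of_nat_0 order_less_asym)
  have p1: "(\<bar>L\<bar> + 1) / real p \<le> \<epsilon>" using p \<open>\<epsilon> > 0\<close> p0 by (simp add: field_simps)
  define v where "v x i = real (x i) / real p" for x :: "nat \<Rightarrow> nat" and i
  \<comment> \<open>Label 0 says that \<open>f\<close> does not decrease the coordinate, label 1
    that it does not increase it. On the two opposite faces the label is prescribed by Kuhn's lemma,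
    and it agrees with this reading because \<open>f\<close> maps into the cube.\<close>
  define label where "label x i = (if x i = 0 then 0 else if x i = p then 1 else if v x i \<le> f (v x) i then 0 else 1 :: nat)" for x i
  have cube: "v x i \<in> {0..1}" if "x i \<le> p" for x i
    using that p0 by (simp add: v_def)
  have l0: "v x i \<le> f (v x) i" if "label x i = 0" "\<And>i. i < n \<Longrightarrow> x i \<le> p" "i < n" for x i
    using that maps[of "v x" i] cube p0 by (auto simp: label_def v_def split: if_splits)
  have l1: "f (v x) i \<le> v x i" if "label x i = 1" "\<And>i. i < n \<Longrightarrow> x i \<le> p" "i < n" for x i
    using that maps[of "v x" i] cube p0 by (auto simp: label_def v_def split: if_splits)
  obtain q where q: "\<forall>i<n. q i < p" and
    rs: "\<forall>i<n. \<exists>r s. (\<forall>j<n. q j \<le> r j \<and> r j \<le> q j + 1) \<and> (\<forall>j<n. q j \<le> s j \<and> s j \<le> q j + 1) \<and> label r i \<noteq> label s i"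
    by (rule kuhn_lemma[of p n label]) (use p0 in \<open>auto simp: label_def\<close>)
  have "\<bar>f (v q) i - v q i\<bar> \<le> \<epsilon>" if i: "i < n" for i
  proof -
    have xp: "x j \<le> p" if "\<forall>j<n. q j \<le> x j \<and> x j \<le> q j + 1" "j < n" for x j
      using q that by (metis Suc_eq_plus1 Suc_leI le_trans)
    have near: "v q i \<le> v x i \<and> v x i \<le> v q i + 1 / p \<and> \<bar>f (v x) i - f (v q) i\<bar> \<le> \<bar>L\<bar> / p"
      if x: "\<forall>j<n. q j \<le> x j \<and> x j \<le> q j + 1" for x
    proof -
      have d: "v q j \<le> v x j \<and> v x j \<le> v q j + 1 / p" if "j < n" for j
      proof -
        have "real (x j) \<le> real (q j) + 1" using x that by (metis of_nat_1 of_nat_add of_nat_le_iff)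
        thus ?thesis using x that p0 by (simp add: v_def field_simps)
      qed
      have "\<forall>i<n. \<bar>f (v x) i - f (v q) i\<bar> \<le> L * (1 / p)"
      proof (rule lip)
        fix j assume j: "j < n"
        show "v x j \<in> {0..1}" using xp[OF x j] by (rule cube)
        show "v q j \<in> {0..1}" using q j by (intro cube) (simp add: less_imp_le)
        show "\<bar>v x j - v q j\<bar> \<le> 1 / real p" using d[OF j] by auto
      qed
      hence "\<bar>f (v x) i - f (v q) i\<bar> \<le> L * (1 / p)" using i by blast
      also have "\<dots> \<le> \<bar>L\<bar> / p" by (simp add: divide_right_mono)
      finally show "v q i \<le> v x i \<and> v x i \<le> v q i + 1 / p \<and> \<bar>f (v x) i - f (v q) i\<bar> \<le> \<bar>L\<bar> / p"
        using d[OF i] by blast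
    qed
    obtain r s where "\<forall>j<n. q j \<le> r j \<and> r j \<le> q j + 1" "\<forall>j<n. q j \<le> s j \<and> s j \<le> q j + 1" "label r i \<noteq> label s i"
      using rs i by blast
    moreover have "label x i = 0 \<or> label x i = 1" for x by (auto simp: label_def)
    ultimately obtain r s where r: "\<forall>j<n. q j \<le> r j \<and> r j \<le> q j + 1" "label r i = 0"
      and s: "\<forall>j<n. q j \<le> s j \<and> s j \<le> q j + 1" "label s i = 1"
      by metis
    \<comment> \<open>At one corner of the cell the coordinate does not move down, at another it
      does not move up; comparing both with the corner \<open>q\<close> bounds the displacement at
      \<open>q\<close>.\<close>
    have "v r i \<le> f (v r) i" using l0[OF r(2) xp[OF r(1)] i] by blast
    moreover have "f (v s) i \<le> v s i" using l1[OF s(2) xp[OF s(1)] i] by blast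
    ultimately have "\<bar>f (v q) i - v q i\<bar> \<le> \<bar>L\<bar> / p + 1 / p"
      using near[OF r(1)] near[OF s(1)] by linarith
    thus ?thesis using p1 by (simp add: add_divide_distrib)
  qed
  moreover have "v q i \<in> {0..1}" if "i < n" for i using q that by (intro cube) (simp add: less_imp_le)
  ultimately show ?thesis by blast
qed

text \<open>The box [-R, R]^I is rescaled to the unit cube along an enumeration of \<open>I\<close>.
  Arguments and values are scaled by the same factor, so \<open>L\<close> is unchanged.\<close>

corollary approximate_fixed_point_box:
  fixes f :: "('i \<Rightarrow> real) \<Rightarrow> 'i \<Rightarrow> real"
  assumes I: "finite I" and R: "R > 0"
    and lip: "\<And>x y \<delta>. (\<And>i. i \<in> I \<Longrightarrow> \<bar>x i - y i\<bar> \<le> \<delta>) \<Longrightarrow> \<forall>i\<in>I. \<bar>f x i - f y i\<bar> \<le> L * \<delta>"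
    and maps: "\<And>x i. i \<in> I \<Longrightarrow> \<bar>f x i\<bar> \<le> R"
    and "\<epsilon> > 0"
  shows "\<exists>x. \<forall>i\<in>I. \<bar>f x i - x i\<bar> \<le> \<epsilon>"
proof -
  obtain h where h: "bij_betw h {..<card I} I" using ex_bij_betw_nat_finite[OF I] by (auto simp: atLeast0LessThan)
  define h' where "h' = inv_into {..<card I} h"
  have h'h: "h' (h i) = i" if "i < card I" for i
    using that h by (simp add: h'_def bij_betw_def inv_into_f_f)
  have h'I: "h' k < card I" "h (h' k) = k" if "k \<in> I" for k
    using that h by (auto simp: h'_def bij_betw_def intro: inv_into_into[of k h "{..<card I}", simplified] f_inv_into_f)
  define e where "e z = (\<lambda>k. R * (2 * z (h' k) - 1))" for z :: "nat \<Rightarrow> real"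
  define F where "F z i = (f (e z) (h i) / R + 1) / 2" for z i
  have hI: "h i \<in> I" if "i < card I" for i using that h by (auto simp: bij_betw_def)
  have "\<exists>z. \<forall>i<card I. z i \<in> {0..1} \<and> \<bar>F z i - z i\<bar> \<le> \<epsilon> / (2 * R)"
  proof (rule approximate_fixed_point[where L = L])
    fix x y :: "nat \<Rightarrow> real" and \<delta> assume d: "\<And>i. i < card I \<Longrightarrow> \<bar>x i - y i\<bar> \<le> \<delta>"
    have "\<forall>k\<in>I. \<bar>f (e x) k - f (e y) k\<bar> \<le> L * (2 * R * \<delta>)"
    proof (rule lip)
      fix k assume k: "k \<in> I"
      have "e x k - e y k = 2 * R * (x (h' k) - y (h' k))"
        by (simp add: e_def algebra_simps)
      hence "\<bar>e x k - e y k\<bar> = 2 * R * \<bar>x (h' k) - y (h' k)\<bar>"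
        using R by (simp add: abs_mult)
      thus "\<bar>e x k - e y k\<bar> \<le> 2 * R * \<delta>" using d[OF h'I(1)[OF k]] R by simp
    qed
    hence "\<bar>f (e x) (h i) - f (e y) (h i)\<bar> / (2 * R) \<le> L * (2 * R * \<delta>) / (2 * R)" if "i < card I" for i
      using hI[OF that] R by (intro divide_right_mono) auto
    moreover have "\<bar>F x i - F y i\<bar> = \<bar>f (e x) (h i) - f (e y) (h i)\<bar> / (2 * R)" for i
    proof -
      have "F x i - F y i = (f (e x) (h i) - f (e y) (h i)) / (2 * R)"
        using R by (simp add: F_def field_simps)
      thus ?thesis using R by (simp add: abs_divide)
    qed
    ultimately show "\<forall>i<card I. \<bar>F x i - F y i\<bar> \<le> L * \<delta>" using R by simp
  next
    fix x :: "nat \<Rightarrow> real" and i assume "i < card I"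
    hence "\<bar>f (e x) (h i)\<bar> \<le> R" using maps hI by blast
    thus "F x i \<in> {0..1}" using R by (auto simp: F_def field_simps abs_le_iff)
  qed (use R \<open>\<epsilon> > 0\<close> in auto)
  then obtain z where z: "\<And>i. i < card I \<Longrightarrow> \<bar>F z i - z i\<bar> \<le> \<epsilon> / (2 * R)" by blast
  have "\<bar>f (e z) k - e z k\<bar> \<le> \<epsilon>" if k: "k \<in> I" for k
  proof -
    have "f (e z) k - e z k = 2 * R * (F z (h' k) - z (h' k))"
      using R by (simp add: F_def e_def h'I(2)[OF k] field_simps)
    hence "\<bar>f (e z) k - e z k\<bar> = 2 * R * \<bar>F z (h' k) - z (h' k)\<bar>"
      using R by (simp add: abs_mult)
    also have "\<dots> \<le> 2 * R * (\<epsilon> / (2 * R))"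
      using z[OF h'I(1)[OF k]] R by (intro mult_left_mono) auto
    finally show ?thesis using R by simp
  qed
  thus ?thesis by blast
qed

section \<open>Gaussian linear combinations of matrices\<close>

lemma hs_norm_le_sum:
  assumes "A \<in> carrier_mat d d"
  shows "hs_norm A \<le> (\<Sum>a<d. \<Sum>b<d. cmod (A $$ (a, b)))"
  unfolding hs_norm_L2_set[OF assms] sum.cartesian_product
  by (rule order_trans[OF L2_set_le_sum]) (auto intro!: sum_mono)

text \<open>\<open>gauss_sum\<close> with deterministic coefficients: quantities are studied as
  functions of the coefficient vector before Gaussian values are inserted.\<close>

definition lin_comb :: "nat \<Rightarrow> nat \<Rightarrow> (nat \<Rightarrow> complex mat) \<Rightarrow> (nat \<Rightarrow> real) \<Rightarrow> complex mat" where
  "lin_comb d l X x = mat_sum d (\<lambda>j. complex_of_real (x j) \<cdot>\<^sub>m X j) {1..l}"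

lemma gauss_sum_lin_comb: "gauss_sum g d l C \<omega> = lin_comb d l C (\<lambda>j. g j \<omega>)"
  by (simp add: gauss_sum_def lin_comb_def)

context
  fixes d l :: nat and X :: "nat \<Rightarrow> complex mat"
  assumes XX: "\<forall>j\<in>{1..l}. X j \<in> carrier_mat d d"
begin

private lemma X [simp]: "j \<in> {1..l} \<Longrightarrow> X j \<in> carrier_mat d d"
  using XX by blast

lemma lin_comb_carrier [simp]: "lin_comb d l X x \<in> carrier_mat d d"
  unfolding lin_comb_def by (intro mat_sum_carrier) auto

lemma lin_comb_index:
  assumes "a < d" "b < d"
  shows "lin_comb d l X x $$ (a, b) = (\<Sum>j=1..l. complex_of_real (x j) * X j $$ (a, b))"
proof -
  have "dim_row (X j) = d" "dim_col (X j) = d" if "j \<in> {1..l}" for j using X[OF that] by auto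
  thus ?thesis unfolding lin_comb_def using assms by (subst mat_sum_index) auto
qed

lemma hs_inner_lin_comb:
  "hs_inner (lin_comb d l X x) (lin_comb d l X y) = (\<Sum>j=1..l. \<Sum>k=1..l. x j * y k * hs_inner (X j) (X k))"
proof -
  have "hs_inner (lin_comb d l X x) (lin_comb d l X y) =
    (\<Sum>a<d. \<Sum>b<d. \<Sum>j=1..l. \<Sum>k=1..l. x j * y k * Re (cnj (X j $$ (a, b)) * X k $$ (a, b)))"
  proof -
    have "Re (cnj (\<Sum>j=1..l. complex_of_real (x j) * u j) * (\<Sum>k=1..l. complex_of_real (y k) * w k)) =
      (\<Sum>j=1..l. \<Sum>k=1..l. x j * y k * Re (cnj (u j) * w k))" for u w :: "nat \<Rightarrow> complex"
      unfolding cnj_sum sum_product Re_sum by (intro sum.cong refl) (simp add: algebra_simps)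
    thus ?thesis unfolding hs_inner_sum[OF lin_comb_carrier lin_comb_carrier]
      by (intro sum.cong refl) (simp only: lessThan_iff lin_comb_index)
  qed
  also have "\<dots> = (\<Sum>j=1..l. \<Sum>k=1..l. \<Sum>a<d. \<Sum>b<d. x j * y k * Re (cnj (X j $$ (a, b)) * X k $$ (a, b)))"
  proof -
    have "(\<Sum>a<d. \<Sum>b<d. \<Sum>j=1..l. \<Sum>k=1..l. F a b j k) = (\<Sum>j=1..l. \<Sum>k=1..l. \<Sum>a<d. \<Sum>b<d. F a b j k)"
      for F :: "nat \<Rightarrow> nat \<Rightarrow> nat \<Rightarrow> nat \<Rightarrow> real"
    proof -
      have "(\<Sum>a<d. \<Sum>b<d. \<Sum>j=1..l. \<Sum>k=1..l. F a b j k) = (\<Sum>a<d. \<Sum>j=1..l. \<Sum>b<d. \<Sum>k=1..l. F a b j k)"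
        by (rule sum.cong[OF refl]) (rule sum.swap)
      also have "\<dots> = (\<Sum>j=1..l. \<Sum>a<d. \<Sum>b<d. \<Sum>k=1..l. F a b j k)"
        by (rule sum.swap)
      also have "\<dots> = (\<Sum>j=1..l. \<Sum>a<d. \<Sum>k=1..l. \<Sum>b<d. F a b j k)"
        by (rule sum.cong[OF refl], rule sum.cong[OF refl]) (rule sum.swap)
      also have "\<dots> = (\<Sum>j=1..l. \<Sum>k=1..l. \<Sum>a<d. \<Sum>b<d. F a b j k)"
        by (rule sum.cong[OF refl]) (rule sum.swap)
      finally show ?thesis .
    qed
    thus ?thesis .
  qed
  also have "\<dots> = (\<Sum>j=1..l. \<Sum>k=1..l. x j * y k * hs_inner (X j) (X k))"
    by (intro sum.cong refl) (simp only: hs_inner_sum[OF X X] sum_distrib_left)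
  finally show ?thesis .
qed

lemma lin_comb_minus: "lin_comb d l X (\<lambda>j. - x j) = (- 1) \<cdot>\<^sub>m lin_comb d l X x"
  by (intro eq_matI) (simp_all add: lin_comb_index sum_negf carrier_matD[OF lin_comb_carrier])

text \<open>This is the evenness required by \<open>even_correlation_le\<close>.\<close>

lemma mat_abs_lin_comb_minus: "mat_abs (lin_comb d l X (\<lambda>j. - x j)) = mat_abs (lin_comb d l X x)"
proof -
  have "mat_adjoint ((- 1) \<cdot>\<^sub>m A) * ((- 1) \<cdot>\<^sub>m A) = mat_adjoint A * A" if "A \<in> carrier_mat d d" for A :: "complex mat"
    using that by (intro eq_matI) (auto simp: mat_adjoint_smult scalar_prod_def)
  thus ?thesis by (simp add: mat_abs_def lin_comb_minus)
qed

lemma mat_adjoint_lin_comb: "mat_adjoint (lin_comb d l X x) = lin_comb d l (\<lambda>j. mat_adjoint (X j)) x"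
  unfolding lin_comb_def
  by (subst mat_adjoint_mat_sum) (auto simp: mat_adjoint_smult)

lemma lin_comb_norm_le: "hs_norm (lin_comb d l X x) \<le> (\<Sum>j=1..l. \<bar>x j\<bar> * hs_norm (X j))"
proof -
  have "hs_inner (lin_comb d l X x) (lin_comb d l X x) \<le> (\<Sum>j=1..l. \<Sum>k=1..l. (\<bar>x j\<bar> * hs_norm (X j)) * (\<bar>x k\<bar> * hs_norm (X k)))"
    unfolding hs_inner_lin_comb
  proof (intro sum_mono)
    fix j k assume jk: "j \<in> {1..l}" "k \<in> {1..l}"
    have "\<bar>hs_inner (X j) (X k)\<bar> \<le> hs_norm (X j) * hs_norm (X k)"
    proof -
      have "hs_inner ((-1) \<cdot>\<^sub>m X j) (X k) = - hs_inner (X j) (X k)"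
        using jk carrier_matD[OF X[OF jk(1)]] by (simp add: hs_inner_sum[of _ d d] sum_negf flip: minus_add_distrib)
      moreover have "hs_inner ((-1) \<cdot>\<^sub>m X j) (X k) \<le> hs_norm ((-1) \<cdot>\<^sub>m X j) * hs_norm (X k)"
        using jk by (intro hs_inner_le[of _ d d]) auto
      ultimately show ?thesis using hs_inner_le[OF X[OF jk(1)] X[OF jk(2)]] by (simp add: hs_norm_smult abs_le_iff)
    qed
    hence "\<bar>x j * x k\<bar> * \<bar>hs_inner (X j) (X k)\<bar> \<le> \<bar>x j * x k\<bar> * (hs_norm (X j) * hs_norm (X k))"
      by (intro mult_left_mono) auto
    moreover have "x j * x k * hs_inner (X j) (X k) \<le> \<bar>x j * x k\<bar> * \<bar>hs_inner (X j) (X k)\<bar>"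
      by (metis abs_ge_self abs_mult)
    ultimately show "x j * x k * hs_inner (X j) (X k) \<le> (\<bar>x j\<bar> * hs_norm (X j)) * (\<bar>x k\<bar> * hs_norm (X k))"
      by (simp add: abs_mult mult_ac)
  qed
  also have "\<dots> = (\<Sum>j=1..l. \<bar>x j\<bar> * hs_norm (X j))\<^sup>2" by (simp add: power2_eq_square sum_product)
  finally show ?thesis
    unfolding hs_norm_def[of "lin_comb d l X x"] by (intro real_le_lsqrt) (auto intro!: sum_nonneg)
qed

lemma lin_comb_diff: "lin_comb d l X x - lin_comb d l X y = lin_comb d l X (\<lambda>j. x j - y j)"
  by (intro eq_matI)
     (simp_all add: lin_comb_index sum_subtractf algebra_simps carrier_matD[OF lin_comb_carrier])

text \<open>Every functional that is Lipschitz for the Hilbert-Schmidt norm becomes an admissible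
  function of the Gaussian vector, hence measurable and integrable.\<close>

lemma sum_lipschitz_entry:
  assumes \<phi>: "\<And>A B. A \<in> carrier_mat d d \<Longrightarrow> B \<in> carrier_mat d d \<Longrightarrow> \<bar>\<phi> A - \<phi> B\<bar> \<le> K * hs_norm (A - B)" and K: "K \<ge> 0"
  shows "sum_lipschitz l (\<lambda>x. \<phi> (lin_comb d l X x))"
  unfolding sum_lipschitz_def
proof (intro exI conjI allI)
  let ?B = "\<Sum>j=1..l. hs_norm (X j)"
  show "K * ?B \<ge> 0" using K by (intro mult_nonneg_nonneg sum_nonneg) auto
  fix x y :: "nat \<Rightarrow> real"
  have "hs_norm (lin_comb d l X (\<lambda>j. x j - y j)) \<le> (\<Sum>j=1..l. \<bar>x j - y j\<bar> * hs_norm (X j))"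
    by (rule lin_comb_norm_le)
  also have "\<dots> \<le> (\<Sum>j=1..l. \<bar>x j - y j\<bar> * ?B)"
    by (intro sum_mono mult_left_mono member_le_sum) auto
  also have "\<dots> = ?B * (\<Sum>j=1..l. \<bar>x j - y j\<bar>)" by (simp only: sum_distrib_right[symmetric] mult.commute)
  finally have "K * hs_norm (lin_comb d l X x - lin_comb d l X y) \<le> K * (?B * (\<Sum>j=1..l. \<bar>x j - y j\<bar>))"
    using K by (simp only: lin_comb_diff mult_left_mono)
  with \<phi>[OF lin_comb_carrier lin_comb_carrier, of x y]
  show "\<bar>\<phi> (lin_comb d l X x) - \<phi> (lin_comb d l X y)\<bar> \<le> K * ?B * (\<Sum>j=1..l. \<bar>x j - y j\<bar>)"
    unfolding mult.assoc by linarith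
qed

end

text \<open>The real and the imaginary part of an entry, selected by a Boolean.\<close>

definition part :: "bool \<Rightarrow> complex \<Rightarrow> real" where
  "part q z = (if q then Re z else Im z)"

lemma part_diff: "part q (z - w) = part q z - part q w"
  by (simp add: part_def)

lemma abs_part_le: "\<bar>part q z\<bar> \<le> cmod z"
  by (simp add: part_def abs_Re_le_cmod abs_Im_le_cmod)

text \<open>Splits the pairing into 2 d^2 real products, so that scalar estimates for Gaussian
  functions apply to each coordinate.\<close>

lemma hs_inner_part:
  assumes "A \<in> carrier_mat d d" "B \<in> carrier_mat d d"
  shows "hs_inner A B = (\<Sum>a<d. \<Sum>b<d. \<Sum>q\<in>UNIV. part q (A $$ (a, b)) * part q (B $$ (a, b)))"
  unfolding hs_inner_sum[OF assms] by (intro sum.cong refl) (simp add: UNIV_bool part_def)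

lemma part_mat_abs_lipschitz:
  assumes "A \<in> carrier_mat d d" "B \<in> carrier_mat d d" "a < d" "b < d"
  shows "\<bar>part q (mat_abs A $$ (a, b)) - part q (mat_abs B $$ (a, b))\<bar> \<le> sqrt 2 * hs_norm (A - B)"
proof -
  have c: "mat_abs A \<in> carrier_mat d d" "mat_abs B \<in> carrier_mat d d" using assms by auto
  have "\<bar>part q (mat_abs A $$ (a, b)) - part q (mat_abs B $$ (a, b))\<bar> = \<bar>part q ((mat_abs A - mat_abs B) $$ (a, b))\<bar>"
    using c assms carrier_matD[OF c(1)] carrier_matD[OF c(2)] by (simp add: part_diff)
  also have "\<dots> \<le> hs_norm (mat_abs A - mat_abs B)"
    using c assms by (intro order_trans[OF abs_part_le] cmod_index_le_hs_norm[of _ d d]) (auto simp: minus_carrier_mat)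
  also have "\<dots> \<le> sqrt 2 * hs_norm (A - B)" using assms by (intro mat_abs_lipschitz)
  finally show ?thesis .
qed

lemma integral_triple_sum:
  fixes h :: "nat \<Rightarrow> nat \<Rightarrow> bool \<Rightarrow> 'a \<Rightarrow> real"
  assumes "\<And>a b q. a < d \<Longrightarrow> b < d \<Longrightarrow> integrable M (h a b q)"
  shows "(\<integral>\<omega>. (\<Sum>a<d. \<Sum>b<d. \<Sum>q\<in>UNIV. h a b q \<omega>) \<partial>M) = (\<Sum>a<d. \<Sum>b<d. \<Sum>q\<in>UNIV. \<integral>\<omega>. h a b q \<omega> \<partial>M)"
proof -
  have "(\<integral>\<omega>. (\<Sum>a<d. \<Sum>b<d. \<Sum>q\<in>UNIV. h a b q \<omega>) \<partial>M) = (\<Sum>a<d. \<integral>\<omega>. (\<Sum>b<d. \<Sum>q\<in>UNIV. h a b q \<omega>) \<partial>M)"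
    using assms by (intro Bochner_Integration.integral_sum Bochner_Integration.integrable_sum) auto
  also have "\<dots> = (\<Sum>a<d. \<Sum>b<d. \<integral>\<omega>. (\<Sum>q\<in>UNIV. h a b q \<omega>) \<partial>M)"
    using assms by (intro sum.cong refl Bochner_Integration.integral_sum Bochner_Integration.integrable_sum) auto
  also have "\<dots> = (\<Sum>a<d. \<Sum>b<d. \<Sum>q\<in>UNIV. \<integral>\<omega>. h a b q \<omega> \<partial>M)"
    using assms by (intro sum.cong refl Bochner_Integration.integral_sum) auto
  finally show ?thesis .
qed

context gaussian_sequence
begin

text \<open>The matrix E |X| of the fixed point problem, assembled from real expectations.\<close>

definition mean_abs :: "nat \<Rightarrow> nat \<Rightarrow> (nat \<Rightarrow> complex mat) \<Rightarrow> complex mat" where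
  "mean_abs d l X = mat d d (\<lambda>(a, b). Complex (expectation (\<lambda>\<omega>. Re (mat_abs (lin_comb d l X (\<lambda>j. g j \<omega>)) $$ (a, b))))
     (expectation (\<lambda>\<omega>. Im (mat_abs (lin_comb d l X (\<lambda>j. g j \<omega>)) $$ (a, b)))))"

lemma mean_abs_carrier [simp]: "mean_abs d l X \<in> carrier_mat d d"
  by (simp add: mean_abs_def)

lemma part_mean_abs:
  assumes "a < d" "b < d"
  shows "part q (mean_abs d l X $$ (a, b)) = expectation (\<lambda>\<omega>. part q (mat_abs (lin_comb d l X (\<lambda>j. g j \<omega>)) $$ (a, b)))"
  using assms by (simp add: mean_abs_def part_def)

context
  fixes d l :: nat and X :: "nat \<Rightarrow> complex mat"
  assumes X: "\<forall>j\<in>{1..l}. X j \<in> carrier_mat d d"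
begin

lemma sum_lipschitz_part_mat_abs:
  assumes "a < d" "b < d"
  shows "sum_lipschitz l (\<lambda>x. part q (mat_abs (lin_comb d l X x) $$ (a, b)))"
  using part_mat_abs_lipschitz[OF _ _ assms] by (intro sum_lipschitz_entry[OF X, where K = "sqrt 2"]) auto

lemma integrable_part_mat_abs:
  assumes "a < d" "b < d"
  shows "integrable M (\<lambda>\<omega>. part q (mat_abs (lin_comb d l X (\<lambda>j. g j \<omega>)) $$ (a, b)))"
  using sum_lipschitz_integrable[OF sum_lipschitz_part_mat_abs[OF assms]] .

lemma hs_inner_mean_abs:
  assumes Y: "Y \<in> carrier_mat d d"
  shows "integrable M (\<lambda>\<omega>. hs_inner Y (mat_abs (lin_comb d l X (\<lambda>j. g j \<omega>))))"
    "expectation (\<lambda>\<omega>. hs_inner Y (mat_abs (lin_comb d l X (\<lambda>j. g j \<omega>)))) = hs_inner Y (mean_abs d l X)"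
proof -
  have eq: "hs_inner Y (mat_abs (lin_comb d l X x)) =
    (\<Sum>a<d. \<Sum>b<d. \<Sum>q\<in>UNIV. part q (Y $$ (a, b)) * part q (mat_abs (lin_comb d l X x) $$ (a, b)))" for x
    by (rule hs_inner_part[OF Y mat_abs_carrier[OF lin_comb_carrier[OF X]]])
  show "integrable M (\<lambda>\<omega>. hs_inner Y (mat_abs (lin_comb d l X (\<lambda>j. g j \<omega>))))"
    unfolding eq using integrable_part_mat_abs by (intro Bochner_Integration.integrable_sum integrable_mult_right) auto
  show "expectation (\<lambda>\<omega>. hs_inner Y (mat_abs (lin_comb d l X (\<lambda>j. g j \<omega>)))) = hs_inner Y (mean_abs d l X)"
    unfolding eq using integrable_part_mat_abs
    by (subst integral_triple_sum) (auto simp: hs_inner_part[OF Y mean_abs_carrier] part_mean_abs intro!: sum.cong)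
qed

text \<open>The scalar estimate for even functions, summed over the real coordinates of |X|.\<close>

lemma expectation_hs_inner_mat_abs_mix_le:
  defines "\<theta> \<equiv> \<lambda>m. pi / 2 ^ (m + 2)"
  defines "A \<equiv> \<lambda>x. mat_abs (lin_comb d l X x)"
  shows "integrable M (\<lambda>\<omega>. hs_inner (A (\<lambda>j. g j \<omega>)) (A (mix l (\<theta> m) \<omega>)))"
    "expectation (\<lambda>\<omega>. hs_inner (A (\<lambda>j. g j \<omega>)) (A (mix l (\<theta> m) \<omega>))) \<le>
      (cos (\<theta> m))\<^sup>2 * expectation (\<lambda>\<omega>. hs_inner (A (\<lambda>j. g j \<omega>)) (A (\<lambda>j. g j \<omega>))) +
      (sin (\<theta> m))\<^sup>2 * hs_inner (mean_abs d l X) (mean_abs d l X)"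
proof -
  define f where "f a b q x = part q (A x $$ (a, b))" for a b q x
  have f: "sum_lipschitz l (f a b q)" if "a < d" "b < d" for a b q
    unfolding f_def A_def using that by (rule sum_lipschitz_part_mat_abs)
  have even: "f a b q (\<lambda>j. - x j) = f a b q x" for a b q x
    unfolding f_def A_def by (simp only: mat_abs_lin_comb_minus[OF X])
  have eq: "hs_inner (A x) (A y) = (\<Sum>a<d. \<Sum>b<d. \<Sum>q\<in>UNIV. f a b q x * f a b q y)" for x y
    unfolding f_def A_def by (rule hs_inner_part[OF mat_abs_carrier[OF lin_comb_carrier[OF X]] mat_abs_carrier[OF lin_comb_carrier[OF X]]])
  have int: "integrable M (\<lambda>\<omega>. f a b q (mix l s \<omega>) * f a b q (mix l t \<omega>))" if "a < d" "b < d" for a b q s t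
    using f[OF that] by (intro integrable_mult_of_square_integrable sum_lipschitz_mix_measurable sum_lipschitz_mix_square_integrable)
  have int0: "integrable M (\<lambda>\<omega>. f a b q (\<lambda>j. g j \<omega>) * f a b q (mix l t \<omega>))"
    "integrable M (\<lambda>\<omega>. f a b q (\<lambda>j. g j \<omega>) * f a b q (\<lambda>j. g j \<omega>))" if "a < d" "b < d" for a b q t
    using int[OF that, of q 0 t] int[OF that, of q 0 0] by simp_all
  show "integrable M (\<lambda>\<omega>. hs_inner (A (\<lambda>j. g j \<omega>)) (A (mix l (\<theta> m) \<omega>)))"
    unfolding eq using int0 by (intro Bochner_Integration.integrable_sum) auto
  have "expectation (\<lambda>\<omega>. hs_inner (A (\<lambda>j. g j \<omega>)) (A (mix l (\<theta> m) \<omega>))) =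
    (\<Sum>a<d. \<Sum>b<d. \<Sum>q\<in>UNIV. expectation (\<lambda>\<omega>. f a b q (\<lambda>j. g j \<omega>) * f a b q (mix l (\<theta> m) \<omega>)))"
    unfolding eq by (rule integral_triple_sum) (rule int0)
  also have "\<dots> \<le> (\<Sum>a<d. \<Sum>b<d. \<Sum>q\<in>UNIV. (cos (\<theta> m))\<^sup>2 * expectation (\<lambda>\<omega>. (f a b q (\<lambda>j. g j \<omega>))\<^sup>2) +
    (sin (\<theta> m))\<^sup>2 * (expectation (\<lambda>\<omega>. f a b q (\<lambda>j. g j \<omega>)))\<^sup>2)"
    unfolding \<theta>_def using f even by (intro sum_mono even_correlation_le) auto
  also have "\<dots> = (cos (\<theta> m))\<^sup>2 * (\<Sum>a<d. \<Sum>b<d. \<Sum>q\<in>UNIV. expectation (\<lambda>\<omega>. (f a b q (\<lambda>j. g j \<omega>))\<^sup>2)) +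
    (sin (\<theta> m))\<^sup>2 * (\<Sum>a<d. \<Sum>b<d. \<Sum>q\<in>UNIV. (expectation (\<lambda>\<omega>. f a b q (\<lambda>j. g j \<omega>)))\<^sup>2)"
    by (simp only: sum.distrib sum_distrib_left)
  also have "(\<Sum>a<d. \<Sum>b<d. \<Sum>q\<in>UNIV. expectation (\<lambda>\<omega>. (f a b q (\<lambda>j. g j \<omega>))\<^sup>2)) =
    expectation (\<lambda>\<omega>. hs_inner (A (\<lambda>j. g j \<omega>)) (A (\<lambda>j. g j \<omega>)))"
    unfolding eq power2_eq_square by (rule integral_triple_sum[symmetric]) (rule int0)
  also have "(\<Sum>a<d. \<Sum>b<d. \<Sum>q\<in>UNIV. (expectation (\<lambda>\<omega>. f a b q (\<lambda>j. g j \<omega>)))\<^sup>2) = hs_inner (mean_abs d l X) (mean_abs d l X)"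
    by (subst hs_inner_part[of _ d]) (auto simp: part_mean_abs f_def A_def power2_eq_square intro!: sum.cong)
  finally show "expectation (\<lambda>\<omega>. hs_inner (A (\<lambda>j. g j \<omega>)) (A (mix l (\<theta> m) \<omega>))) \<le>
      (cos (\<theta> m))\<^sup>2 * expectation (\<lambda>\<omega>. hs_inner (A (\<lambda>j. g j \<omega>)) (A (\<lambda>j. g j \<omega>))) +
      (sin (\<theta> m))\<^sup>2 * hs_inner (mean_abs d l X) (mean_abs d l X)" .
qed

text \<open>The pairing is bilinear in the two Gaussian vectors; equal coordinates have covariance
  cos t, different ones are uncorrelated.\<close>

lemma expectation_hs_inner_lin_comb_mix:
  "integrable M (\<lambda>\<omega>. hs_inner (lin_comb d l X (\<lambda>j. g j \<omega>)) (lin_comb d l X (mix l t \<omega>)))"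
  "expectation (\<lambda>\<omega>. hs_inner (lin_comb d l X (\<lambda>j. g j \<omega>)) (lin_comb d l X (mix l t \<omega>))) =
    cos t * (\<Sum>j=1..l. hs_inner (X j) (X j))"
proof -
  have int: "integrable M (\<lambda>\<omega>. g j \<omega> * mix l t \<omega> k)"
    and E: "expectation (\<lambda>\<omega>. g j \<omega> * mix l t \<omega> k) = (if j = k then cos t else 0)"
    if "j \<in> {1..l}" "k \<in> {1..l}" for j k
  proof -
    have eq: "g j \<omega> * mix l t \<omega> k = cos t * (g j \<omega> * g k \<omega>) + sin t * (g j \<omega> * g (l + k) \<omega>)" for \<omega>
      by (simp add: mix_def algebra_simps)
    have i: "integrable M (\<lambda>\<omega>. g j \<omega> * g k \<omega>)" "integrable M (\<lambda>\<omega>. g j \<omega> * g (l + k) \<omega>)"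
      using that by (auto intro!: g_expectation_mult)
    thus "integrable M (\<lambda>\<omega>. g j \<omega> * mix l t \<omega> k)" unfolding eq by auto
    show "expectation (\<lambda>\<omega>. g j \<omega> * mix l t \<omega> k) = (if j = k then cos t else 0)"
      unfolding eq using i that by (simp add: g_expectation_mult(2))
  qed
  have eq: "hs_inner (lin_comb d l X (\<lambda>j. g j \<omega>)) (lin_comb d l X (mix l t \<omega>)) =
    (\<Sum>j=1..l. \<Sum>k=1..l. g j \<omega> * mix l t \<omega> k * hs_inner (X j) (X k))" for \<omega>
    by (rule hs_inner_lin_comb[OF X])
  show "integrable M (\<lambda>\<omega>. hs_inner (lin_comb d l X (\<lambda>j. g j \<omega>)) (lin_comb d l X (mix l t \<omega>)))"
    unfolding eq using int by (intro Bochner_Integration.integrable_sum integrable_mult_left) auto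
  have "expectation (\<lambda>\<omega>. hs_inner (lin_comb d l X (\<lambda>j. g j \<omega>)) (lin_comb d l X (mix l t \<omega>))) =
    (\<Sum>j=1..l. \<Sum>k=1..l. expectation (\<lambda>\<omega>. g j \<omega> * mix l t \<omega> k * hs_inner (X j) (X k)))"
    unfolding eq using int
    by (subst Bochner_Integration.integral_sum)
       (auto intro!: Bochner_Integration.integrable_sum integrable_mult_left sum.cong Bochner_Integration.integral_sum)
  also have "\<dots> = (\<Sum>j=1..l. \<Sum>k=1..l. (if j = k then cos t else 0) * hs_inner (X j) (X k))"
    using E by (intro sum.cong refl) (simp del: atLeastAtMost_iff)
  also have "\<dots> = (\<Sum>j=1..l. \<Sum>k=1..l. if j = k then cos t * hs_inner (X j) (X k) else 0)"
    by (intro sum.cong refl) auto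
  also have "\<dots> = cos t * (\<Sum>j=1..l. hs_inner (X j) (X j))"
    by (simp add: sum_distrib_left)
  finally show "expectation (\<lambda>\<omega>. hs_inner (lin_comb d l X (\<lambda>j. g j \<omega>)) (lin_comb d l X (mix l t \<omega>))) =
    cos t * (\<Sum>j=1..l. hs_inner (X j) (X j))" .
qed

end

text \<open>\<open>hs_inner_mat_abs_ge\<close> is integrated over copies at angle
  \<open>\<theta> m\<close>: the left side is exactly 2 V cos, the right side at most 2 V cos^2 + S
  sin^2. The difference of the V terms and the S term share the factor 1 - cos; after dividing by it
  the angle tends to 0.\<close>

theorem second_moment_le_mean_abs:
  assumes X: "\<forall>j\<in>{1..l}. X j \<in> carrier_mat d d"
  defines "X' \<equiv> \<lambda>j. mat_adjoint (X j)"
  shows "(\<Sum>j=1..l. hs_inner (X j) (X j)) \<le>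
    hs_inner (mean_abs d l X) (mean_abs d l X) + hs_inner (mean_abs d l X') (mean_abs d l X')"
proof -
  have X': "\<forall>j\<in>{1..l}. X' j \<in> carrier_mat d d" using X by (simp add: X'_def)
  define V where "V = (\<Sum>j=1..l. hs_inner (X j) (X j))"
  define S where "S = hs_inner (mean_abs d l X) (mean_abs d l X) + hs_inner (mean_abs d l X') (mean_abs d l X')"
  define \<theta> where "\<theta> m = pi / 2 ^ (m + 2)" for m :: nat
  have adj: "lin_comb d l X' x = mat_adjoint (lin_comb d l X x)" for x
    unfolding X'_def by (rule mat_adjoint_lin_comb[symmetric, OF X])
  have c: "lin_comb d l X x \<in> carrier_mat d d" for x by (rule lin_comb_carrier[OF X])
  have self: "expectation (\<lambda>\<omega>. hs_inner (lin_comb d l X (\<lambda>j. g j \<omega>)) (lin_comb d l X (\<lambda>j. g j \<omega>))) = V"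
    using expectation_hs_inner_lin_comb_mix(2)[OF X, where t = 0] by (simp add: V_def)
  have abs1: "hs_inner (mat_abs (lin_comb d l X x)) (mat_abs (lin_comb d l X x)) = hs_inner (lin_comb d l X x) (lin_comb d l X x)" for x
    using c by (rule hs_inner_mat_abs_self)
  have abs2: "hs_inner (mat_abs (lin_comb d l X' x)) (mat_abs (lin_comb d l X' x)) = hs_inner (lin_comb d l X x) (lin_comb d l X x)" for x
    unfolding adj using c[of x] by (simp add: hs_inner_mat_abs_self[of _ d] hs_inner_adjoint[of _ d])
  have main: "2 * cos (\<theta> m) * V \<le> (1 + cos (\<theta> m)) * S" for m
  proof -
    have "pi / 2 ^ (m + 2) \<le> pi / 4" using one_le_power[of "2::real" m] by (simp add: field_simps)
    hence th: "0 < \<theta> m" "\<theta> m \<le> pi / 4" by (auto simp: \<theta>_def)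
    have cos1: "cos (\<theta> m) < 1" using th cos_monotone_0_pi[of 0 "\<theta> m"] by simp
    have "2 * (cos (\<theta> m) * V) = expectation (\<lambda>\<omega>. 2 * hs_inner (lin_comb d l X (\<lambda>j. g j \<omega>)) (lin_comb d l X (mix l (\<theta> m) \<omega>)))"
      using expectation_hs_inner_lin_comb_mix[OF X, where t = "\<theta> m"] by (simp add: V_def)
    also have "\<dots> \<le> expectation (\<lambda>\<omega>. hs_inner (mat_abs (lin_comb d l X (\<lambda>j. g j \<omega>))) (mat_abs (lin_comb d l X (mix l (\<theta> m) \<omega>))) +
        hs_inner (mat_abs (lin_comb d l X' (\<lambda>j. g j \<omega>))) (mat_abs (lin_comb d l X' (mix l (\<theta> m) \<omega>))))"
      using expectation_hs_inner_lin_comb_mix(1)[OF X] expectation_hs_inner_mat_abs_mix_le(1)[OF X]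
        expectation_hs_inner_mat_abs_mix_le(1)[OF X']
      unfolding \<theta>_def
      by (intro integral_mono Bochner_Integration.integrable_add integrable_mult_right)
         (simp_all add: adj hs_inner_mat_abs_ge[OF c c])
    also have "\<dots> = expectation (\<lambda>\<omega>. hs_inner (mat_abs (lin_comb d l X (\<lambda>j. g j \<omega>))) (mat_abs (lin_comb d l X (mix l (\<theta> m) \<omega>)))) +
        expectation (\<lambda>\<omega>. hs_inner (mat_abs (lin_comb d l X' (\<lambda>j. g j \<omega>))) (mat_abs (lin_comb d l X' (mix l (\<theta> m) \<omega>))))"
      unfolding \<theta>_def
      by (intro Bochner_Integration.integral_add expectation_hs_inner_mat_abs_mix_le(1) X X')
    also have "\<dots> \<le> ((cos (\<theta> m))\<^sup>2 * V + (sin (\<theta> m))\<^sup>2 * hs_inner (mean_abs d l X) (mean_abs d l X)) +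
       ((cos (\<theta> m))\<^sup>2 * V + (sin (\<theta> m))\<^sup>2 * hs_inner (mean_abs d l X') (mean_abs d l X'))"
      using expectation_hs_inner_mat_abs_mix_le(2)[OF X, of m] expectation_hs_inner_mat_abs_mix_le(2)[OF X', of m]
      unfolding \<theta>_def[symmetric] abs1 abs2 self by (rule add_mono)
    also have "\<dots> = 2 * (cos (\<theta> m))\<^sup>2 * V + (sin (\<theta> m))\<^sup>2 * S" by (simp add: S_def algebra_simps)
    also have "(sin (\<theta> m))\<^sup>2 = (1 - cos (\<theta> m)) * (1 + cos (\<theta> m))"
      by (simp add: sin_squared_eq algebra_simps power2_eq_square)
    finally have "(1 - cos (\<theta> m)) * (2 * cos (\<theta> m) * V) \<le> (1 - cos (\<theta> m)) * ((1 + cos (\<theta> m)) * S)"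
      by (simp add: algebra_simps power2_eq_square)
    thus ?thesis using cos1 by simp
  qed
  have lim: "(\<lambda>m. cos (\<theta> m)) \<longlonglongrightarrow> cos 0"
  proof (intro tendsto_intros)
    have "(\<lambda>m. pi / 4 * (1 / 2) ^ m) \<longlonglongrightarrow> pi / 4 * 0"
      by (intro tendsto_intros LIMSEQ_realpow_zero) auto
    thus "\<theta> \<longlonglongrightarrow> 0" by (simp add: \<theta>_def[abs_def] field_simps)
  qed
  have "(\<lambda>m. 2 * cos (\<theta> m) * V) \<longlonglongrightarrow> 2 * cos 0 * V" "(\<lambda>m. (1 + cos (\<theta> m)) * S) \<longlonglongrightarrow> (1 + cos 0) * S"
    by (intro tendsto_intros lim)+
  hence "2 * cos 0 * V \<le> (1 + cos 0) * S"
    using main by (intro LIMSEQ_le) auto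
  thus ?thesis by (simp add: V_def S_def)
qed

end

section \<open>The Sylvester equation\<close>

lemma psd_mat_hs_inner_nonneg:
  assumes P: "psd_mat d P" and A: "A \<in> carrier_mat d d"
  shows "hs_inner A (P * A) \<ge> 0" "hs_inner A (A * P) \<ge> 0"
proof -
  define T where "T = psd_sqrt P"
  have T: "psd_mat d T" "T * T = P" unfolding T_def using psd_sqrt[OF P] by auto
  note [simp] = psd_matD[OF T(1)] A
  have "hs_inner (T * A) (T * A) = hs_inner A (P * A)"
    by (subst hs_inner_mult_left[of _ d]) (auto simp: T(2)[symmetric] assoc_mult_mat[of _ d d _ d _ d])
  thus "hs_inner A (P * A) \<ge> 0" by (metis hs_inner_nonneg)
  have "hs_inner (A * T) (A * T) = hs_inner A (A * P)"
    by (subst hs_inner_mult_right[of _ d]) (auto simp: T(2)[symmetric] assoc_mult_mat[of _ d d _ d _ d])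
  thus "hs_inner A (A * P) \<ge> 0" by (metis hs_inner_nonneg)
qed

text \<open>The absolute value makes this positive for every matrix \<open>A\<close>, so the fixed
  point map is defined for all matrices; the multiple of the identity makes the Sylvester equation
  uniquely solvable.\<close>

definition regularize :: "nat \<Rightarrow> real \<Rightarrow> complex mat \<Rightarrow> complex mat" where
  "regularize d \<epsilon> A = mat_abs A + diag_real d (\<lambda>_. \<epsilon>)"

lemma diag_real_const_mult:
  assumes "A \<in> carrier_mat d d"
  shows "diag_real d (\<lambda>_. \<epsilon>) * A = complex_of_real \<epsilon> \<cdot>\<^sub>m A" "A * diag_real d (\<lambda>_. \<epsilon>) = complex_of_real \<epsilon> \<cdot>\<^sub>m A"
  using assms by (auto simp: index_diag_real_mult index_mult_diag_real simp del: index_mult_mat(1) intro!: eq_matI)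

lemma regularize_carrier [simp]: "A \<in> carrier_mat d d \<Longrightarrow> regularize d \<epsilon> A \<in> carrier_mat d d"
  by (simp add: regularize_def)

lemma regularize_adjoint: "A \<in> carrier_mat d d \<Longrightarrow> mat_adjoint (regularize d \<epsilon> A) = regularize d \<epsilon> A"
  by (simp add: regularize_def mat_adjoint_add[of _ d d])

lemma hs_inner_smult_right:
  assumes "A \<in> carrier_mat n m" "B \<in> carrier_mat n m"
  shows "hs_inner A (complex_of_real c \<cdot>\<^sub>m B) = c * hs_inner A B"
proof -
  have "Re (cnj (A $$ (i, j)) * (complex_of_real c \<cdot>\<^sub>m B) $$ (i, j)) = c * Re (cnj (A $$ (i, j)) * B $$ (i, j))"
    if "i < n" "j < m" for i j
    using assms that by (simp add: algebra_simps)
  thus ?thesis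
    unfolding hs_inner_sum[OF assms] hs_inner_sum[OF assms(1) smult_carrier_mat[OF assms(2)]] sum_distrib_left
    by (intro sum.cong refl) (simp only: lessThan_iff)
qed

text \<open>Coercivity of left and right multiplication, the source of the norm bound for the
  Sylvester equation.\<close>

lemma hs_inner_regularize_ge:
  assumes "A \<in> carrier_mat d d" "Z \<in> carrier_mat d d"
  shows "\<epsilon> * hs_inner Z Z \<le> hs_inner Z (regularize d \<epsilon> A * Z)" "\<epsilon> * hs_inner Z Z \<le> hs_inner Z (Z * regularize d \<epsilon> A)"
proof -
  note [simp] = assms
  have "regularize d \<epsilon> A * Z = mat_abs A * Z + complex_of_real \<epsilon> \<cdot>\<^sub>m Z"
    unfolding regularize_def by (subst add_mult_distrib_mat[of _ d d _ _ d]) (auto simp: diag_real_const_mult)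
  thus "\<epsilon> * hs_inner Z Z \<le> hs_inner Z (regularize d \<epsilon> A * Z)"
    using psd_mat_hs_inner_nonneg(1)[OF mat_abs_psd(1)[OF assms(1)] assms(2)]
    by (simp add: hs_inner_add_right[of _ d d] hs_inner_smult_right[of _ d d])
  have "Z * regularize d \<epsilon> A = Z * mat_abs A + complex_of_real \<epsilon> \<cdot>\<^sub>m Z"
    unfolding regularize_def by (subst mult_add_distrib_mat[of _ d d _ d]) (auto simp: diag_real_const_mult)
  thus "\<epsilon> * hs_inner Z Z \<le> hs_inner Z (Z * regularize d \<epsilon> A)"
    using psd_mat_hs_inner_nonneg(2)[OF mat_abs_psd(1)[OF assms(1)] assms(2)]
    by (simp add: hs_inner_add_right[of _ d d] hs_inner_smult_right[of _ d d])
qed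

lemma regularize_diagonalization:
  assumes "A \<in> carrier_mat d d" "\<epsilon> > 0"
  shows "\<exists>U f. unitary_mat d U \<and> (\<forall>i. f i > 0) \<and> regularize d \<epsilon> A = U * diag_real d f * mat_adjoint U"
proof -
  obtain U f where U: "unitary_mat d U" and f: "\<And>i. f i \<ge> 0" and A: "mat_abs A = U * diag_real d f * mat_adjoint U"
    using psd_mat_diagonalization[OF mat_abs_psd(1)[OF assms(1)]] by blast
  note [simp] = unitary_matD(1,2)[OF U]
  have e: "U * diag_real d (\<lambda>_. \<epsilon>) * mat_adjoint U = diag_real d (\<lambda>_. \<epsilon>)"
  proof -
    have "diag_real d (\<lambda>_. \<epsilon>) = complex_of_real \<epsilon> \<cdot>\<^sub>m 1\<^sub>m d" by (intro eq_matI) auto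
    moreover have "U * diag_real d (\<lambda>_. \<epsilon>) * mat_adjoint U = complex_of_real \<epsilon> \<cdot>\<^sub>m (U * mat_adjoint U)"
      by (simp add: diag_real_const_mult mult_smult_assoc_mat[of _ d d _ d])
    ultimately show ?thesis using unitary_matD(4)[OF U] by simp
  qed
  have "diag_real d (\<lambda>i. f i + \<epsilon>) = diag_real d f + diag_real d (\<lambda>_. \<epsilon>)" by (intro eq_matI) auto
  hence "U * diag_real d (\<lambda>i. f i + \<epsilon>) * mat_adjoint U = U * diag_real d f * mat_adjoint U + U * diag_real d (\<lambda>_. \<epsilon>) * mat_adjoint U"
    by (simp add: mult_add_distrib_mat[of _ d d _ d] add_mult_distrib_mat[of _ d d _ _ d])
  hence "regularize d \<epsilon> A = U * diag_real d (\<lambda>i. f i + \<epsilon>) * mat_adjoint U"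
    by (simp add: regularize_def A e)
  thus ?thesis using U f assms(2) by (intro exI[of _ U] exI[of _ "\<lambda>i. f i + \<epsilon>"]) (auto intro: add_nonneg_pos)
qed

text \<open>The choice is harmless for regularized coefficients: by \<open>sylvester_norm_le\<close>
  the homogeneous equation has only the zero solution.\<close>

definition sylvester :: "nat \<Rightarrow> complex mat \<Rightarrow> complex mat \<Rightarrow> complex mat \<Rightarrow> complex mat" where
  "sylvester d Y Y' C = (SOME Z. Z \<in> carrier_mat d d \<and> Y * Z + Z * Y' = C)"

text \<open>In eigenbases of the two coefficients the equation decouples into (f_i + h_j) K_ij =
  D_ij with f_i + h_j > 0.\<close>

lemma sylvester:
  assumes "A \<in> carrier_mat d d" "A' \<in> carrier_mat d d" and C: "C \<in> carrier_mat d d" and "\<epsilon> > 0"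
  defines "Z \<equiv> sylvester d (regularize d \<epsilon> A) (regularize d \<epsilon> A') C"
  shows "Z \<in> carrier_mat d d" "regularize d \<epsilon> A * Z + Z * regularize d \<epsilon> A' = C"
proof -
  obtain U f where U: "unitary_mat d U" and f: "\<And>i. f i > 0" and Y: "regularize d \<epsilon> A = U * diag_real d f * mat_adjoint U"
    using regularize_diagonalization[OF assms(1,4)] by blast
  obtain V h where V: "unitary_mat d V" and h: "\<And>i. h i > 0" and Y': "regularize d \<epsilon> A' = V * diag_real d h * mat_adjoint V"
    using regularize_diagonalization[OF assms(2,4)] by blast
  note [simp] = unitary_matD(1,2)[OF U] unitary_matD(1,2)[OF V] C
  note assoc = assoc_mult_mat[of _ d d _ d _ d]
  define D where "D = mat_adjoint U * C * V"
  have [simp]: "D \<in> carrier_mat d d" by (simp add: D_def)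
  define K where "K = mat d d (\<lambda>(i, j). D $$ (i, j) / complex_of_real (f i + h j))"
  have K [simp]: "K \<in> carrier_mat d d" by (simp add: K_def)
  have K1: "diag_real d f * K + K * diag_real d h = D"
  proof (rule eq_matI)
    fix i j assume "i < dim_row D" "j < dim_col D"
    hence ij: "i < d" "j < d" using carrier_matD[of D d d] by auto
    have "(diag_real d f * K + K * diag_real d h) $$ (i, j) = complex_of_real (f i + h j) * K $$ (i, j)"
      using ij carrier_matD[OF K]
      by (simp add: index_diag_real_mult[OF K] index_mult_diag_real[OF K] algebra_simps del: index_mult_mat(1))
    moreover have "f i + h j \<noteq> 0" using f[of i] h[of j] by linarith
    ultimately show "(diag_real d f * K + K * diag_real d h) $$ (i, j) = D $$ (i, j)"
      using ij by (simp add: K_def del: of_real_add)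
  qed (use carrier_matD[of D d d] carrier_matD[OF K] in auto)
  define Z0 where "Z0 = U * K * mat_adjoint V"
  have [simp]: "Z0 \<in> carrier_mat d d" by (simp add: Z0_def)
  have 1: "U * diag_real d f * mat_adjoint U * Z0 = U * (diag_real d f * K) * mat_adjoint V"
    using unitary_mult_cancel(1)[OF U, of "K * mat_adjoint V" d] by (simp add: Z0_def assoc)
  have 2: "Z0 * (V * diag_real d h * mat_adjoint V) = U * (K * diag_real d h) * mat_adjoint V"
    using unitary_mult_cancel(1)[OF V, of "diag_real d h * mat_adjoint V" d] by (simp add: Z0_def assoc)
  have "regularize d \<epsilon> A * Z0 + Z0 * regularize d \<epsilon> A' = U * (diag_real d f * K + K * diag_real d h) * mat_adjoint V"
    unfolding Y Y' 1 2 by (simp add: mult_add_distrib_mat[of _ d d _ d] add_mult_distrib_mat[of _ d d _ _ d])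
  also have "\<dots> = C"
    unfolding K1 D_def using unitary_mult_cancel(2)[OF U, of "C * V * mat_adjoint V" d] unitary_mult_cancel_right(1)[OF V C]
    by (simp add: assoc)
  finally have "\<exists>Z. Z \<in> carrier_mat d d \<and> regularize d \<epsilon> A * Z + Z * regularize d \<epsilon> A' = C"
    by (intro exI[of _ Z0]) auto
  from someI_ex[OF this] show "Z \<in> carrier_mat d d" "regularize d \<epsilon> A * Z + Z * regularize d \<epsilon> A' = C"
    unfolding Z_def sylvester_def by auto
qed

text \<open>Pair the equation with \<open>Z\<close>; each of the two terms contributes at least
  epsilon ||Z||^2.\<close>

lemma sylvester_norm_le:
  assumes "A \<in> carrier_mat d d" "A' \<in> carrier_mat d d" "Z \<in> carrier_mat d d" "\<epsilon> > 0"
    "regularize d \<epsilon> A * Z + Z * regularize d \<epsilon> A' = C"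
  shows "hs_norm Z \<le> hs_norm C / (2 * \<epsilon>)"
proof -
  note [simp] = assms(1-3)
  have C: "C \<in> carrier_mat d d" unfolding assms(5)[symmetric] by simp
  have "hs_inner Z C = hs_inner Z (regularize d \<epsilon> A * Z) + hs_inner Z (Z * regularize d \<epsilon> A')"
    unfolding assms(5)[symmetric] by (rule hs_inner_add_right[of _ d d]) auto
  hence "2 * \<epsilon> * hs_inner Z Z \<le> hs_inner Z C"
    using hs_inner_regularize_ge(1)[OF assms(1,3), of \<epsilon>] hs_inner_regularize_ge(2)[OF assms(2,3), of \<epsilon>] by simp
  also have "\<dots> \<le> hs_norm Z * hs_norm C" using C by (intro hs_inner_le[of _ d d]) auto
  finally have "(2 * \<epsilon> * hs_norm Z) * hs_norm Z \<le> hs_norm C * hs_norm Z"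
    by (simp add: hs_norm_square[symmetric] power2_eq_square mult_ac)
  hence "2 * \<epsilon> * hs_norm Z \<le> hs_norm C"
    by (cases "hs_norm Z = 0") (auto simp: less_le)
  thus ?thesis using assms(4) by (simp add: field_simps)
qed

lemma mat_diff_add_diff:
  fixes P Q R S :: "complex mat"
  assumes "P \<in> carrier_mat n m" "Q \<in> carrier_mat n m" "R \<in> carrier_mat n m" "S \<in> carrier_mat n m"
  shows "(P - Q) + (R - S) = (P + R) - (Q + S)"
  using assms by (intro eq_matI) auto

text \<open>The difference of the solutions \<open>Z\<close> and \<open>W\<close> solves the
  equation with the coefficients of \<open>Z\<close> and right-hand side (RB - RA) W + W (RB' -
  RA'). Bounding first it and then \<open>W\<close> by \<open>sylvester_norm_le\<close> gives the
  factor 1 / (2 epsilon)^2; sqrt 2 comes from \<open>mat_abs_lipschitz\<close>.\<close>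

lemma sylvester_lipschitz:
  assumes A: "A \<in> carrier_mat d d" "A' \<in> carrier_mat d d" "B \<in> carrier_mat d d" "B' \<in> carrier_mat d d"
    and C: "C \<in> carrier_mat d d" and \<epsilon>: "\<epsilon> > 0"
  shows "hs_norm (sylvester d (regularize d \<epsilon> A) (regularize d \<epsilon> A') C - sylvester d (regularize d \<epsilon> B) (regularize d \<epsilon> B') C)
    \<le> hs_norm C / (2 * \<epsilon>)\<^sup>2 * sqrt 2 * (hs_norm (A - B) + hs_norm (A' - B'))"
proof -
  define Z where "Z = sylvester d (regularize d \<epsilon> A) (regularize d \<epsilon> A') C"
  define W where "W = sylvester d (regularize d \<epsilon> B) (regularize d \<epsilon> B') C"
  have Z: "Z \<in> carrier_mat d d" "regularize d \<epsilon> A * Z + Z * regularize d \<epsilon> A' = C"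
    unfolding Z_def using sylvester[OF A(1,2) C \<epsilon>] by auto
  have W: "W \<in> carrier_mat d d" "regularize d \<epsilon> B * W + W * regularize d \<epsilon> B' = C"
    unfolding W_def using sylvester[OF A(3,4) C \<epsilon>] by auto
  note [simp] = A Z(1) W(1)
  have d1: "regularize d \<epsilon> B - regularize d \<epsilon> A = mat_abs B - mat_abs A" if "A \<in> carrier_mat d d" "B \<in> carrier_mat d d" for A B
    using carrier_matD[OF mat_abs_carrier[OF that(1)]] carrier_matD[OF mat_abs_carrier[OF that(2)]]
    by (intro eq_matI) (auto simp: regularize_def)
  define RA RA' RB RB' where R: "RA = regularize d \<epsilon> A" "RA' = regularize d \<epsilon> A'" "RB = regularize d \<epsilon> B" "RB' = regularize d \<epsilon> B'"
  have [simp]: "RA \<in> carrier_mat d d" "RA' \<in> carrier_mat d d" "RB \<in> carrier_mat d d" "RB' \<in> carrier_mat d d"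
    by (auto simp: R)
  have eq: "RA * (Z - W) + (Z - W) * RA' = (RB - RA) * W + W * (RB' - RA')"
  proof -
    have "RA * (Z - W) + (Z - W) * RA' = (RA * Z - RA * W) + (Z * RA' - W * RA')"
      by (simp add: mult_minus_distrib_mat[of _ d d _ d] minus_mult_distrib_mat[of _ d d _ _ d])
    also have "\<dots> = (RA * Z + Z * RA') - (RA * W + W * RA')"
      by (rule mat_diff_add_diff[of _ d d]) auto
    also have "\<dots> = (RB * W + W * RB') - (RA * W + W * RA')"
      using Z(2) W(2) by (simp add: R)
    also have "\<dots> = (RB * W - RA * W) + (W * RB' - W * RA')"
      by (rule mat_diff_add_diff[of _ d d, symmetric]) auto
    also have "\<dots> = (RB - RA) * W + W * (RB' - RA')"
      by (simp add: mult_minus_distrib_mat[of _ d d _ d] minus_mult_distrib_mat[of _ d d _ _ d])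
    finally show ?thesis .
  qed
  have "hs_norm (Z - W) \<le> hs_norm ((RB - RA) * W + W * (RB' - RA')) / (2 * \<epsilon>)"
    using \<epsilon> eq by (intro sylvester_norm_le[OF A(1,2)]) (auto simp: R minus_carrier_mat)
  also have "hs_norm ((RB - RA) * W + W * (RB' - RA')) \<le> hs_norm ((RB - RA) * W) + hs_norm (W * (RB' - RA'))"
    by (rule hs_norm_triangle[of _ d d]) (auto simp: minus_carrier_mat)
  also have "\<dots> \<le> hs_norm (RB - RA) * hs_norm W + hs_norm W * hs_norm (RB' - RA')"
    by (intro add_mono hs_norm_mult[of _ d d _ d]) (auto simp: minus_carrier_mat)
  also have "hs_norm (RB - RA) \<le> sqrt 2 * hs_norm (A - B)"
  proof -
    have "mat_abs A - mat_abs B \<in> carrier_mat d d" "mat_abs B - mat_abs A = (-1) \<cdot>\<^sub>m (mat_abs A - mat_abs B)"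
      using carrier_matD[OF mat_abs_carrier[OF A(1)]] carrier_matD[OF mat_abs_carrier[OF A(3)]]
      by (auto simp: minus_carrier_mat intro!: eq_matI)
    thus ?thesis using mat_abs_lipschitz[OF A(1,3)] by (simp add: R d1 hs_norm_smult)
  qed
  also have "hs_norm (RB' - RA') \<le> sqrt 2 * hs_norm (A' - B')"
  proof -
    have "mat_abs A' - mat_abs B' \<in> carrier_mat d d" "mat_abs B' - mat_abs A' = (-1) \<cdot>\<^sub>m (mat_abs A' - mat_abs B')"
      using carrier_matD[OF mat_abs_carrier[OF A(2)]] carrier_matD[OF mat_abs_carrier[OF A(4)]]
      by (auto simp: minus_carrier_mat intro!: eq_matI)
    thus ?thesis using mat_abs_lipschitz[OF A(2,4)] by (simp add: R d1 hs_norm_smult)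
  qed
  finally have "hs_norm (Z - W) \<le> (sqrt 2 * hs_norm (A - B) * hs_norm W + hs_norm W * (sqrt 2 * hs_norm (A' - B'))) / (2 * \<epsilon>)"
    using \<epsilon> by (simp add: divide_right_mono mult_right_mono mult_left_mono)
  also have "\<dots> = hs_norm W * (sqrt 2 * (hs_norm (A - B) + hs_norm (A' - B')) / (2 * \<epsilon>))"
    by (simp add: algebra_simps add_divide_distrib)
  also have "\<dots> \<le> hs_norm C / (2 * \<epsilon>) * (sqrt 2 * (hs_norm (A - B) + hs_norm (A' - B')) / (2 * \<epsilon>))"
    using sylvester_norm_le[OF A(3,4) W(1) \<epsilon> W(2)] \<epsilon> by (intro mult_right_mono) auto
  also have "\<dots> = hs_norm C / (2 * \<epsilon>)\<^sup>2 * sqrt 2 * (hs_norm (A - B) + hs_norm (A' - B'))"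
    by (simp add: power2_eq_square)
  finally show ?thesis by (simp add: Z_def W_def)
qed

section \<open>The upper bound\<close>

text \<open>Test \<open>Y * Z + Z * Y'\<close> against the polar factor \<open>W\<close> of
  \<open>Z\<close>: by cyclicity of the trace one term meets \<open>Z * W\<close> and the other
  \<open>W * Z\<close>, so both absolute values appear at once.\<close>

lemma trace_mat_abs_sylvester_ge:
  assumes Z: "Z \<in> carrier_mat d d" and Y: "Y \<in> carrier_mat d d" "mat_adjoint Y = Y"
    and Y': "Y' \<in> carrier_mat d d" "mat_adjoint Y' = Y'"
  shows "hs_inner Y (mat_abs (mat_adjoint Z)) + hs_inner Y' (mat_abs Z) \<le> Re (mat_trace (mat_abs (Y * Z + Z * Y')))"
proof -
  obtain W where W: "partial_isometry d W" "W * Z = mat_abs Z" "Z * W = mat_abs (mat_adjoint Z)"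
    by (rule polar_decomposition[OF Z]) blast
  note [simp] = Z Y(1) Y'(1) partial_isometry_carrier[OF W(1)]
  note assoc = assoc_mult_mat[of _ d d _ d _ d]
  have "mat_trace (W * (Y * Z + Z * Y')) = mat_trace (W * (Y * Z)) + mat_trace (W * (Z * Y'))"
    by (simp add: mult_add_distrib_mat[of _ d d _ d] mat_trace_add[of _ d])
  also have "mat_trace (W * (Y * Z)) = mat_trace (Y * Z * W)"
    by (rule mat_trace_comm[of _ d d]) auto
  also have "Y * Z * W = Y * mat_abs (mat_adjoint Z)" by (simp add: assoc W(3))
  also have "W * (Z * Y') = mat_abs Z * Y'" by (simp add: assoc[symmetric] W(2))
  also have "mat_trace (mat_abs Z * Y') = mat_trace (Y' * mat_abs Z)"
    using mat_abs_carrier[OF Z] by (intro mat_trace_comm[of _ d d]) auto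
  finally have "Re (mat_trace (W * (Y * Z + Z * Y'))) = hs_inner Y (mat_abs (mat_adjoint Z)) + hs_inner Y' (mat_abs Z)"
    by (simp add: hs_inner_def Y(2) Y'(2))
  thus ?thesis using trace_partial_isometry_le_trace_abs[OF W(1), of "Y * Z + Z * Y'"] by simp
qed

lemma S1_l2_norm_le_decomposition:
  assumes "finite I" "\<forall>k\<in>I. X k \<in> carrier_mat d d \<and> Y k \<in> carrier_mat d d \<and> C k = X k + Y k"
  shows "S1_l2_norm d I C \<le>
     Re (mat_trace (psd_sqrt (mat_sum d (\<lambda>k. mat_adjoint (X k) * X k) I))) +
     Re (mat_trace (psd_sqrt (mat_sum d (\<lambda>k. Y k * mat_adjoint (Y k)) I)))"
  unfolding S1_l2_norm_def
proof (rule cInf_lower)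
  show "bdd_below {Re (mat_trace (psd_sqrt (mat_sum d (\<lambda>k. mat_adjoint (X k) * X k) I))) +
     Re (mat_trace (psd_sqrt (mat_sum d (\<lambda>k. Y k * mat_adjoint (Y k)) I))) | X Y.
      \<forall>k\<in>I. X k \<in> carrier_mat d d \<and> Y k \<in> carrier_mat d d \<and> C k = X k + Y k}"
  proof (intro bdd_belowI[of _ 0], safe)
    fix X Y :: "'a \<Rightarrow> complex mat"
    assume XY: "\<forall>k\<in>I. X k \<in> carrier_mat d d \<and> Y k \<in> carrier_mat d d \<and> C k = X k + Y k"
    have "psd_mat d (mat_sum d (\<lambda>k. mat_adjoint (X k) * X k) I)"
      using XY by (intro psd_mat_mat_sum assms(1) psd_mat_gram[of _ d]) auto
    moreover have "psd_mat d (mat_sum d (\<lambda>k. Y k * mat_adjoint (Y k)) I)"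
      using XY psd_mat_gram[of "mat_adjoint (Y _)" d d] by (intro psd_mat_mat_sum assms(1)) auto
    ultimately show "0 \<le> Re (mat_trace (psd_sqrt (mat_sum d (\<lambda>k. mat_adjoint (X k) * X k) I))) +
     Re (mat_trace (psd_sqrt (mat_sum d (\<lambda>k. Y k * mat_adjoint (Y k)) I)))"
      by (intro add_nonneg_nonneg psd_mat_trace_nonneg psd_sqrt(1))
  qed
qed (use assms(2) in blast)

text \<open>The splitting has column part X_k Y' and row part Y X_k. Their sums of squares are Y' R
  Y' and Y R' Y with the two sums of squares R, R' of the X_k, and
  \<open>trace_sqrt_sandwich_le\<close> estimates the roots.\<close>

lemma S1_l2_norm_le_sylvester:
  assumes I: "finite I" and X: "\<forall>k\<in>I. X k \<in> carrier_mat d d"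
    and Y: "Y \<in> carrier_mat d d" "mat_adjoint Y = Y" and Y': "Y' \<in> carrier_mat d d" "mat_adjoint Y' = Y'"
    and C: "\<forall>k\<in>I. C k = Y * X k + X k * Y'"
  shows "S1_l2_norm d I C \<le> sqrt (\<Sum>k\<in>I. hs_inner (X k) (X k)) * (hs_norm Y + hs_norm Y')"
proof -
  have X' [simp]: "X k \<in> carrier_mat d d" if "k \<in> I" for k using X that by blast
  note [simp] = Y(1) Y'(1)
  note assoc = assoc_mult_mat[of _ d d _ d _ d]
  define R where "R = mat_sum d (\<lambda>k. mat_adjoint (X k) * X k) I"
  define R' where "R' = mat_sum d (\<lambda>k. X k * mat_adjoint (X k)) I"
  have R: "psd_mat d R" unfolding R_def by (intro psd_mat_mat_sum I psd_mat_gram[of _ d]) auto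
  have R': "psd_mat d R'" unfolding R'_def using psd_mat_gram[of "mat_adjoint (X _)" d d]
    by (intro psd_mat_mat_sum I) auto
  have trR: "Re (mat_trace R) = (\<Sum>k\<in>I. hs_inner (X k) (X k))"
    unfolding R_def by (subst mat_trace_mat_sum) (auto simp: I hs_inner_def)
  have trR': "Re (mat_trace R') = (\<Sum>k\<in>I. hs_inner (X k) (X k))"
    unfolding R'_def hs_inner_def
    by (subst mat_trace_mat_sum) (auto simp: I mat_trace_comm[of "X _" d d "mat_adjoint (X _)"] intro!: sum.cong)
  have 1: "mat_sum d (\<lambda>k. mat_adjoint (X k * Y') * (X k * Y')) I = mat_adjoint Y' * R * Y'"
  proof -
    have "mat_adjoint Y' * R * Y' = mat_sum d (\<lambda>k. mat_adjoint Y' * (mat_adjoint (X k) * X k) * Y') I"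
      unfolding R_def using I by (subst mat_sum_mult_left, simp_all, subst mat_sum_mult_right) auto
    also have "\<dots> = mat_sum d (\<lambda>k. mat_adjoint (X k * Y') * (X k * Y')) I"
      using I by (intro mat_sum_cong) (auto simp: mat_adjoint_mult[of _ d d _ d] assoc)
    finally show ?thesis by simp
  qed
  have 2: "mat_sum d (\<lambda>k. (Y * X k) * mat_adjoint (Y * X k)) I = mat_adjoint Y * R' * Y"
  proof -
    have "mat_adjoint Y * R' * Y = mat_sum d (\<lambda>k. Y * (X k * mat_adjoint (X k)) * Y) I"
      unfolding R'_def Y(2) using I by (subst mat_sum_mult_left, simp_all, subst mat_sum_mult_right) auto
    also have "\<dots> = mat_sum d (\<lambda>k. (Y * X k) * mat_adjoint (Y * X k)) I"
      using I by (intro mat_sum_cong) (auto simp: mat_adjoint_mult[of _ d d _ d] assoc Y(2))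
    finally show ?thesis by simp
  qed
  have "S1_l2_norm d I C \<le>
     Re (mat_trace (psd_sqrt (mat_sum d (\<lambda>k. mat_adjoint (X k * Y') * (X k * Y')) I))) +
     Re (mat_trace (psd_sqrt (mat_sum d (\<lambda>k. (Y * X k) * mat_adjoint (Y * X k)) I)))"
    using C by (intro S1_l2_norm_le_decomposition I) (auto intro!: comm_add_mat[of _ d d])
  also have "\<dots> \<le> sqrt (Re (mat_trace R)) * hs_norm Y' + sqrt (Re (mat_trace R')) * hs_norm Y"
    unfolding 1 2 using R R' by (intro add_mono trace_sqrt_sandwich_le) auto
  finally show ?thesis by (simp add: trR trR' algebra_simps)
qed

context gaussian_sequence
begin

lemma lin_comb_diff_family:
  assumes "\<forall>j\<in>{1..l}. X j \<in> carrier_mat d d" "\<forall>j\<in>{1..l}. Z j \<in> carrier_mat d d"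
  shows "lin_comb d l X x - lin_comb d l Z x = lin_comb d l (\<lambda>j. X j - Z j) x"
proof -
  have XZ: "\<forall>j\<in>{1..l}. X j - Z j \<in> carrier_mat d d" using assms by (auto simp: minus_carrier_mat)
  note c = carrier_matD[OF lin_comb_carrier[OF assms(1)]] carrier_matD[OF lin_comb_carrier[OF assms(2)]]
    carrier_matD[OF lin_comb_carrier[OF XZ]]
  have "(X j - Z j) $$ (a, b) = X j $$ (a, b) - Z j $$ (a, b)" if "j \<in> {1..l}" "a < d" "b < d" for j a b
    using index_minus_mat(1)[of a "Z j" b "X j"] carrier_matD[OF bspec[OF assms(2) that(1)]] that(2,3) by simp
  note e = this
  show ?thesis
  proof (rule eq_matI)
    fix a b assume "a < dim_row (lin_comb d l (\<lambda>j. X j - Z j) x)" "b < dim_col (lin_comb d l (\<lambda>j. X j - Z j) x)"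
    hence ab: "a < d" "b < d" by (simp_all add: c)
    have "lin_comb d l (\<lambda>j. X j - Z j) x $$ (a, b) = (\<Sum>j=1..l. complex_of_real (x j) * (X j $$ (a, b) - Z j $$ (a, b)))"
      unfolding lin_comb_index[OF XZ ab] by (intro sum.cong refl) (simp only: e[OF _ ab])
    also have "\<dots> = lin_comb d l X x $$ (a, b) - lin_comb d l Z x $$ (a, b)"
      unfolding lin_comb_index[OF assms(1) ab] lin_comb_index[OF assms(2) ab] by (simp add: right_diff_distrib sum_subtractf)
    finally show "(lin_comb d l X x - lin_comb d l Z x) $$ (a, b) = lin_comb d l (\<lambda>j. X j - Z j) x $$ (a, b)"
      using ab c by simp
  qed (simp_all add: c)
qed

lemma expectation_abs_g_le: "j \<ge> 1 \<Longrightarrow> integrable M (\<lambda>\<omega>. \<bar>g j \<omega>\<bar>)" "j \<ge> 1 \<Longrightarrow> expectation (\<lambda>\<omega>. \<bar>g j \<omega>\<bar>) \<le> 1"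
proof -
  assume j: "j \<ge> 1"
  show int: "integrable M (\<lambda>\<omega>. \<bar>g j \<omega>\<bar>)" using g_integrable_power[OF j, of 1] by simp
  have "expectation (\<lambda>\<omega>. \<bar>g j \<omega>\<bar>) \<le> expectation (\<lambda>\<omega>. ((g j \<omega>)\<^sup>2 + 1) / 2)"
  proof (rule integral_mono)
    show "integrable M (\<lambda>\<omega>. ((g j \<omega>)\<^sup>2 + 1) / 2)" using g_integrable_power[OF j, of 2] by simp
    show "\<bar>g j \<omega>\<bar> \<le> ((g j \<omega>)\<^sup>2 + 1) / 2" for \<omega>
      using zero_le_power2[of "\<bar>g j \<omega>\<bar> - 1"] by (simp add: power2_eq_square algebra_simps)
  qed (fact int)
  also have "\<dots> = 1" using g_integrable_power[OF j, of 2] g_expectation_square[OF j] by (simp add: prob_space)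
  finally show "expectation (\<lambda>\<omega>. \<bar>g j \<omega>\<bar>) \<le> 1" .
qed

lemma expectation_weighted_abs_g_le:
  assumes "\<And>j. w j \<ge> 0"
  shows "integrable M (\<lambda>\<omega>. \<Sum>j=1..l. \<bar>g j \<omega>\<bar> * w j)" "expectation (\<lambda>\<omega>. \<Sum>j=1..l. \<bar>g j \<omega>\<bar> * w j) \<le> (\<Sum>j=1..l. w j)"
proof -
  have int: "integrable M (\<lambda>\<omega>. \<bar>g j \<omega>\<bar> * w j)" if "j \<in> {1..l}" for j
    using that expectation_abs_g_le(1) by (intro integrable_mult_left) auto
  thus "integrable M (\<lambda>\<omega>. \<Sum>j=1..l. \<bar>g j \<omega>\<bar> * w j)" by (rule Bochner_Integration.integrable_sum)
  have "expectation (\<lambda>\<omega>. \<Sum>j=1..l. \<bar>g j \<omega>\<bar> * w j) = (\<Sum>j=1..l. expectation (\<lambda>\<omega>. \<bar>g j \<omega>\<bar> * w j))"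
    using int by (rule Bochner_Integration.integral_sum)
  also have "\<dots> \<le> (\<Sum>j=1..l. w j)"
    using expectation_abs_g_le(2) assms by (intro sum_mono) (auto intro!: mult_left_le_one_le)
  finally show "expectation (\<lambda>\<omega>. \<Sum>j=1..l. \<bar>g j \<omega>\<bar> * w j) \<le> (\<Sum>j=1..l. w j)" .
qed

text \<open>Since E |g_j| <= 1, the Lipschitz bound for the absolute value survives the expectation.
  This gives the Lipschitz bound of the fixed point map.\<close>

lemma part_mean_abs_lipschitz:
  assumes X: "\<forall>j\<in>{1..l}. X j \<in> carrier_mat d d" and Z: "\<forall>j\<in>{1..l}. Z j \<in> carrier_mat d d" and ab: "a < d" "b < d"
  shows "\<bar>part q (mean_abs d l X $$ (a, b)) - part q (mean_abs d l Z $$ (a, b))\<bar> \<le> sqrt 2 * (\<Sum>j=1..l. hs_norm (X j - Z j))"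
proof -
  have XZ: "\<forall>j\<in>{1..l}. X j - Z j \<in> carrier_mat d d" using X Z by (auto simp: minus_carrier_mat)
  let ?D = "\<lambda>\<omega>. part q (mat_abs (lin_comb d l X (\<lambda>j. g j \<omega>)) $$ (a, b)) - part q (mat_abs (lin_comb d l Z (\<lambda>j. g j \<omega>)) $$ (a, b))"
  note int = integrable_part_mat_abs[OF X ab, of q] integrable_part_mat_abs[OF Z ab, of q]
  have "part q (mean_abs d l X $$ (a, b)) - part q (mean_abs d l Z $$ (a, b)) = expectation ?D"
    using int by (simp add: part_mean_abs[OF ab])
  hence "\<bar>part q (mean_abs d l X $$ (a, b)) - part q (mean_abs d l Z $$ (a, b))\<bar> \<le> expectation (\<lambda>\<omega>. \<bar>?D \<omega>\<bar>)"
    by (simp only: integral_abs_bound)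
  also have "\<dots> \<le> expectation (\<lambda>\<omega>. sqrt 2 * (\<Sum>j=1..l. \<bar>g j \<omega>\<bar> * hs_norm (X j - Z j)))"
  proof (rule integral_mono)
    show "integrable M (\<lambda>\<omega>. \<bar>?D \<omega>\<bar>)" using int by simp
    show "integrable M (\<lambda>\<omega>. sqrt 2 * (\<Sum>j=1..l. \<bar>g j \<omega>\<bar> * hs_norm (X j - Z j)))"
      by (intro integrable_mult_right expectation_weighted_abs_g_le) auto
    fix \<omega>
    have "\<bar>?D \<omega>\<bar> \<le> sqrt 2 * hs_norm (lin_comb d l X (\<lambda>j. g j \<omega>) - lin_comb d l Z (\<lambda>j. g j \<omega>))"
      by (rule part_mat_abs_lipschitz[OF lin_comb_carrier[OF X] lin_comb_carrier[OF Z] ab])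
    also have "\<dots> \<le> sqrt 2 * (\<Sum>j=1..l. \<bar>g j \<omega>\<bar> * hs_norm (X j - Z j))"
      unfolding lin_comb_diff_family[OF X Z] by (intro mult_left_mono lin_comb_norm_le[OF XZ]) auto
    finally show "\<bar>?D \<omega>\<bar> \<le> sqrt 2 * (\<Sum>j=1..l. \<bar>g j \<omega>\<bar> * hs_norm (X j - Z j))" .
  qed
  also have "\<dots> \<le> sqrt 2 * (\<Sum>j=1..l. hs_norm (X j - Z j))"
    using expectation_weighted_abs_g_le[of "\<lambda>j. hs_norm (X j - Z j)" l] by simp
  finally show ?thesis .
qed

text \<open>Confines the values of the fixed point map to a box.\<close>

lemma abs_part_mean_abs_le:
  assumes X: "\<forall>j\<in>{1..l}. X j \<in> carrier_mat d d" and ab: "a < d" "b < d"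
  shows "\<bar>part q (mean_abs d l X $$ (a, b))\<bar> \<le> (\<Sum>j=1..l. hs_norm (X j))"
proof -
  let ?D = "\<lambda>\<omega>. part q (mat_abs (lin_comb d l X (\<lambda>j. g j \<omega>)) $$ (a, b))"
  note int = integrable_part_mat_abs[OF X ab, of q]
  have "\<bar>part q (mean_abs d l X $$ (a, b))\<bar> \<le> expectation (\<lambda>\<omega>. \<bar>?D \<omega>\<bar>)"
    unfolding part_mean_abs[OF ab] by (rule integral_abs_bound)
  also have "\<dots> \<le> expectation (\<lambda>\<omega>. \<Sum>j=1..l. \<bar>g j \<omega>\<bar> * hs_norm (X j))"
  proof (rule integral_mono)
    show "integrable M (\<lambda>\<omega>. \<bar>?D \<omega>\<bar>)" using int by simp
    show "integrable M (\<lambda>\<omega>. \<Sum>j=1..l. \<bar>g j \<omega>\<bar> * hs_norm (X j))"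
      by (intro expectation_weighted_abs_g_le) auto
    fix \<omega>
    have "\<bar>?D \<omega>\<bar> \<le> hs_norm (mat_abs (lin_comb d l X (\<lambda>j. g j \<omega>)))"
      by (intro order_trans[OF abs_part_le] cmod_index_le_hs_norm[of _ d d] mat_abs_carrier lin_comb_carrier X ab)
    also have "\<dots> \<le> (\<Sum>j=1..l. \<bar>g j \<omega>\<bar> * hs_norm (X j))"
      unfolding hs_norm_mat_abs[OF lin_comb_carrier[OF X]] by (intro lin_comb_norm_le[OF X])
    finally show "\<bar>?D \<omega>\<bar> \<le> (\<Sum>j=1..l. \<bar>g j \<omega>\<bar> * hs_norm (X j))" .
  qed
  also have "\<dots> \<le> (\<Sum>j=1..l. hs_norm (X j))"
    by (intro expectation_weighted_abs_g_le) auto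
  finally show ?thesis .
qed

text \<open>Needed so that the expectation equals its own absolute value, which is what
  \<open>regularize\<close> sees near a fixed point. The quadratic form at \<open>v\<close> is the
  pairing with the rank one matrix v v^*, so it commutes with the expectation.\<close>

lemma mean_abs_psd:
  assumes X: "\<forall>j\<in>{1..l}. X j \<in> carrier_mat d d"
  shows "psd_mat d (mean_abs d l X)"
  unfolding psd_mat_def
proof (intro conjI ballI)
  let ?B = "mean_abs d l X"
  let ?A = "\<lambda>\<omega>. mat_abs (lin_comb d l X (\<lambda>j. g j \<omega>))"
  note dimB = carrier_matD[OF mean_abs_carrier[of d l X]]
  have A: "?A \<omega> \<in> carrier_mat d d" for \<omega> by (intro mat_abs_carrier lin_comb_carrier X)
  show h: "mat_adjoint ?B = ?B"
  proof (rule eq_matI)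
    fix a b assume "a < dim_row ?B" "b < dim_col ?B"
    hence ab: "a < d" "b < d" by (auto simp: dimB)
    have "?A \<omega> $$ (a, b) = cnj (?A \<omega> $$ (b, a))" for \<omega>
      using mat_abs_adjoint[OF lin_comb_carrier[OF X], of "\<lambda>j. g j \<omega>"] ab carrier_matD[OF A[of \<omega>]]
      by (metis conjugate_complex_def mat_adjoint_index)
    hence "Re (?A \<omega> $$ (a, b)) = Re (?A \<omega> $$ (b, a))" "Im (?A \<omega> $$ (a, b)) = - Im (?A \<omega> $$ (b, a))" for \<omega>
      by (metis cnj.sel)+
    thus "mat_adjoint ?B $$ (a, b) = ?B $$ (a, b)" using ab by (simp add: mean_abs_def complex_eq_iff)
  qed (simp_all add: dimB)
  fix v :: "complex vec" assume v: "v \<in> carrier_vec d"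
  define R where "R = mat d d (\<lambda>(a, b). v $ a * cnj (v $ b))"
  have R [simp]: "R \<in> carrier_mat d d" by (simp add: R_def)
  have hsR: "hs_inner R A = Re ((A *\<^sub>v v) \<bullet>c v)" if "A \<in> carrier_mat d d" for A
  proof -
    have "hs_inner R A = (\<Sum>a<d. \<Sum>b<d. Re (A $$ (a, b) * v $ b * cnj (v $ a)))"
      unfolding hs_inner_sum[OF R that] by (intro sum.cong refl arg_cong[where f = Re]) (auto simp: R_def)
    also have "\<dots> = Re ((A *\<^sub>v v) \<bullet>c v)"
      using that v by (simp add: scalar_prod_def lessThan_atLeast0 sum_distrib_right sum_distrib_left del: times_complex.sel)
    finally show ?thesis .
  qed
  have "0 \<le> expectation (\<lambda>\<omega>. hs_inner R (?A \<omega>))"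
  proof (rule integral_nonneg_AE, rule AE_I2)
    fix \<omega>
    have "0 \<le> (?A \<omega> *\<^sub>v v) \<bullet>c v"
      using mat_abs_psd(1)[OF lin_comb_carrier[OF X], of "\<lambda>j. g j \<omega>"] v unfolding psd_mat_def by blast
    thus "0 \<le> hs_inner R (?A \<omega>)" by (simp add: hsR[OF A] less_eq_complex_def)
  qed
  also have "\<dots> = Re ((?B *\<^sub>v v) \<bullet>c v)"
    by (simp add: hs_inner_mean_abs(2)[OF X R] hsR)
  finally have "Re ((?B *\<^sub>v v) \<bullet>c v) \<ge> 0" .
  moreover have "Im ((?B *\<^sub>v v) \<bullet>c v) = 0"
  proof -
    have Bv: "?B *\<^sub>v v \<in> carrier_vec d" by (intro mult_mat_vec_carrier[of _ d d] mean_abs_carrier v)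
    have "(?B *\<^sub>v v) \<bullet>c v = v \<bullet>c (?B *\<^sub>v v)"
      using adjoint_cscalar_prod[OF mean_abs_carrier v v, of l X] h by simp
    also have "\<dots> = cnj ((?B *\<^sub>v v) \<bullet>c v)"
      using Bv v by (simp add: scalar_prod_def cnj_sum mult.commute del: dim_mult_mat_vec)
    finally show ?thesis by (simp add: complex_eq_iff)
  qed
  ultimately show "0 \<le> (?B *\<^sub>v v) \<bullet>c v" by (simp add: less_eq_complex_def)
qed simp

end

lemma lin_comb_sylvester:
  assumes X: "\<forall>j\<in>{1..l}. X j \<in> carrier_mat d d" and Y: "Y \<in> carrier_mat d d" "Y' \<in> carrier_mat d d"
    and C: "\<forall>j\<in>{1..l}. C j = Y * X j + X j * Y'"
  shows "lin_comb d l C x = Y * lin_comb d l X x + lin_comb d l X x * Y'"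
proof -
  have [simp]: "X j \<in> carrier_mat d d" if "j \<in> {1..l}" for j using X that by blast
  note [simp] = Y
  have "Y * lin_comb d l X x + lin_comb d l X x * Y' =
    mat_sum d (\<lambda>j. Y * (complex_of_real (x j) \<cdot>\<^sub>m X j) + (complex_of_real (x j) \<cdot>\<^sub>m X j) * Y') {1..l}"
    unfolding lin_comb_def
    by (subst mat_sum_mult_left, simp, simp, simp, subst mat_sum_mult_right, simp, simp, simp, rule mat_sum_add) simp_all
  also have "\<dots> = mat_sum d (\<lambda>j. complex_of_real (x j) \<cdot>\<^sub>m C j) {1..l}"
  proof (rule mat_sum_cong)
    fix j assume j: "j \<in> {1..l}"
    hence Xj: "X j \<in> carrier_mat d d" by simp
    have "Y * (complex_of_real (x j) \<cdot>\<^sub>m X j) + (complex_of_real (x j) \<cdot>\<^sub>m X j) * Y' = complex_of_real (x j) \<cdot>\<^sub>m (Y * X j + X j * Y')"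
      using add_smult_distrib_left_mat[of "Y * X j" d d "X j * Y'" "complex_of_real (x j)"] Xj
      by (simp add: mult_smult_distrib[of Y d d "X j" d] mult_smult_assoc_mat[of "X j" d d Y' d])
    thus "Y * (complex_of_real (x j) \<cdot>\<^sub>m X j) + (complex_of_real (x j) \<cdot>\<^sub>m X j) * Y' = complex_of_real (x j) \<cdot>\<^sub>m C j"
      using C j by simp
  qed simp_all
  finally show ?thesis by (simp add: lin_comb_def)
qed

lemma hs_inner_one:
  assumes "A \<in> carrier_mat d d"
  shows "hs_inner (1\<^sub>m d) A = Re (mat_trace A)"
  using assms by (simp add: hs_inner_def)

lemma hs_norm_diag_real_const: "\<epsilon> \<ge> 0 \<Longrightarrow> hs_norm (diag_real d (\<lambda>_. \<epsilon>)) \<le> real d * \<epsilon>"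
proof -
  assume e: "\<epsilon> \<ge> 0"
  have "hs_norm (diag_real d (\<lambda>_. \<epsilon>)) \<le> (\<Sum>a<d. \<Sum>b<d. cmod (diag_real d (\<lambda>_. \<epsilon>) $$ (a, b)))"
    by (rule hs_norm_le_sum) simp
  also have "\<dots> = (\<Sum>a<d. \<Sum>b<d. if a = b then \<epsilon> else 0)"
    using e by (intro sum.cong refl) auto
  also have "\<dots> = real d * \<epsilon>" by simp
  finally show ?thesis .
qed

section \<open>Balanced coefficients and the constant sqrt 2\<close>

context gaussian_sequence
begin

lemma L1_S1_norm_gauss_sum:
  assumes C: "\<forall>j\<in>{1..l}. C j \<in> carrier_mat d d"
  shows "integrable M (\<lambda>\<omega>. Re (mat_trace (mat_abs (lin_comb d l C (\<lambda>j. g j \<omega>)))))"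
    "L1_S1_norm M (gauss_sum g d l C) = expectation (\<lambda>\<omega>. Re (mat_trace (mat_abs (lin_comb d l C (\<lambda>j. g j \<omega>)))))"
proof -
  have "Re (mat_trace (mat_abs (lin_comb d l C x))) = hs_inner (1\<^sub>m d) (mat_abs (lin_comb d l C x))" for x
    by (rule hs_inner_one[symmetric]) (intro mat_abs_carrier lin_comb_carrier C)
  thus "integrable M (\<lambda>\<omega>. Re (mat_trace (mat_abs (lin_comb d l C (\<lambda>j. g j \<omega>)))))"
    using hs_inner_mean_abs(1)[OF C one_carrier_mat] by simp
qed (simp add: L1_S1_norm_def gauss_sum_lin_comb)

lemma L1_S1_norm_nonneg:
  assumes "\<forall>j\<in>{1..l}. C j \<in> carrier_mat d d"
  shows "L1_S1_norm M (gauss_sum g d l C) \<ge> 0"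
  unfolding L1_S1_norm_gauss_sum(2)[OF assms]
  by (rule integral_nonneg_AE, rule AE_I2) (rule psd_mat_trace_nonneg[OF mat_abs_psd(1)[OF lin_comb_carrier[OF assms]]])

text \<open>When \<open>Y\<close> and \<open>Y'\<close> are themselves the two expectations, the
  left side is ||Y||^2 + ||Y'||^2.\<close>

lemma L1_S1_norm_sylvester_ge:
  assumes X: "\<forall>j\<in>{1..l}. X j \<in> carrier_mat d d"
    and Y: "Y \<in> carrier_mat d d" "mat_adjoint Y = Y" and Y': "Y' \<in> carrier_mat d d" "mat_adjoint Y' = Y'"
    and C: "\<forall>j\<in>{1..l}. C j = Y * X j + X j * Y'"
  shows "hs_inner Y (mean_abs d l (\<lambda>j. mat_adjoint (X j))) + hs_inner Y' (mean_abs d l X) \<le> L1_S1_norm M (gauss_sum g d l C)"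
proof -
  have X': "\<forall>j\<in>{1..l}. mat_adjoint (X j) \<in> carrier_mat d d" using X by simp
  have Cc: "\<forall>j\<in>{1..l}. C j \<in> carrier_mat d d" using C X Y Y' by simp
  have "hs_inner Y (mean_abs d l (\<lambda>j. mat_adjoint (X j))) + hs_inner Y' (mean_abs d l X) =
    expectation (\<lambda>\<omega>. hs_inner Y (mat_abs (lin_comb d l (\<lambda>j. mat_adjoint (X j)) (\<lambda>j. g j \<omega>))) +
      hs_inner Y' (mat_abs (lin_comb d l X (\<lambda>j. g j \<omega>))))"
    using hs_inner_mean_abs[OF X' Y(1)] hs_inner_mean_abs[OF X Y'(1)] by simp
  also have "\<dots> \<le> expectation (\<lambda>\<omega>. Re (mat_trace (mat_abs (lin_comb d l C (\<lambda>j. g j \<omega>)))))"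
  proof (rule integral_mono)
    show "integrable M (\<lambda>\<omega>. Re (mat_trace (mat_abs (lin_comb d l C (\<lambda>j. g j \<omega>)))))"
      by (rule L1_S1_norm_gauss_sum(1)[OF Cc])
    fix \<omega>
    show "hs_inner Y (mat_abs (lin_comb d l (\<lambda>j. mat_adjoint (X j)) (\<lambda>j. g j \<omega>))) +
      hs_inner Y' (mat_abs (lin_comb d l X (\<lambda>j. g j \<omega>))) \<le> Re (mat_trace (mat_abs (lin_comb d l C (\<lambda>j. g j \<omega>))))"
      unfolding lin_comb_sylvester[OF X Y(1) Y'(1) C] mat_adjoint_lin_comb[OF X, symmetric]
      by (rule trace_mat_abs_sylvester_ge[OF lin_comb_carrier[OF X] Y Y'])
  qed (intro Bochner_Integration.integrable_add hs_inner_mean_abs(1) X X' Y Y')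
  finally show ?thesis by (simp only: L1_S1_norm_gauss_sum(2)[OF Cc])
qed

text \<open>
  The two positive matrices that split the coefficients come from an approximate fixed point of
  \<open>(A, A') \<mapsto> (E |X\<^sup>*|, E |X|)\<close>, where \<open>X\<close> solves \<open>(|A| + \<epsilon>) X + X (|A'| + \<epsilon>) = C\<close>.
\<close>

lemma exists_almost_balanced_sylvester:
  assumes C: "\<forall>j\<in>{1..l}. C j \<in> carrier_mat d d" and e: "e > 0"
  shows "\<exists>X Y Y'. (\<forall>j\<in>{1..l}. X j \<in> carrier_mat d d) \<and>
    Y \<in> carrier_mat d d \<and> mat_adjoint Y = Y \<and> Y' \<in> carrier_mat d d \<and> mat_adjoint Y' = Y' \<and>
    (\<forall>j\<in>{1..l}. C j = Y * X j + X j * Y') \<and>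
    hs_norm (Y - mean_abs d l (\<lambda>j. mat_adjoint (X j))) \<le> e \<and> hs_norm (Y' - mean_abs d l X) \<le> e"
proof -
  \<comment> \<open>The shift has norm at most d epsilon, hence at most e / 2; the other half is
    reserved for the fixed point error.\<close>
  define \<epsilon> where "\<epsilon> = e / (2 * (real d + 1))"
  have \<epsilon>: "\<epsilon> > 0" using e by (simp add: \<epsilon>_def)
  \<comment> \<open>Real coordinates of a pair of matrices: the first Boolean selects the left
    (\<open>True\<close>) or the right coefficient, the second the real or the imaginary
    part.\<close>
  define I where "I = (UNIV :: bool set) \<times> (UNIV :: bool set) \<times> {..<d} \<times> {..<d}"
  have finI: "finite I" by (simp add: I_def)
  define mtx where "mtx x p = mat d d (\<lambda>(a, b). Complex (x (p, True, a, b)) (x (p, False, a, b)))"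
    for x :: "bool \<times> bool \<times> nat \<times> nat \<Rightarrow> real" and p
  have mtx [simp]: "mtx x p \<in> carrier_mat d d" for x p by (simp add: mtx_def)
  have mtx_part: "part q (mtx x p $$ (a, b)) = x (p, q, a, b)" if "a < d" "b < d" for x p q a b
    using that by (simp add: mtx_def part_def)
  have norm_part: "hs_norm (A - B) \<le> real d * real d * (2 * \<delta>)"
    if "A \<in> carrier_mat d d" "B \<in> carrier_mat d d" and
      \<delta>: "\<And>q a b. a < d \<Longrightarrow> b < d \<Longrightarrow> \<bar>part q (A $$ (a, b)) - part q (B $$ (a, b))\<bar> \<le> \<delta>" for A B \<delta>
  proof -
    have "hs_norm (A - B) \<le> (\<Sum>a<d. \<Sum>b<d. cmod ((A - B) $$ (a, b)))"
      using that by (intro hs_norm_le_sum minus_carrier_mat)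
    also have "\<dots> \<le> (\<Sum>a<d. \<Sum>b<d. 2 * \<delta>)"
    proof (intro sum_mono)
      fix a b assume "a \<in> {..<d}" "b \<in> {..<d}"
      hence ab: "a < d" "b < d" by auto
      have "cmod ((A - B) $$ (a, b)) \<le> \<bar>Re ((A - B) $$ (a, b))\<bar> + \<bar>Im ((A - B) $$ (a, b))\<bar>" by (rule cmod_le)
      thus "cmod ((A - B) $$ (a, b)) \<le> 2 * \<delta>"
        using \<delta>[OF ab, of True] \<delta>[OF ab, of False] that(1,2) ab by (simp add: part_def)
    qed
    finally show ?thesis by simp
  qed
  define X where "X x j = sylvester d (regularize d \<epsilon> (mtx x True)) (regularize d \<epsilon> (mtx x False)) (C j)" for x j
  have X: "X x j \<in> carrier_mat d d" and XC: "regularize d \<epsilon> (mtx x True) * X x j + X x j * regularize d \<epsilon> (mtx x False) = C j"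
    and Xn: "hs_norm (X x j) \<le> hs_norm (C j) / (2 * \<epsilon>)" if "j \<in> {1..l}" for x j
  proof -
    have Cj: "C j \<in> carrier_mat d d" using C that by blast
    show 1: "X x j \<in> carrier_mat d d" and 2: "regularize d \<epsilon> (mtx x True) * X x j + X x j * regularize d \<epsilon> (mtx x False) = C j"
      unfolding X_def using sylvester[OF mtx mtx Cj \<epsilon>] by auto
    show "hs_norm (X x j) \<le> hs_norm (C j) / (2 * \<epsilon>)"
      by (rule sylvester_norm_le[OF mtx mtx 1 \<epsilon> 2])
  qed
  have Xc: "\<forall>j\<in>{1..l}. X x j \<in> carrier_mat d d" and X'c: "\<forall>j\<in>{1..l}. mat_adjoint (X x j) \<in> carrier_mat d d" for x
    using X by auto
  define B where "B x p = (if p then mean_abs d l (\<lambda>j. mat_adjoint (X x j)) else mean_abs d l (X x))" for x p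
  have B [simp]: "B x p \<in> carrier_mat d d" for x p by (simp add: B_def)
  have Bpsd: "psd_mat d (B x p)" for x p
    using mean_abs_psd[OF Xc] mean_abs_psd[OF X'c] by (simp add: B_def)
  define f where "f x = (\<lambda>(p, q, a, b). part q (B x p $$ (a, b)))" for x
  \<comment> \<open>The norm bound for the Sylvester equation confines all values; the summand 1
    guarantees a positive radius even if all \<open>C j\<close> vanish.\<close>
  define R where "R = (\<Sum>j=1..l. hs_norm (C j) / (2 * \<epsilon>)) + 1"
  have R: "R > 0" unfolding R_def using \<epsilon> by (intro add_nonneg_pos sum_nonneg) auto
  \<comment> \<open>Each of the two coefficient matrices moves by at most 2 d^2 delta when its
    coordinates move by delta, whence 4 d^2.\<close>
  define L where "L = sqrt 2 * (\<Sum>j=1..l. hs_norm (C j) / (2 * \<epsilon>)\<^sup>2 * sqrt 2 * (4 * real d * real d))"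
  have lip: "\<forall>i\<in>I. \<bar>f x i - f y i\<bar> \<le> L * \<delta>" if d: "\<And>i. i \<in> I \<Longrightarrow> \<bar>x i - y i\<bar> \<le> \<delta>" for x y \<delta>
  proof
    fix i assume "i \<in> I"
    then obtain p q a b where i: "i = (p, q, a, b)" and ab: "a < d" "b < d" by (cases i) (auto simp: I_def)
    have Xd: "hs_norm (X x j - X y j) \<le> hs_norm (C j) / (2 * \<epsilon>)\<^sup>2 * sqrt 2 * (4 * real d * real d) * \<delta>" if j: "j \<in> {1..l}" for j
    proof -
      have Cj: "C j \<in> carrier_mat d d" using C j by blast
      have m: "hs_norm (mtx x p - mtx y p) \<le> real d * real d * (2 * \<delta>)" for p
        by (rule norm_part) (auto simp: mtx_part I_def intro!: d)
      have "hs_norm (X x j - X y j) \<le> hs_norm (C j) / (2 * \<epsilon>)\<^sup>2 * sqrt 2 * (hs_norm (mtx x True - mtx y True) + hs_norm (mtx x False - mtx y False))"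
        unfolding X_def by (rule sylvester_lipschitz[OF mtx mtx mtx mtx Cj \<epsilon>])
      also have "\<dots> \<le> hs_norm (C j) / (2 * \<epsilon>)\<^sup>2 * sqrt 2 * (real d * real d * (2 * \<delta>) + real d * real d * (2 * \<delta>))"
        by (intro mult_left_mono add_mono m) auto
      finally show ?thesis by (simp add: algebra_simps)
    qed
    have Xd': "hs_norm (mat_adjoint (X x j) - mat_adjoint (X y j)) = hs_norm (X x j - X y j)" if "j \<in> {1..l}" for j
      using mat_adjoint_minus[OF X[OF that] X[OF that], of x y] hs_norm_adjoint[of "X x j - X y j"] by simp
    have "\<bar>part q (B x p $$ (a, b)) - part q (B y p $$ (a, b))\<bar> \<le> sqrt 2 * (\<Sum>j=1..l. hs_norm (X x j - X y j))"
    proof (cases p)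
      case True
      have "(\<Sum>j=1..l. hs_norm (mat_adjoint (X x j) - mat_adjoint (X y j))) = (\<Sum>j=1..l. hs_norm (X x j - X y j))"
        by (intro sum.cong refl Xd')
      thus ?thesis using True part_mean_abs_lipschitz[OF X'c X'c ab, of q x y] by (simp add: B_def)
    next
      case False
      thus ?thesis using part_mean_abs_lipschitz[OF Xc Xc ab, of q x y] by (simp add: B_def)
    qed
    also have "\<dots> \<le> sqrt 2 * (\<Sum>j=1..l. hs_norm (C j) / (2 * \<epsilon>)\<^sup>2 * sqrt 2 * (4 * real d * real d) * \<delta>)"
      by (intro mult_left_mono sum_mono Xd) auto
    also have "\<dots> = L * \<delta>" by (simp only: L_def sum_distrib_right mult.assoc)
    finally show "\<bar>f x i - f y i\<bar> \<le> L * \<delta>" by (simp add: f_def i)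
  qed
  have maps: "\<bar>f x i\<bar> \<le> R" if "i \<in> I" for x i
  proof -
    obtain p q a b where i: "i = (p, q, a, b)" and ab: "a < d" "b < d" using \<open>i \<in> I\<close> by (cases i) (auto simp: I_def)
    have "\<bar>part q (B x p $$ (a, b))\<bar> \<le> (\<Sum>j=1..l. hs_norm (X x j))"
      using abs_part_mean_abs_le[OF Xc ab, of q x] abs_part_mean_abs_le[OF X'c ab, of q x] by (simp add: B_def)
    also have "\<dots> \<le> (\<Sum>j=1..l. hs_norm (C j) / (2 * \<epsilon>))" by (intro sum_mono Xn)
    also have "\<dots> \<le> R" by (simp add: R_def)
    finally show ?thesis by (simp add: f_def i)
  qed
  \<comment> \<open>Chosen so that twice 2 d^2 eta is at most e / 2; the outer 2 bounds the factor
    sqrt 2 of \<open>mat_abs_lipschitz\<close>.\<close>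
  define \<eta> where "\<eta> = e / (8 * (real d * real d + 1))"
  have \<eta>: "\<eta> > 0" using e by (simp add: \<eta>_def add_nonneg_pos)
  obtain x where x: "\<forall>i\<in>I. \<bar>f x i - x i\<bar> \<le> \<eta>"
    using approximate_fixed_point_box[of I R f L \<eta>, OF finI R lip maps \<eta>] by blast
  have near: "hs_norm (regularize d \<epsilon> (mtx x p) - B x p) \<le> e" for p
  proof -
    have c: "mat_abs (mtx x p) - B x p \<in> carrier_mat d d" by (intro minus_carrier_mat B)
    have "hs_norm (mtx x p - B x p) \<le> real d * real d * (2 * \<eta>)"
    proof (rule norm_part)
      fix q a b assume ab: "a < d" "b < d"
      hence "(p, q, a, b) \<in> I" by (simp add: I_def)
      thus "\<bar>part q (mtx x p $$ (a, b)) - part q (B x p $$ (a, b))\<bar> \<le> \<eta>"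
        using x by (force simp: f_def mtx_part[OF ab] abs_minus_commute)
    qed auto
    \<comment> \<open>\<open>B x p\<close> is positive and so equals its absolute value; closeness
      of \<open>mtx x p\<close> to it therefore carries over to the absolute value of
      \<open>mtx x p\<close>.\<close>
    moreover have "hs_norm (mat_abs (mtx x p) - B x p) \<le> sqrt 2 * hs_norm (mtx x p - B x p)"
      using mat_abs_lipschitz[OF mtx B, of x p x p] by (simp add: mat_abs_of_psd[OF Bpsd])
    moreover have "sqrt 2 * hs_norm (mtx x p - B x p) \<le> 2 * hs_norm (mtx x p - B x p)"
      by (intro mult_right_mono real_le_lsqrt) auto
    ultimately have "hs_norm (mat_abs (mtx x p) - B x p) \<le> 2 * (real d * real d * (2 * \<eta>))"
      by linarith
    also have "\<dots> \<le> e / 2"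
    proof -
      have p: "real d * real d + 1 > 0" by (intro add_nonneg_pos) auto
      hence "real d * real d / (real d * real d + 1) \<le> 1" by (simp add: divide_le_eq)
      hence "e / 2 * (real d * real d / (real d * real d + 1)) \<le> e / 2 * 1" using e by (intro mult_left_mono) auto
      moreover have "2 * (real d * real d * (2 * \<eta>)) = e / 2 * (real d * real d / (real d * real d + 1))"
        using p by (simp add: \<eta>_def field_simps)
      ultimately show ?thesis by simp
    qed
    finally have 1: "hs_norm (mat_abs (mtx x p) - B x p) \<le> e / 2" .
    have "hs_norm (diag_real d (\<lambda>_. \<epsilon>)) \<le> real d * \<epsilon>" using \<epsilon> by (intro hs_norm_diag_real_const) simp
    also have "\<dots> \<le> e / 2"
    proof -
      have p: "real d + 1 > 0" by (intro add_nonneg_pos) auto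
      hence "real d / (real d + 1) \<le> 1" by (simp add: divide_le_eq)
      hence "e / 2 * (real d / (real d + 1)) \<le> e / 2 * 1" using e by (intro mult_left_mono) auto
      moreover have "real d * \<epsilon> = e / 2 * (real d / (real d + 1))"
        using p by (simp add: \<epsilon>_def field_simps)
      ultimately show ?thesis by simp
    qed
    finally have 2: "hs_norm (diag_real d (\<lambda>_. \<epsilon>)) \<le> e / 2" .
    have "regularize d \<epsilon> (mtx x p) - B x p = (mat_abs (mtx x p) - B x p) + diag_real d (\<lambda>_. \<epsilon>)"
      using carrier_matD[OF mat_abs_carrier[OF mtx]] carrier_matD[OF B]
      by (intro eq_matI) (auto simp: regularize_def)
    thus ?thesis using hs_norm_triangle[OF c diag_real_carrier, of "\<lambda>_. \<epsilon>"] 1 2 by simp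
  qed
  show ?thesis
  proof (intro exI conjI)
    show "\<forall>j\<in>{1..l}. X x j \<in> carrier_mat d d" by (rule Xc)
    show "regularize d \<epsilon> (mtx x True) \<in> carrier_mat d d" "regularize d \<epsilon> (mtx x False) \<in> carrier_mat d d" by simp_all
    show "mat_adjoint (regularize d \<epsilon> (mtx x True)) = regularize d \<epsilon> (mtx x True)"
      "mat_adjoint (regularize d \<epsilon> (mtx x False)) = regularize d \<epsilon> (mtx x False)"
      by (rule regularize_adjoint[OF mtx])+
    show "\<forall>j\<in>{1..l}. C j = regularize d \<epsilon> (mtx x True) * X x j + X x j * regularize d \<epsilon> (mtx x False)"
      by (intro ballI XC[symmetric])
    show "hs_norm (regularize d \<epsilon> (mtx x True) - mean_abs d l (\<lambda>j. mat_adjoint (X x j))) \<le> e"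
      using near[of True] by (simp add: B_def)
    show "hs_norm (regularize d \<epsilon> (mtx x False) - mean_abs d l (X x)) \<le> e"
      using near[of False] by (simp add: B_def)
  qed
qed

text \<open>All estimates carry the balancing error \<open>e\<close>, which is removed only at the
  end.\<close>

theorem S1_l2_norm_le_L1_S1_norm:
  assumes C: "\<forall>j\<in>{1..l}. C j \<in> carrier_mat d d"
  shows "S1_l2_norm d {1..l} C \<le> sqrt 2 * L1_S1_norm M (gauss_sum g d l C)"
proof -
  define N where "N = L1_S1_norm M (gauss_sum g d l C)"
  have N: "N \<ge> 0" unfolding N_def by (rule L1_S1_norm_nonneg[OF C])
  have main: "S1_l2_norm d {1..l} C \<le> sqrt 2 * N + 4 * e * (N + 2)" if e: "0 < e" "e \<le> 1" for e
  proof -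
    obtain X Y Y' where X: "\<forall>j\<in>{1..l}. X j \<in> carrier_mat d d"
      and Y: "Y \<in> carrier_mat d d" "mat_adjoint Y = Y" and Y': "Y' \<in> carrier_mat d d" "mat_adjoint Y' = Y'"
      and XC: "\<forall>j\<in>{1..l}. C j = Y * X j + X j * Y'"
      and n1: "hs_norm (Y - mean_abs d l (\<lambda>j. mat_adjoint (X j))) \<le> e" and n2: "hs_norm (Y' - mean_abs d l X) \<le> e"
      using exists_almost_balanced_sylvester[OF C e(1)] by blast
    define B where "B = mean_abs d l (\<lambda>j. mat_adjoint (X j))"
    define B' where "B' = mean_abs d l X"
    have [simp]: "B \<in> carrier_mat d d" "B' \<in> carrier_mat d d" by (auto simp: B_def B'_def)
    define s where "s = sqrt (hs_inner B' B' + hs_inner B B)"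
    have s2: "s\<^sup>2 = hs_inner B' B' + hs_inner B B" and s0: "s \<ge> 0"
      unfolding s_def by (simp_all add: hs_inner_nonneg)
    have V: "(\<Sum>j=1..l. hs_inner (X j) (X j)) \<le> s\<^sup>2"
      using second_moment_le_mean_abs[OF X] by (simp add: s2 B_def B'_def)
    have bb: "hs_norm B + hs_norm B' \<le> sqrt 2 * s"
    proof -
      have "(hs_norm B + hs_norm B')\<^sup>2 \<le> 2 * ((hs_norm B)\<^sup>2 + (hs_norm B')\<^sup>2)"
        using zero_le_power2[of "hs_norm B - hs_norm B'"] by (simp add: power2_eq_square algebra_simps)
      also have "\<dots> = 2 * s\<^sup>2" unfolding hs_norm_square s2 by (simp only: add.commute)
      also have "\<dots> = (sqrt 2 * s)\<^sup>2" by (simp only: power_mult_distrib real_sqrt_pow2_iff) simp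
      finally show ?thesis by (rule power2_le_imp_le) (use s0 in simp)
    qed
    have near: "hs_norm D \<le> hs_norm A + e" "hs_inner A A - e * hs_norm A \<le> hs_inner D A"
      if "A \<in> carrier_mat d d" "D \<in> carrier_mat d d" "hs_norm (D - A) \<le> e" for A D
    proof -
      have DA: "D - A \<in> carrier_mat d d" using that by (simp add: minus_carrier_mat)
      have D: "D = A + (D - A)" using that(1,2) by (intro eq_matI) auto
      show "hs_norm D \<le> hs_norm A + e" using hs_norm_triangle[OF that(1) DA] that(3) D by simp
      have "(-1) \<cdot>\<^sub>m (D - A) = A - D" using that(1,2) by (intro eq_matI) auto
      hence "hs_norm (A - D) = hs_norm (D - A)" using hs_norm_smult[of "-1" "D - A"] by simp
      moreover have "hs_inner (A - D) A \<le> hs_norm (A - D) * hs_norm A"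
        using that by (intro hs_inner_le[of _ d d]) (auto simp: minus_carrier_mat)
      moreover have "hs_norm (D - A) * hs_norm A \<le> e * hs_norm A" using that(3) by (intro mult_right_mono) auto
      ultimately show "hs_inner A A - e * hs_norm A \<le> hs_inner D A"
        using that by (simp add: hs_inner_minus_left[of _ d d])
    qed
    have "s\<^sup>2 - e * (hs_norm B + hs_norm B') \<le> hs_inner Y B + hs_inner Y' B'"
      using near(2)[of B Y] near(2)[of B' Y'] n1 n2 Y Y' unfolding s2 by (simp add: B_def B'_def algebra_simps)
    also have "\<dots> \<le> N"
      unfolding N_def B_def B'_def by (rule L1_S1_norm_sylvester_ge[OF X Y Y' XC])
    finally have "s\<^sup>2 \<le> N + e * (hs_norm B + hs_norm B')" by simp
    also have "\<dots> \<le> N + e * (sqrt 2 * s)" using bb e by (intro add_left_mono mult_left_mono) auto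
    finally have sN: "s\<^sup>2 \<le> N + e * (sqrt 2 * s)" .
    have r2: "sqrt 2 \<le> 3 / 2" by (rule real_le_lsqrt) (auto simp: power2_eq_square)
    \<comment> \<open>A crude bound on \<open>s\<close> that does not depend on \<open>e\<close>, so
      that the error terms \<open>e * s\<close> vanish with \<open>e\<close>. If it failed, s (s -
      3/2) would be at least (N + 2) (N + 1/2) > N, against \<open>sN\<close>.\<close>
    have sle: "s \<le> N + 2"
    proof (rule ccontr)
      assume "\<not> s \<le> N + 2"
      hence a: "s > N + 2" by simp
      have "e * (sqrt 2 * s) \<le> 1 * (3 / 2 * s)" using e r2 s0 by (intro mult_mono) auto
      hence "s * (s - 3 / 2) \<le> N" using sN by (simp add: power2_eq_square algebra_simps)
      moreover have "(N + 2) * (1 / 2) \<le> s * (s - 3 / 2)" using a N by (intro mult_mono) auto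
      moreover have "(N + 2) * (N + 1 / 2) \<le> s * (s - 3 / 2)" using a N by (intro mult_mono) auto
      moreover have "(N + 2) * (N + 1 / 2) = N * N + 5 / 2 * N + 1" by (simp add: field_simps)
      moreover have "N * N \<ge> 0" by simp
      ultimately show False using N by linarith
    qed
    have "S1_l2_norm d {1..l} C \<le> sqrt (\<Sum>j=1..l. hs_inner (X j) (X j)) * (hs_norm Y + hs_norm Y')"
      by (intro S1_l2_norm_le_sylvester X Y Y' XC) simp
    also have "\<dots> \<le> s * (sqrt 2 * s + 2 * e)"
    proof (rule mult_mono)
      show "sqrt (\<Sum>j=1..l. hs_inner (X j) (X j)) \<le> s" using V s0 by (intro real_le_lsqrt) (auto intro: sum_nonneg hs_inner_nonneg)
      show "hs_norm Y + hs_norm Y' \<le> sqrt 2 * s + 2 * e"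
        using near(1)[of B Y] near(1)[of B' Y'] n1 n2 Y Y' bb by (simp add: B_def B'_def)
    qed (use s0 in auto)
    also have "\<dots> = sqrt 2 * s\<^sup>2 + 2 * e * s" by (simp add: power2_eq_square algebra_simps)
    also have "\<dots> \<le> sqrt 2 * (N + e * (sqrt 2 * s)) + 2 * e * s" using sN by (intro add_right_mono mult_left_mono) auto
    also have "\<dots> = sqrt 2 * N + 4 * e * s" by (simp add: algebra_simps)
    also have "\<dots> \<le> sqrt 2 * N + 4 * e * (N + 2)" using sle e by (intro add_left_mono mult_left_mono) auto
    finally show ?thesis .
  qed
  have "S1_l2_norm d {1..l} C \<le> sqrt 2 * N"
  proof (rule field_le_epsilon)
    fix r :: real assume r: "r > 0"
    define e where "e = min 1 (r / (4 * (N + 2)))"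
    have e: "0 < e" "e \<le> 1" "e \<le> r / (4 * (N + 2))" using r N by (auto simp: e_def)
    hence "4 * e * (N + 2) \<le> r" using N by (simp add: field_simps)
    thus "S1_l2_norm d {1..l} C \<le> sqrt 2 * N + r" using main[OF e(1,2)] by linarith
  qed
  thus ?thesis by (simp add: N_def)
qed

end

section \<open>The lower bound\<close>

text \<open>Cutting out a column by a diagonal projection keeps a Gaussian combination one, so the
  moment bound for Hilbert-Schmidt norms applies to single columns.\<close>

lemma col_norm_eq_hs_norm:
  assumes "A \<in> carrier_mat d d" "i < d"
  shows "col_norm A i = hs_norm (A * diag_real d (\<lambda>k. if k = i then 1 else 0))"
proof -
  have "hs_inner (A * diag_real d (\<lambda>k. if k = i then 1 else 0)) (A * diag_real d (\<lambda>k. if k = i then 1 else 0)) =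
    (\<Sum>a<d. \<Sum>b<d. (cmod ((A * diag_real d (\<lambda>k. if k = i then 1 else 0)) $$ (a, b)))\<^sup>2)"
    using assms by (intro hs_inner_self) simp
  also have "\<dots> = (\<Sum>a<d. \<Sum>b<d. if b = i then (cmod (A $$ (a, i)))\<^sup>2 else 0)"
    by (intro sum.cong refl) (simp add: index_mult_diag_real[OF assms(1)] norm_mult del: index_mult_mat(1))
  also have "\<dots> = (\<Sum>a<d. (cmod (A $$ (a, i)))\<^sup>2)" using assms(2) by simp
  finally show ?thesis
    using carrier_matD[OF assms(1)] by (simp add: hs_norm_def col_norm_def L2_set_def)
qed

lemma gram_mult_right:
  fixes A U :: "complex mat"
  assumes "A \<in> carrier_mat d d" "U \<in> carrier_mat d d"
  shows "mat_adjoint (A * U) * (A * U) = mat_adjoint U * (mat_adjoint A * A) * U"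
  using assms by (simp add: mat_adjoint_mult[OF assms] assoc_mult_mat[of _ d d _ d _ d])

text \<open>In an eigenbasis of the sum of squares the eigenvalue q_i is the sum over k of ||X_k
  u_i||^2, so the trace of the root is a sum of square functions of columns. Both the Gaussian
  estimate and the dual estimate start from this form.\<close>

lemma gram_sum_diagonalization:
  assumes I: "finite I" and X: "\<And>k. k \<in> I \<Longrightarrow> X k \<in> carrier_mat d d"
  obtains U q where "unitary_mat d U"
    "Re (mat_trace (psd_sqrt (mat_sum d (\<lambda>k. mat_adjoint (X k) * X k) I))) = (\<Sum>i<d. sqrt (q i))"
    "\<And>i. i < d \<Longrightarrow> (\<Sum>k\<in>I. (col_norm (X k * U) i)\<^sup>2) = q i"
proof -
  define Q where "Q = mat_sum d (\<lambda>k. mat_adjoint (X k) * X k) I"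
  have "psd_mat d Q" unfolding Q_def using X by (intro psd_mat_mat_sum I psd_mat_gram[of _ d])
  then obtain U q where U: "unitary_mat d U" and q: "\<And>i. q i \<ge> 0" and Q: "Q = U * diag_real d q * mat_adjoint U"
    using psd_mat_diagonalization by blast
  note [simp] = unitary_matD(1,2)[OF U] X
  have 1: "Re (mat_trace (psd_sqrt Q)) = (\<Sum>i<d. sqrt (q i))"
    unfolding Q using U q by (subst psd_sqrt_conj_diag) (auto simp: mat_trace_conj mat_trace_diag_real)
  have 2: "(\<Sum>k\<in>I. (col_norm (X k * U) i)\<^sup>2) = q i" if i: "i < d" for i
  proof -
    have "diag_real d q = mat_adjoint U * Q * U"
      unfolding Q using unitary_mult_cancel(1)[OF U, of "diag_real d q * mat_adjoint U * U" d]
        unitary_mult_cancel_right(2)[OF U, of "diag_real d q" d]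
      by (simp add: assoc_mult_mat[of _ d d _ d _ d])
    also have "\<dots> = mat_sum d (\<lambda>k. mat_adjoint U * (mat_adjoint (X k) * X k) * U) I"
      unfolding Q_def using I by (subst mat_sum_mult_left, simp_all, subst mat_sum_mult_right) auto
    also have "\<dots> = mat_sum d (\<lambda>k. mat_adjoint (X k * U) * (X k * U)) I"
      by (intro mat_sum_cong I gram_mult_right[of _ d, symmetric] X unitary_matD(1)[OF U]) simp_all
    finally have "diag_real d q $$ (i, i) = (\<Sum>k\<in>I. (mat_adjoint (X k * U) * (X k * U)) $$ (i, i))"
      using i I by (simp add: mat_sum_index del: index_mult_mat(1))
    hence "q i = (\<Sum>k\<in>I. Re ((mat_adjoint (X k * U) * (X k * U)) $$ (i, i)))"
      unfolding Re_sum[symmetric] diag_real_index[OF i i] by (metis Re_complex_of_real)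
    also have "\<dots> = (\<Sum>k\<in>I. (col_norm (X k * U) i)\<^sup>2)"
      by (intro sum.cong refl col_norm_square[symmetric, OF mult_carrier_square i] X unitary_matD(1)[OF U])
    finally show ?thesis by (rule sym)
  qed
  show thesis using that[OF U] 1 2 unfolding Q_def by blast
qed

text \<open>Column part of the duality. In the eigenbasis, Cauchy-Schwarz over entries and over k
  bounds the pairing by sqrt (q_i) times the root of the sum over k of ||B_k u_i||^2, which is at
  most 1 because the Gram sum of \<open>B\<close> is at most the identity. Diagonal Gram sums are
  enough for creation operators.\<close>

lemma trace_sqrt_gram_ge:
  assumes I: "finite I" and X: "\<And>k. k \<in> I \<Longrightarrow> X k \<in> carrier_mat d d" and B: "\<And>k. k \<in> I \<Longrightarrow> B k \<in> carrier_mat d d"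
    and BB: "mat_sum d (\<lambda>k. mat_adjoint (B k) * B k) I = diag_real d f" and f: "\<And>i. i < d \<Longrightarrow> f i \<le> 1"
  shows "(\<Sum>k\<in>I. hs_inner (B k) (X k)) \<le> Re (mat_trace (psd_sqrt (mat_sum d (\<lambda>k. mat_adjoint (X k) * X k) I)))"
proof -
  obtain U q where U: "unitary_mat d U"
    and q: "Re (mat_trace (psd_sqrt (mat_sum d (\<lambda>k. mat_adjoint (X k) * X k) I))) = (\<Sum>i<d. sqrt (q i))"
    and Xq: "\<And>i. i < d \<Longrightarrow> (\<Sum>k\<in>I. (col_norm (X k * U) i)\<^sup>2) = q i"
    using gram_sum_diagonalization[of I X d, OF I X] by blast
  note [simp] = unitary_matD(1,2)[OF U] X B
  have BU: "(\<Sum>k\<in>I. (col_norm (B k * U) i)\<^sup>2) \<le> 1" if i: "i < d" for i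
  proof -
    have "mat_adjoint U * diag_real d f * U = mat_sum d (\<lambda>k. mat_adjoint U * (mat_adjoint (B k) * B k) * U) I"
      unfolding BB[symmetric] using I by (subst mat_sum_mult_left, simp_all, subst mat_sum_mult_right) auto
    also have "\<dots> = mat_sum d (\<lambda>k. mat_adjoint (B k * U) * (B k * U)) I"
      by (intro mat_sum_cong I gram_mult_right[of _ d, symmetric] B unitary_matD(1)[OF U]) simp_all
    finally have "(mat_adjoint U * diag_real d f * U) $$ (i, i) = (\<Sum>k\<in>I. (mat_adjoint (B k * U) * (B k * U)) $$ (i, i))"
      using i I by (simp add: mat_sum_index del: index_mult_mat(1))
    hence "(\<Sum>k\<in>I. (col_norm (B k * U) i)\<^sup>2) = Re ((mat_adjoint U * diag_real d f * U) $$ (i, i))"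
      using i by (simp add: col_norm_square[of _ d d] del: index_mult_mat(1))
    also have "(mat_adjoint U * diag_real d f * U) $$ (i, i) = (\<Sum>a<d. mat_adjoint U $$ (i, a) * (diag_real d f * U) $$ (a, i))"
      using i by (simp add: assoc_mult_mat[of _ d d _ d _ d] index_mult_mat_sum[of "mat_adjoint U" d d _ d] del: index_mult_mat(1))
    also have "\<dots> = (\<Sum>a<d. complex_of_real (f a * (cmod (U $$ (a, i)))\<^sup>2))"
    proof (intro sum.cong refl)
      fix a assume "a \<in> {..<d}"
      hence a: "a < d" by simp
      have "mat_adjoint U $$ (i, a) = cnj (U $$ (a, i))" using a i carrier_matD[OF unitary_matD(1)[OF U]] by simp
      thus "mat_adjoint U $$ (i, a) * (diag_real d f * U) $$ (a, i) = complex_of_real (f a * (cmod (U $$ (a, i)))\<^sup>2)"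
        using a i complex_norm_square[of "U $$ (a, i)"]
        by (simp add: index_diag_real_mult[of U d d] mult_ac del: index_mult_mat(1))
    qed
    also have "Re \<dots> = (\<Sum>a<d. f a * (cmod (U $$ (a, i)))\<^sup>2)" by simp
    also have "\<dots> \<le> (\<Sum>a<d. 1 * (cmod (U $$ (a, i)))\<^sup>2)" using f by (intro sum_mono mult_right_mono) auto
    also have "\<dots> = (col_norm U i)\<^sup>2" using carrier_matD[OF unitary_matD(1)[OF U]] by (simp add: col_norm_def L2_set_def sum_nonneg)
    also have "\<dots> = 1" using i unitary_matD(3)[OF U] by (simp add: col_norm_square[of U d d])
    finally show ?thesis .
  qed
  have hs: "hs_inner (B k) (X k) \<le> (\<Sum>i<d. col_norm (B k * U) i * col_norm (X k * U) i)" if k: "k \<in> I" for k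
  proof -
    have "hs_inner (B k * U) (X k * U) = hs_inner (B k) (X k * U * mat_adjoint U)"
      using k by (subst hs_inner_mult_right[of _ d]) auto
    hence "hs_inner (B k) (X k) = hs_inner (B k * U) (X k * U)"
      using unitary_mult_cancel_right(1)[OF U X[OF k]] by simp
    also have "\<dots> = (\<Sum>a<d. \<Sum>i<d. Re (cnj ((B k * U) $$ (a, i)) * (X k * U) $$ (a, i)))"
      by (rule hs_inner_sum[OF mult_carrier_square[OF B[OF k] unitary_matD(1)[OF U]] mult_carrier_square[OF X[OF k] unitary_matD(1)[OF U]]])
    also have "\<dots> = (\<Sum>i<d. \<Sum>a<d. Re (cnj ((B k * U) $$ (a, i)) * (X k * U) $$ (a, i)))"
      by (rule sum.swap)
    also have "\<dots> \<le> (\<Sum>i<d. col_norm (B k * U) i * col_norm (X k * U) i)"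
    proof (intro sum_mono)
      fix i
      have dims: "dim_row (B k * U) = d" "dim_row (X k * U) = d" using carrier_matD[OF B[OF k]] carrier_matD[OF X[OF k]] by simp_all
      have "(\<Sum>a<d. Re (cnj ((B k * U) $$ (a, i)) * (X k * U) $$ (a, i))) \<le>
        (\<Sum>a<d. \<bar>cmod ((B k * U) $$ (a, i))\<bar> * \<bar>cmod ((X k * U) $$ (a, i))\<bar>)"
        by (intro sum_mono order_trans[OF complex_Re_le_cmod]) (simp add: norm_mult del: index_mult_mat(1))
      also have "\<dots> \<le> col_norm (B k * U) i * col_norm (X k * U) i"
        unfolding col_norm_def dims by (rule L2_set_mult_ineq)
      finally show "(\<Sum>a<d. Re (cnj ((B k * U) $$ (a, i)) * (X k * U) $$ (a, i))) \<le> col_norm (B k * U) i * col_norm (X k * U) i" .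
    qed
    finally show ?thesis .
  qed
  have "(\<Sum>k\<in>I. hs_inner (B k) (X k)) \<le> (\<Sum>k\<in>I. \<Sum>i<d. col_norm (B k * U) i * col_norm (X k * U) i)"
    by (intro sum_mono hs)
  also have "\<dots> = (\<Sum>i<d. \<Sum>k\<in>I. col_norm (B k * U) i * col_norm (X k * U) i)" by (rule sum.swap)
  also have "\<dots> \<le> (\<Sum>i<d. sqrt (q i))"
  proof (intro sum_mono)
    fix i assume "i \<in> {..<d}"
    hence i: "i < d" by simp
    have "(\<Sum>k\<in>I. col_norm (B k * U) i * col_norm (X k * U) i) \<le> (\<Sum>k\<in>I. \<bar>col_norm (B k * U) i\<bar> * \<bar>col_norm (X k * U) i\<bar>)"
      by simp
    also have "\<dots> \<le> L2_set (\<lambda>k. col_norm (B k * U) i) I * L2_set (\<lambda>k. col_norm (X k * U) i) I"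
      by (rule L2_set_mult_ineq)
    also have "\<dots> \<le> 1 * L2_set (\<lambda>k. col_norm (X k * U) i) I"
      using BU[OF i] by (intro mult_right_mono) (auto simp: L2_set_def sum_nonneg)
    also have "\<dots> = sqrt (q i)" using Xq[OF i] by (simp add: L2_set_def)
    finally show "(\<Sum>k\<in>I. col_norm (B k * U) i * col_norm (X k * U) i) \<le> sqrt (q i)" .
  qed
  finally show ?thesis by (simp add: q)
qed

text \<open>The splitting C = C + 0 ensures that the infimum is taken over a nonempty set.\<close>

lemma S1_l2_norm_greatest:
  assumes "\<forall>k\<in>I. C k \<in> carrier_mat d d"
    and "\<And>X Y. \<forall>k\<in>I. X k \<in> carrier_mat d d \<and> Y k \<in> carrier_mat d d \<and> C k = X k + Y k \<Longrightarrow>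
     c \<le> Re (mat_trace (psd_sqrt (mat_sum d (\<lambda>k. mat_adjoint (X k) * X k) I))) +
     Re (mat_trace (psd_sqrt (mat_sum d (\<lambda>k. Y k * mat_adjoint (Y k)) I)))"
  shows "c \<le> S1_l2_norm d I C"
  unfolding S1_l2_norm_def
proof (rule cInf_greatest)
  let ?v = "\<lambda>X Y. Re (mat_trace (psd_sqrt (mat_sum d (\<lambda>k. mat_adjoint (X k) * X k) I))) +
      Re (mat_trace (psd_sqrt (mat_sum d (\<lambda>k. Y k * mat_adjoint (Y k)) I)))"
  let ?A = "{?v X Y | X Y. \<forall>k\<in>I. X k \<in> carrier_mat d d \<and> Y k \<in> carrier_mat d d \<and> C k = X k + Y k}"
  have "\<forall>k\<in>I. C k \<in> carrier_mat d d \<and> 0\<^sub>m d d \<in> carrier_mat d d \<and> C k = C k + 0\<^sub>m d d"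
    using assms(1) by simp
  hence "?v C (\<lambda>_. 0\<^sub>m d d) \<in> ?A"
    by (intro CollectI exI[of _ C] exI[of _ "\<lambda>_. 0\<^sub>m d d"] conjI refl)
  thus "?A \<noteq> {}" by (rule ex_in_conv[THEN iffD1, OF exI])
  fix r assume "r \<in> ?A"
  then obtain X Y where r: "r = ?v X Y" and "\<forall>k\<in>I. X k \<in> carrier_mat d d \<and> Y k \<in> carrier_mat d d \<and> C k = X k + Y k"
    by (elim CollectE exE conjE)
  from assms(2)[OF this(2)] show "c \<le> r" unfolding r .
qed

text \<open>A family whose two Gram sums are at most 1 tests both halves of a splitting: the part X
  through the sum of B^* B and, after taking adjoints, the part Y through the sum of B B^*.\<close>

theorem S1_l2_norm_ge_dual:
  assumes I: "finite I" and C: "\<forall>k\<in>I. C k \<in> carrier_mat d d" and B: "\<forall>k\<in>I. B k \<in> carrier_mat d d"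
    and f: "mat_sum d (\<lambda>k. mat_adjoint (B k) * B k) I = diag_real d f" "\<And>i. i < d \<Longrightarrow> f i \<le> 1"
    and h: "mat_sum d (\<lambda>k. B k * mat_adjoint (B k)) I = diag_real d h" "\<And>i. i < d \<Longrightarrow> h i \<le> 1"
  shows "(\<Sum>k\<in>I. hs_inner (B k) (C k)) \<le> S1_l2_norm d I C"
proof (rule S1_l2_norm_greatest[OF C])
  fix X Y assume XY: "\<forall>k\<in>I. X k \<in> carrier_mat d d \<and> Y k \<in> carrier_mat d d \<and> C k = X k + Y k"
  have k: "X k \<in> carrier_mat d d" "Y k \<in> carrier_mat d d" "B k \<in> carrier_mat d d" "C k = X k + Y k"
    "mat_adjoint (Y k) \<in> carrier_mat d d" "mat_adjoint (B k) \<in> carrier_mat d d" if "k \<in> I" for k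
    using XY B that by simp_all
  have "(\<Sum>k\<in>I. hs_inner (B k) (C k)) = (\<Sum>k\<in>I. hs_inner (B k) (X k) + hs_inner (mat_adjoint (B k)) (mat_adjoint (Y k)))"
  proof (intro sum.cong refl)
    fix j assume "j \<in> I"
    note k = k[OF this]
    show "hs_inner (B j) (C j) = hs_inner (B j) (X j) + hs_inner (mat_adjoint (B j)) (mat_adjoint (Y j))"
      unfolding k(4) hs_inner_adjoint[OF k(3,2)] by (rule hs_inner_add_right[OF k(3,1,2)])
  qed
  also have "\<dots> = (\<Sum>k\<in>I. hs_inner (B k) (X k)) + (\<Sum>k\<in>I. hs_inner (mat_adjoint (B k)) (mat_adjoint (Y k)))"
    by (rule sum.distrib)
  also have "\<dots> \<le> Re (mat_trace (psd_sqrt (mat_sum d (\<lambda>k. mat_adjoint (X k) * X k) I))) +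
     Re (mat_trace (psd_sqrt (mat_sum d (\<lambda>k. mat_adjoint (mat_adjoint (Y k)) * mat_adjoint (Y k)) I)))"
  proof (rule add_mono)
    show "(\<Sum>k\<in>I. hs_inner (B k) (X k)) \<le> Re (mat_trace (psd_sqrt (mat_sum d (\<lambda>k. mat_adjoint (X k) * X k) I)))"
      by (rule trace_sqrt_gram_ge[OF I k(1) k(3) f])
    show "(\<Sum>k\<in>I. hs_inner (mat_adjoint (B k)) (mat_adjoint (Y k))) \<le>
      Re (mat_trace (psd_sqrt (mat_sum d (\<lambda>k. mat_adjoint (mat_adjoint (Y k)) * mat_adjoint (Y k)) I)))"
      by (rule trace_sqrt_gram_ge[OF I k(5) k(6) _ h(2)]) (simp_all add: h(1))
  qed
  finally show "(\<Sum>k\<in>I. hs_inner (B k) (C k)) \<le> Re (mat_trace (psd_sqrt (mat_sum d (\<lambda>k. mat_adjoint (X k) * X k) I))) +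
     Re (mat_trace (psd_sqrt (mat_sum d (\<lambda>k. Y k * mat_adjoint (Y k)) I)))" unfolding mat_adjoint_adjoint .
qed

lemma lin_comb_mult_right:
  assumes "\<forall>j\<in>{1..l}. X j \<in> carrier_mat d d" "Y \<in> carrier_mat d d"
  shows "lin_comb d l X x * Y = lin_comb d l (\<lambda>j. X j * Y) x"
proof -
  have [simp]: "X j \<in> carrier_mat d d" if "j \<in> {1..l}" for j using assms(1) that by blast
  note [simp] = assms(2)
  have "lin_comb d l X x * Y = mat_sum d (\<lambda>j. complex_of_real (x j) \<cdot>\<^sub>m X j * Y) {1..l}"
    unfolding lin_comb_def by (rule mat_sum_mult_right) simp_all
  also have "\<dots> = lin_comb d l (\<lambda>j. X j * Y) x"
    unfolding lin_comb_def
    by (rule mat_sum_cong) (simp_all add: mult_smult_assoc_mat[of _ d d Y d] del: atLeastAtMost_iff)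
  finally show ?thesis .
qed

context gaussian_sequence
begin

text \<open>Jensen's inequality in the form that variances are nonnegative; the second moment is
  computed from the orthonormality of the g_j.\<close>

lemma expectation_hs_norm_le:
  assumes X: "\<forall>j\<in>{1..l}. X j \<in> carrier_mat d d"
  shows "integrable M (\<lambda>\<omega>. hs_norm (lin_comb d l X (\<lambda>j. g j \<omega>)))"
    "expectation (\<lambda>\<omega>. hs_norm (lin_comb d l X (\<lambda>j. g j \<omega>))) \<le> sqrt (\<Sum>j=1..l. hs_inner (X j) (X j))"
proof -
  let ?f = "\<lambda>\<omega>. hs_norm (lin_comb d l X (\<lambda>j. g j \<omega>))"
  have "\<bar>hs_norm A - hs_norm B\<bar> \<le> 1 * hs_norm (A - B)" if AB: "A \<in> carrier_mat d d" "B \<in> carrier_mat d d" for A B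
  proof -
    have c: "A - B \<in> carrier_mat d d" "B - A \<in> carrier_mat d d" using AB by (auto simp: minus_carrier_mat)
    have e: "A = B + (A - B)" "B = A + (B - A)" "B - A = (-1) \<cdot>\<^sub>m (A - B)"
      using AB by (auto intro!: eq_matI)
    have "hs_norm A \<le> hs_norm B + hs_norm (A - B)" using hs_norm_triangle[OF AB(2) c(1)] e(1) by simp
    moreover have "hs_norm B \<le> hs_norm A + hs_norm (B - A)" using hs_norm_triangle[OF AB(1) c(2)] e(2) by simp
    moreover have "hs_norm (B - A) = hs_norm (A - B)" using hs_norm_smult[of "-1" "A - B"] e(3) by simp
    ultimately show ?thesis by (simp add: abs_le_iff)
  qed
  hence lip: "sum_lipschitz l (\<lambda>x. hs_norm (lin_comb d l X x))"
    by (intro sum_lipschitz_entry[OF X, where K = 1]) auto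
  show int: "integrable M ?f" by (rule sum_lipschitz_integrable[OF lip])
  have sq: "(?f \<omega>)\<^sup>2 = hs_inner (lin_comb d l X (\<lambda>j. g j \<omega>)) (lin_comb d l X (mix l 0 \<omega>))" for \<omega>
    by (simp add: hs_norm_square)
  have "integrable M (\<lambda>\<omega>. (?f \<omega>)\<^sup>2)" unfolding sq by (rule expectation_hs_inner_lin_comb_mix(1)[OF X])
  hence "(expectation ?f)\<^sup>2 \<le> expectation (\<lambda>\<omega>. (?f \<omega>)\<^sup>2)"
    using variance_eq[OF int] variance_positive[of ?f] by simp
  also have "\<dots> = (\<Sum>j=1..l. hs_inner (X j) (X j))"
    unfolding sq expectation_hs_inner_lin_comb_mix(2)[OF X] by simp
  finally show "expectation ?f \<le> sqrt (\<Sum>j=1..l. hs_inner (X j) (X j))" by (rule real_le_rsqrt)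
qed

text \<open>The basis \<open>U\<close> depends on the coefficients and not on the outcome, so each
  column is a Gaussian combination with second moment q_i.\<close>

lemma expectation_sum_col_norm_le:
  assumes X: "\<forall>j\<in>{1..l}. X j \<in> carrier_mat d d"
  obtains U where "unitary_mat d U"
    "integrable M (\<lambda>\<omega>. \<Sum>i<d. col_norm (lin_comb d l X (\<lambda>j. g j \<omega>) * U) i)"
    "expectation (\<lambda>\<omega>. \<Sum>i<d. col_norm (lin_comb d l X (\<lambda>j. g j \<omega>) * U) i) \<le>
      Re (mat_trace (psd_sqrt (mat_sum d (\<lambda>k. mat_adjoint (X k) * X k) {1..l})))"
proof -
  have Xj: "\<And>k. k \<in> {1..l} \<Longrightarrow> X k \<in> carrier_mat d d" using X by blast
  obtain U q where U: "unitary_mat d U"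
    and q: "Re (mat_trace (psd_sqrt (mat_sum d (\<lambda>k. mat_adjoint (X k) * X k) {1..l}))) = (\<Sum>i<d. sqrt (q i))"
    and Xq: "\<And>i. i < d \<Longrightarrow> (\<Sum>k\<in>{1..l}. (col_norm (X k * U) i)\<^sup>2) = q i"
    by (rule gram_sum_diagonalization[OF finite_atLeastAtMost Xj]) blast+
  note Uc = unitary_matD(1)[OF U]
  define D where "D i = diag_real d (\<lambda>k. if k = i then 1 else 0)" for i :: nat
  define Z where "Z i j = X j * U * D i" for i j
  have XU: "\<forall>j\<in>{1..l}. X j * U \<in> carrier_mat d d" using X Uc by simp
  have Z: "\<forall>j\<in>{1..l}. Z i j \<in> carrier_mat d d" for i using XU by (simp add: Z_def D_def)
  have eq: "col_norm (lin_comb d l X x * U) i = hs_norm (lin_comb d l (Z i) x)" if "i < d" for i x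
    unfolding Z_def lin_comb_mult_right[OF X Uc]
    using lin_comb_mult_right[OF XU, of "D i"] lin_comb_carrier[OF XU] that
    by (simp add: D_def col_norm_eq_hs_norm[of _ d])
  have Zq: "(\<Sum>j=1..l. hs_inner (Z i j) (Z i j)) = q i" if i: "i < d" for i
  proof -
    have "hs_inner (Z i j) (Z i j) = (col_norm (X j * U) i)\<^sup>2" if "j \<in> {1..l}" for j
      using col_norm_eq_hs_norm[OF bspec[OF XU that] i] by (simp add: Z_def D_def hs_norm_square)
    thus ?thesis using Xq[OF i] by simp
  qed
  have int: "integrable M (\<lambda>\<omega>. col_norm (lin_comb d l X (\<lambda>j. g j \<omega>) * U) i)"
    and le: "expectation (\<lambda>\<omega>. col_norm (lin_comb d l X (\<lambda>j. g j \<omega>) * U) i) \<le> sqrt (q i)" if "i < d" for i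
    using expectation_hs_norm_le[OF Z, of i] unfolding eq[OF that] Zq[OF that] by auto
  show thesis
  proof (rule that[OF U])
    show "integrable M (\<lambda>\<omega>. \<Sum>i<d. col_norm (lin_comb d l X (\<lambda>j. g j \<omega>) * U) i)"
      using int by (intro Bochner_Integration.integrable_sum) auto
    have "expectation (\<lambda>\<omega>. \<Sum>i<d. col_norm (lin_comb d l X (\<lambda>j. g j \<omega>) * U) i) =
      (\<Sum>i<d. expectation (\<lambda>\<omega>. col_norm (lin_comb d l X (\<lambda>j. g j \<omega>) * U) i))"
      using int by (intro Bochner_Integration.integral_sum) auto
    also have "\<dots> \<le> (\<Sum>i<d. sqrt (q i))" using le by (intro sum_mono) auto
    finally show "expectation (\<lambda>\<omega>. \<Sum>i<d. col_norm (lin_comb d l X (\<lambda>j. g j \<omega>) * U) i) \<le>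
      Re (mat_trace (psd_sqrt (mat_sum d (\<lambda>k. mat_adjoint (X k) * X k) {1..l})))" unfolding q .
  qed
qed

theorem L1_S1_norm_le_S1_l2_norm:
  assumes C: "\<forall>j\<in>{1..l}. C j \<in> carrier_mat d d"
  shows "L1_S1_norm M (gauss_sum g d l C) \<le> S1_l2_norm d {1..l} C"
proof (rule S1_l2_norm_greatest[OF C])
  fix X Y assume XY: "\<forall>k\<in>{1..l}. X k \<in> carrier_mat d d \<and> Y k \<in> carrier_mat d d \<and> C k = X k + Y k"
  hence X: "\<forall>k\<in>{1..l}. X k \<in> carrier_mat d d" and Y: "\<forall>k\<in>{1..l}. Y k \<in> carrier_mat d d"
    and Y': "\<forall>k\<in>{1..l}. mat_adjoint (Y k) \<in> carrier_mat d d" by auto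
  obtain U where U: "unitary_mat d U"
    and U1: "integrable M (\<lambda>\<omega>. \<Sum>i<d. col_norm (lin_comb d l X (\<lambda>j. g j \<omega>) * U) i)"
    and U2: "expectation (\<lambda>\<omega>. \<Sum>i<d. col_norm (lin_comb d l X (\<lambda>j. g j \<omega>) * U) i) \<le>
      Re (mat_trace (psd_sqrt (mat_sum d (\<lambda>k. mat_adjoint (X k) * X k) {1..l})))"
    by (rule expectation_sum_col_norm_le[OF X])
  \<comment> \<open>The row part of \<open>Y\<close> is the column part of the adjoints.\<close>
  obtain V where V: "unitary_mat d V"
    and V1: "integrable M (\<lambda>\<omega>. \<Sum>i<d. col_norm (lin_comb d l (\<lambda>k. mat_adjoint (Y k)) (\<lambda>j. g j \<omega>) * V) i)"
    and V2: "expectation (\<lambda>\<omega>. \<Sum>i<d. col_norm (lin_comb d l (\<lambda>k. mat_adjoint (Y k)) (\<lambda>j. g j \<omega>) * V) i) \<le>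
      Re (mat_trace (psd_sqrt (mat_sum d (\<lambda>k. mat_adjoint (mat_adjoint (Y k)) * mat_adjoint (Y k)) {1..l})))"
    by (rule expectation_sum_col_norm_le[OF Y'])
  have pointwise: "Re (mat_trace (mat_abs (lin_comb d l C x))) \<le>
    (\<Sum>i<d. col_norm (lin_comb d l X x * U) i) + (\<Sum>i<d. col_norm (lin_comb d l (\<lambda>k. mat_adjoint (Y k)) x * V) i)" for x
  proof -
    have cX: "lin_comb d l X x \<in> carrier_mat d d" and cY: "lin_comb d l Y x \<in> carrier_mat d d"
      by (intro lin_comb_carrier X Y)+
    have sum: "lin_comb d l C x = lin_comb d l X x + lin_comb d l Y x"
    proof (rule eq_matI)
      fix a b assume "a < dim_row (lin_comb d l X x + lin_comb d l Y x)" "b < dim_col (lin_comb d l X x + lin_comb d l Y x)"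
      hence ab: "a < d" "b < d" using carrier_matD[OF cY] by auto
      have "C j $$ (a, b) = X j $$ (a, b) + Y j $$ (a, b)" if "j \<in> {1..l}" for j
        using XY that ab carrier_matD[OF bspec[OF Y that]] by (simp del: atLeastAtMost_iff)
      hence "lin_comb d l C x $$ (a, b) = (\<Sum>j=1..l. complex_of_real (x j) * (X j $$ (a, b) + Y j $$ (a, b)))"
        unfolding lin_comb_index[OF C ab] by (intro sum.cong refl) simp
      thus "lin_comb d l C x $$ (a, b) = (lin_comb d l X x + lin_comb d l Y x) $$ (a, b)"
        using ab carrier_matD[OF cY]
        by (simp add: lin_comb_index[OF X ab] lin_comb_index[OF Y ab] distrib_left sum.distrib)
    qed (use carrier_matD[OF lin_comb_carrier[OF C]] carrier_matD[OF cY] in auto)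
    \<comment> \<open>One polar factor, that of the whole combination, serves both parts; each part
      is then estimated in its own basis.\<close>
    obtain W where W: "partial_isometry d W" "W * lin_comb d l C x = mat_abs (lin_comb d l C x)"
      by (rule polar_decomposition[OF lin_comb_carrier[OF C]]) blast
    have Wc: "W \<in> carrier_mat d d" by (rule partial_isometry_carrier[OF W(1)])
    have "mat_abs (lin_comb d l C x) = W * lin_comb d l X x + W * lin_comb d l Y x"
      using W(2) mult_add_distrib_mat[OF Wc cX cY] sum by simp
    hence "mat_trace (mat_abs (lin_comb d l C x)) = mat_trace (W * lin_comb d l X x) + mat_trace (W * lin_comb d l Y x)"
      using Wc cX cY by (simp add: mat_trace_add[of _ d])
    moreover have "Re (mat_trace (W * lin_comb d l X x)) \<le> (\<Sum>i<d. col_norm (lin_comb d l X x * U) i)"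
      by (rule trace_partial_isometry_le[OF W(1) U cX])
    moreover have "Re (mat_trace (W * lin_comb d l Y x)) \<le> (\<Sum>i<d. col_norm (lin_comb d l (\<lambda>k. mat_adjoint (Y k)) x * V) i)"
      using trace_partial_isometry_le'[OF W(1) V cY] by (simp only: mat_adjoint_lin_comb[OF Y])
    ultimately show ?thesis by simp
  qed
  have "L1_S1_norm M (gauss_sum g d l C) \<le> expectation (\<lambda>\<omega>. (\<Sum>i<d. col_norm (lin_comb d l X (\<lambda>j. g j \<omega>) * U) i) +
    (\<Sum>i<d. col_norm (lin_comb d l (\<lambda>k. mat_adjoint (Y k)) (\<lambda>j. g j \<omega>) * V) i))"
    unfolding L1_S1_norm_gauss_sum(2)[OF C]
    by (intro integral_mono L1_S1_norm_gauss_sum(1)[OF C] Bochner_Integration.integrable_add U1 V1 pointwise)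
  also have "\<dots> = expectation (\<lambda>\<omega>. \<Sum>i<d. col_norm (lin_comb d l X (\<lambda>j. g j \<omega>) * U) i) +
    expectation (\<lambda>\<omega>. \<Sum>i<d. col_norm (lin_comb d l (\<lambda>k. mat_adjoint (Y k)) (\<lambda>j. g j \<omega>) * V) i)"
    by (rule Bochner_Integration.integral_add[OF U1 V1])
  also have "\<dots> \<le> Re (mat_trace (psd_sqrt (mat_sum d (\<lambda>k. mat_adjoint (X k) * X k) {1..l}))) +
     Re (mat_trace (psd_sqrt (mat_sum d (\<lambda>k. Y k * mat_adjoint (Y k)) {1..l})))"
    using add_mono[OF U2 V2] by (simp only: mat_adjoint_adjoint)
  finally show "L1_S1_norm M (gauss_sum g d l C) \<le> Re (mat_trace (psd_sqrt (mat_sum d (\<lambda>k. mat_adjoint (X k) * X k) {1..l}))) +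
     Re (mat_trace (psd_sqrt (mat_sum d (\<lambda>k. Y k * mat_adjoint (Y k)) {1..l})))" .
qed

end

section \<open>Creation operators and optimality\<close>

text \<open>By hypothesis G^* G has no eigenvalues other than 0 and s^2. Hence G^* G / s is its
  root: it is positive as the Gram matrix of G / sqrt s, and it squares to G^* G.\<close>

lemma mat_abs_scaled_gram:
  assumes G: "G \<in> carrier_mat d d" and s: "s > 0"
    and H: "mat_adjoint G * G * (mat_adjoint G * G) = complex_of_real (s\<^sup>2) \<cdot>\<^sub>m (mat_adjoint G * G)"
  shows "mat_abs G = complex_of_real (1 / s) \<cdot>\<^sub>m (mat_adjoint G * G)"
  unfolding mat_abs_def
proof (rule psd_sqrt_eqI[of d])
  define c where "c = complex_of_real (sqrt (1 / s))"
  define H where "H = mat_adjoint G * G"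
  have Hc [simp]: "H \<in> carrier_mat d d" using G by (simp add: H_def)
  have "c * cnj c = complex_of_real (sqrt (1 / s) * sqrt (1 / s))"
    by (simp only: c_def complex_cnj_complex_of_real of_real_mult)
  also have "sqrt (1 / s) * sqrt (1 / s) = 1 / s" using s by simp
  finally have cc: "c * cnj c = 1 / complex_of_real s" by simp
  have "mat_adjoint (c \<cdot>\<^sub>m G) * (c \<cdot>\<^sub>m G) = complex_of_real (1 / s) \<cdot>\<^sub>m H"
    unfolding mat_adjoint_smult H_def using G
    by (simp add: mult_smult_distrib[of _ d d G d] mult_smult_assoc_mat[of "mat_adjoint G" d d G d] smult_smult_mat cc mult.commute[of "cnj c"])
  thus "psd_mat d (complex_of_real (1 / s) \<cdot>\<^sub>m (mat_adjoint G * G))"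
    using psd_mat_gram[of "c \<cdot>\<^sub>m G" d d] G by (simp add: H_def)
  have "complex_of_real (1 / s) \<cdot>\<^sub>m H * (complex_of_real (1 / s) \<cdot>\<^sub>m H) = (complex_of_real (1 / s) * complex_of_real (1 / s) * complex_of_real (s\<^sup>2)) \<cdot>\<^sub>m H"
    using H unfolding H_def[symmetric]
    by (simp add: mult_smult_distrib[of _ d d H d] mult_smult_assoc_mat[of H d d H d] smult_smult_mat mult_ac)
  also have "complex_of_real (1 / s) * complex_of_real (1 / s) * complex_of_real (s\<^sup>2) = 1"
    using s by (simp add: power2_eq_square)
  also have "1 \<cdot>\<^sub>m H = H" by (intro eq_matI) auto
  finally show "complex_of_real (1 / s) \<cdot>\<^sub>m (mat_adjoint G * G) * (complex_of_real (1 / s) \<cdot>\<^sub>m (mat_adjoint G * G)) = mat_adjoint G * G"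
    by (simp only: H_def)
qed

lemma sum_product_swap:
  fixes f g :: "'i \<Rightarrow> 'u \<Rightarrow> real"
  shows "(\<Sum>u\<in>A. (\<Sum>i\<in>I. f i u) * (\<Sum>j\<in>I. g j u)) = (\<Sum>i\<in>I. \<Sum>j\<in>I. \<Sum>u\<in>A. f i u * g j u)"
  unfolding sum_product by (subst sum.swap, intro sum.cong refl, rule sum.swap)

text \<open>The basis of the exterior algebra is labelled by subsets of \<open>{1..l}\<close>, while
  matrices are indexed by numbers; \<open>e\<close> mediates between the two and forces d =
  2^l.\<close>

locale subset_enumeration =
  fixes l d :: nat and e :: "nat \<Rightarrow> nat set"
  assumes bij: "bij_betw e {..<d} (Pow {1..l})"
begin

definition kernel_mat :: "(nat set \<Rightarrow> nat set \<Rightarrow> real) \<Rightarrow> complex mat" where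
  "kernel_mat F = mat d d (\<lambda>(r, c). complex_of_real (F (e r) (e c)))"

lemma kernel_mat_carrier [simp]: "kernel_mat F \<in> carrier_mat d d"
  by (simp add: kernel_mat_def)

lemma kernel_mat_dim [simp]: "dim_row (kernel_mat F) = d" "dim_col (kernel_mat F) = d"
  by (simp_all add: kernel_mat_def)

lemma kernel_mat_index [simp]:
  "r < d \<Longrightarrow> c < d \<Longrightarrow> kernel_mat F $$ (r, c) = complex_of_real (F (e r) (e c))"
  by (simp add: kernel_mat_def)

lemma e_subset: "r < d \<Longrightarrow> e r \<subseteq> {1..l}"
  using bij by (auto simp: bij_betw_def)

lemma e_eq_iff: "r < d \<Longrightarrow> c < d \<Longrightarrow> e r = e c \<longleftrightarrow> r = c"
  using bij by (auto simp: bij_betw_def inj_on_def)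

lemma sum_e: "(\<Sum>r<d. F (e r)) = sum F (Pow {1..l})"
  by (rule sum.reindex_bij_betw[OF bij])

lemma kernel_mat_cong:
  assumes "\<And>T S. T \<subseteq> {1..l} \<Longrightarrow> S \<subseteq> {1..l} \<Longrightarrow> F T S = G T S"
  shows "kernel_mat F = kernel_mat G"
  using assms e_subset by (intro eq_matI) auto

lemma kernel_mat_adjoint: "mat_adjoint (kernel_mat F) = kernel_mat (\<lambda>T S. F S T)"
  by (intro eq_matI) auto

lemma kernel_mat_mult:
  "kernel_mat F * kernel_mat G = kernel_mat (\<lambda>T S. \<Sum>U\<in>Pow {1..l}. F T U * G U S)"
proof (rule eq_matI)
  fix r c assume "r < dim_row (kernel_mat (\<lambda>T S. \<Sum>U\<in>Pow {1..l}. F T U * G U S))"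
    "c < dim_col (kernel_mat (\<lambda>T S. \<Sum>U\<in>Pow {1..l}. F T U * G U S))"
  hence rc: "r < d" "c < d" by auto
  have "(kernel_mat F * kernel_mat G) $$ (r, c) = (\<Sum>u<d. complex_of_real (F (e r) (e u) * G (e u) (e c)))"
    using rc by (subst index_mult_mat_sum[of _ d d _ d]) auto
  also have "\<dots> = complex_of_real (\<Sum>U\<in>Pow {1..l}. F (e r) U * G U (e c))"
    unfolding sum_e[of "\<lambda>U. F (e r) U * G U (e c)", symmetric] by (rule of_real_sum[symmetric])
  finally show "(kernel_mat F * kernel_mat G) $$ (r, c) = kernel_mat (\<lambda>T S. \<Sum>U\<in>Pow {1..l}. F T U * G U S) $$ (r, c)"
    using rc by simp
qed auto

lemma kernel_mat_add: "kernel_mat F + kernel_mat G = kernel_mat (\<lambda>T S. F T S + G T S)"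
  by (intro eq_matI) auto

lemma kernel_mat_zero: "kernel_mat (\<lambda>T S. 0) = 0\<^sub>m d d"
  by (intro eq_matI) auto

lemma kernel_mat_smult: "complex_of_real a \<cdot>\<^sub>m kernel_mat F = kernel_mat (\<lambda>T S. a * F T S)"
  by (intro eq_matI) auto

lemma kernel_mat_diag: "kernel_mat (\<lambda>T S. if T = S then a S else 0) = diag_real d (\<lambda>r. a (e r))"
  by (intro eq_matI) (auto simp: e_eq_iff)

lemma kernel_mat_sum: "finite I \<Longrightarrow> mat_sum d (\<lambda>j. kernel_mat (F j)) I = kernel_mat (\<lambda>T S. \<Sum>j\<in>I. F j T S)"
  by (intro eq_matI) (auto simp: mat_sum_index)

lemma lin_comb_kernel_mat: "lin_comb d l (\<lambda>j. kernel_mat (F j)) x = kernel_mat (\<lambda>T S. \<Sum>j=1..l. x j * F j T S)"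
  by (simp add: lin_comb_def kernel_mat_smult kernel_mat_sum)

lemma hs_inner_kernel_mat:
  "hs_inner (kernel_mat F) (kernel_mat G) = (\<Sum>T\<in>Pow {1..l}. \<Sum>S\<in>Pow {1..l}. F T S * G T S)"
proof -
  have "hs_inner (kernel_mat F) (kernel_mat G) = (\<Sum>r<d. \<Sum>c<d. F (e r) (e c) * G (e r) (e c))"
    by (subst hs_inner_sum[of _ d d]) auto
  also have "\<dots> = (\<Sum>r<d. \<Sum>S\<in>Pow {1..l}. F (e r) S * G (e r) S)"
    by (intro sum.cong refl sum_e)
  also have "\<dots> = (\<Sum>T\<in>Pow {1..l}. \<Sum>S\<in>Pow {1..l}. F T S * G T S)" by (rule sum_e)
  finally show ?thesis .
qed

end

text \<open>The sign picked up when the vector j moves from the front of the wedge product over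
  \<open>insert j S\<close> to its place in increasing order.\<close>

definition fermion_sign :: "nat \<Rightarrow> nat set \<Rightarrow> real" where
  "fermion_sign j S = (-1) ^ card {i \<in> S. i < j}"

text \<open>Matrix coefficients of the fermionic creation operators in the basis of \<open>\<Lambda>(\<complex>\<^sup>l)\<close> indexed by subsets.\<close>

definition creation :: "nat \<Rightarrow> nat set \<Rightarrow> nat set \<Rightarrow> real" where
  "creation j T S = (if j \<notin> S \<and> T = insert j S then fermion_sign j S else 0)"

lemma fermion_sign_square [simp]: "fermion_sign j S * fermion_sign j S = 1"
  by (simp add: fermion_sign_def flip: power_add mult_2)

lemma fermion_sign_insert:
  assumes "finite S" "i \<notin> S"
  shows "fermion_sign j (insert i S) = (if i < j then - fermion_sign j S else fermion_sign j S)"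
proof -
  have "{a \<in> insert i S. a < j} = (if i < j then insert i {a \<in> S. a < j} else {a \<in> S. a < j})" by auto
  thus ?thesis using assms by (simp add: fermion_sign_def)
qed

lemma sum_creation_left:
  assumes "S \<subseteq> {1..l}" "j \<in> {1..l}"
  shows "(\<Sum>U\<in>Pow {1..l}. F U * creation j U S) = (if j \<in> S then 0 else F (insert j S) * fermion_sign j S)"
proof -
  have "F U * creation j U S = (if U = insert j S then (if j \<in> S then 0 else F (insert j S) * fermion_sign j S) else 0)" for U
    by (simp add: creation_def)
  hence "(\<Sum>U\<in>Pow {1..l}. F U * creation j U S) =
    (\<Sum>U\<in>Pow {1..l}. if U = insert j S then (if j \<in> S then 0 else F (insert j S) * fermion_sign j S) else 0)" by simp
  also have "\<dots> = (if insert j S \<in> Pow {1..l} then (if j \<in> S then 0 else F (insert j S) * fermion_sign j S) else 0)"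
    by (rule sum.delta) simp
  finally show ?thesis using assms by simp
qed

lemma sum_creation_right:
  assumes "T \<subseteq> {1..l}"
  shows "(\<Sum>U\<in>Pow {1..l}. creation j T U * F U) = (if j \<in> T then fermion_sign j (T - {j}) * F (T - {j}) else 0)"
proof -
  have "j \<notin> U \<and> T = insert j U \<longleftrightarrow> U = T - {j} \<and> j \<in> T" for U by auto
  hence "creation j T U * F U = (if U = T - {j} then (if j \<in> T then fermion_sign j (T - {j}) * F (T - {j}) else 0) else 0)" for U
    by (simp add: creation_def)
  hence "(\<Sum>U\<in>Pow {1..l}. creation j T U * F U) =
    (\<Sum>U\<in>Pow {1..l}. if U = T - {j} then (if j \<in> T then fermion_sign j (T - {j}) * F (T - {j}) else 0) else 0)" by simp
  also have "\<dots> = (if T - {j} \<in> Pow {1..l} then (if j \<in> T then fermion_sign j (T - {j}) * F (T - {j}) else 0) else 0)"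
    by (rule sum.delta) simp
  finally show ?thesis using assms by auto
qed

text \<open>The essential case is that of distinct i, j outside S. Both orders then reach the same
  set, and the signs are opposite because only the presence of the smaller element affects the sign
  of the other.\<close>

lemma creation_anticommute:
  assumes S: "S \<subseteq> {1..l}" and ij: "i \<in> {1..l}" "j \<in> {1..l}"
  shows "(\<Sum>U\<in>Pow {1..l}. creation i T U * creation j U S) = - (\<Sum>U\<in>Pow {1..l}. creation j T U * creation i U S)"
proof -
  have f: "finite S" using S finite_subset by blast
  show ?thesis
  proof (cases "i = j \<or> i \<in> S \<or> j \<in> S")
    case True
    thus ?thesis unfolding sum_creation_left[OF S ij(1)] sum_creation_left[OF S ij(2)]
      by (auto simp: creation_def)
  next
    case False
    hence n: "i \<noteq> j" "i \<notin> S" "j \<notin> S" by auto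
    have "creation i T (insert j S) = (if T = insert i (insert j S) then fermion_sign i (insert j S) else 0)"
      "creation j T (insert i S) = (if T = insert i (insert j S) then fermion_sign j (insert i S) else 0)"
      using n by (simp_all add: creation_def insert_commute)
    moreover have "fermion_sign i (insert j S) * fermion_sign j S = - (fermion_sign j (insert i S) * fermion_sign i S)"
      using n by (simp add: fermion_sign_insert[OF f])
    ultimately show ?thesis unfolding sum_creation_left[OF S ij(1)] sum_creation_left[OF S ij(2)] using n by simp
  qed
qed

lemma sum_creation_left_self:
  assumes "S \<subseteq> {1..l}" "j \<in> {1..l}"
  shows "(\<Sum>U\<in>Pow {1..l}. creation j U T * creation j U S) = (if T = S \<and> j \<notin> S then 1 else 0)"
proof -
  have "j \<notin> S \<and> j \<notin> T \<and> insert j S = insert j T \<longleftrightarrow> T = S \<and> j \<notin> S" by (metis insert_ident)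
  thus ?thesis unfolding sum_creation_left[OF assms] by (auto simp: creation_def)
qed

text \<open>The canonical anticommutation relations: the sums are the entries of a_i^* a_j and a_j
  a_i^* for the creation operators a_j. For i different from j they can be nonzero only if T arises
  from S by replacing i with j, and then they cancel.\<close>

lemma creation_canonical:
  assumes S: "S \<subseteq> {1..l}" and T: "T \<subseteq> {1..l}" and ij: "i \<in> {1..l}" "j \<in> {1..l}"
  shows "(\<Sum>U\<in>Pow {1..l}. creation i U T * creation j U S) + (\<Sum>U\<in>Pow {1..l}. creation j T U * creation i S U) =
    (if i = j \<and> T = S then 1 else 0)"
proof (cases "i = j")
  case True
  have "(if j \<in> T then fermion_sign j (T - {j}) * creation j S (T - {j}) else 0) = (if T = S \<and> j \<in> S then 1 else 0)"
    by (auto simp: creation_def insert_absorb)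
  thus ?thesis
    unfolding True sum_creation_left_self[OF S ij(2)] sum_creation_right[OF T] by simp
next
  case False
  show ?thesis
  proof (cases "j \<notin> S \<and> i \<in> S \<and> T = insert j (S - {i})")
    case True
    define R where "R = S - {i}"
    have R: "finite R" "S = insert i R" "T = insert j R" "i \<notin> R" "j \<notin> R"
      using True False finite_subset[OF S] by (auto simp: R_def)
    have "creation i (insert j S) T = fermion_sign i (insert j R)"
      using R(4) False by (simp add: creation_def R(2,3) insert_commute)
    moreover have "creation i S (T - {j}) = fermion_sign i R" "T - {j} = R"
      using R(4,5) by (simp_all add: creation_def R(2,3))
    moreover have "fermion_sign i (insert j R) * fermion_sign j S = - (fermion_sign j R * fermion_sign i R)"
      using R(4,5) False by (simp add: R(2) fermion_sign_insert[OF R(1)])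
    moreover have "R - {j} = R" using R(5) by blast
    ultimately show ?thesis
      unfolding sum_creation_left[OF S ij(2)] sum_creation_right[OF T] using True False by simp
  next
    case n: False
    have "creation i (insert j S) T = 0" if j: "j \<notin> S"
    proof (rule ccontr)
      assume "creation i (insert j S) T \<noteq> 0"
      hence i: "i \<notin> T" "insert j S = insert i T" by (auto simp: creation_def split: if_splits)
      hence "i \<in> S" "T = insert j S - {i}" using False by auto
      thus False using n j False by auto
    qed
    moreover have "creation i S (T - {j}) = 0" if j: "j \<in> T"
    proof (rule ccontr)
      assume "creation i S (T - {j}) \<noteq> 0"
      hence i: "i \<notin> T - {j}" "S = insert i (T - {j})" by (auto simp: creation_def split: if_splits)
      hence "S - {i} = T - {j}" "j \<notin> S" "i \<in> S" using False by auto
      thus False using n j by (simp add: insert_absorb)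
    qed
    ultimately show ?thesis
      unfolding sum_creation_left[OF S ij(2)] sum_creation_right[OF T] using False by simp
  qed
qed

section \<open>Creation operators as matrices and the k-particle spaces\<close>

context subset_enumeration
begin

definition creation_field :: "(nat \<Rightarrow> real) \<Rightarrow> complex mat" where
  "creation_field x = kernel_mat (\<lambda>T S. \<Sum>j=1..l. x j * creation j T S)"

lemma creation_field_carrier [simp]: "creation_field x \<in> carrier_mat d d"
  by (simp add: creation_field_def)

text \<open>The products a_i a_j are antisymmetric and x_i x_j is symmetric in i and j, so the sum
  equals its own negative.\<close>

lemma creation_field_square: "creation_field x * creation_field x = 0\<^sub>m d d"
proof -
  have "(\<Sum>U\<in>Pow {1..l}. (\<Sum>i=1..l. x i * creation i T U) * (\<Sum>j=1..l. x j * creation j U S)) = 0" (is "?z = 0")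
    if S: "S \<subseteq> {1..l}" for T S
  proof -
    have "?z = (\<Sum>i=1..l. \<Sum>j=1..l. \<Sum>U\<in>Pow {1..l}. (x i * creation i T U) * (x j * creation j U S))"
      by (rule sum_product_swap)
    also have "\<dots> = (\<Sum>i=1..l. \<Sum>j=1..l. x i * x j * (\<Sum>U\<in>Pow {1..l}. creation i T U * creation j U S))"
      by (simp add: sum_distrib_left mult_ac)
    finally have z: "?z = (\<Sum>i=1..l. \<Sum>j=1..l. x i * x j * (\<Sum>U\<in>Pow {1..l}. creation i T U * creation j U S))" .
    also have "\<dots> = (\<Sum>i=1..l. \<Sum>j=1..l. - (x j * x i * (\<Sum>U\<in>Pow {1..l}. creation j T U * creation i U S)))"
    proof (intro sum.cong refl)
      fix i j assume "i \<in> {1..l}" "j \<in> {1..l}"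
      from creation_anticommute[OF S this, of T]
      show "x i * x j * (\<Sum>U\<in>Pow {1..l}. creation i T U * creation j U S) =
        - (x j * x i * (\<Sum>U\<in>Pow {1..l}. creation j T U * creation i U S))"
        by (simp only: mult_minus_right mult.commute)
    qed
    also have "\<dots> = - (\<Sum>i=1..l. \<Sum>j=1..l. x j * x i * (\<Sum>U\<in>Pow {1..l}. creation j T U * creation i U S))"
      by (simp only: sum_negf)
    also have "\<dots> = - ?z" unfolding z by (subst sum.swap) (rule refl)
    finally show ?thesis by simp
  qed
  thus ?thesis
    unfolding creation_field_def kernel_mat_mult kernel_mat_zero[symmetric] by (intro kernel_mat_cong)
qed

lemma creation_field_canonical:
  "mat_adjoint (creation_field x) * creation_field x + creation_field x * mat_adjoint (creation_field x) = diag_real d (\<lambda>_. \<Sum>j=1..l. (x j)\<^sup>2)"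
proof -
  have "(\<Sum>U\<in>Pow {1..l}. (\<Sum>i=1..l. x i * creation i U T) * (\<Sum>j=1..l. x j * creation j U S)) +
    (\<Sum>U\<in>Pow {1..l}. (\<Sum>i=1..l. x i * creation i T U) * (\<Sum>j=1..l. x j * creation j S U)) =
    (if T = S then (\<Sum>j=1..l. (x j)\<^sup>2) else 0)" (is "?a + ?b = _")
    if S: "S \<subseteq> {1..l}" and T: "T \<subseteq> {1..l}" for T S
  proof -
    have "?a = (\<Sum>i=1..l. \<Sum>j=1..l. \<Sum>U\<in>Pow {1..l}. (x i * creation i U T) * (x j * creation j U S))"
      by (rule sum_product_swap)
    also have "\<dots> = (\<Sum>i=1..l. \<Sum>j=1..l. x i * x j * (\<Sum>U\<in>Pow {1..l}. creation i U T * creation j U S))"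
      by (simp add: sum_distrib_left mult_ac)
    finally have a: "?a = \<dots>" .
    have "?b = (\<Sum>i=1..l. \<Sum>j=1..l. \<Sum>U\<in>Pow {1..l}. (x i * creation i T U) * (x j * creation j S U))"
      by (rule sum_product_swap)
    also have "\<dots> = (\<Sum>i=1..l. \<Sum>j=1..l. x i * x j * (\<Sum>U\<in>Pow {1..l}. creation i T U * creation j S U))"
      by (simp add: sum_distrib_left mult_ac)
    also have "\<dots> = (\<Sum>i=1..l. \<Sum>j=1..l. x i * x j * (\<Sum>U\<in>Pow {1..l}. creation j T U * creation i S U))"
      by (subst sum.swap) (simp only: mult.commute)
    finally have "?a + ?b = (\<Sum>i=1..l. \<Sum>j=1..l. x i * x j *
      ((\<Sum>U\<in>Pow {1..l}. creation i U T * creation j U S) + (\<Sum>U\<in>Pow {1..l}. creation j T U * creation i S U)))"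
      unfolding a by (simp only: sum.distrib distrib_left)
    also have "\<dots> = (\<Sum>i=1..l. \<Sum>j=1..l. x i * x j * (if i = j \<and> T = S then 1 else 0))"
      by (intro sum.cong refl arg_cong2[where f = "(*)"] creation_canonical S T)
    also have "\<dots> = (\<Sum>i=1..l. \<Sum>j=1..l. if i = j then (if T = S then (x i)\<^sup>2 else 0) else 0)"
      by (intro sum.cong refl) (simp add: power2_eq_square)
    also have "\<dots> = (if T = S then (\<Sum>j=1..l. (x j)\<^sup>2) else 0)" by simp
    finally show ?thesis .
  qed
  thus ?thesis
    unfolding creation_field_def kernel_mat_adjoint kernel_mat_mult kernel_mat_add
      kernel_mat_diag[of "\<lambda>_. \<Sum>j=1..l. (x j)\<^sup>2", symmetric]
    by (intro kernel_mat_cong)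
qed

text \<open>The projection onto the k-particle space of the exterior algebra.\<close>

definition layer :: "nat \<Rightarrow> complex mat" where
  "layer k = diag_real d (\<lambda>r. if card (e r) = k then 1 else 0)"

definition layer_creation :: "nat \<Rightarrow> nat \<Rightarrow> complex mat" where
  "layer_creation k j = kernel_mat (\<lambda>T S. if card S = k then creation j T S else 0)"

lemma layer [simp]: "layer k \<in> carrier_mat d d" "mat_adjoint (layer k) = layer k" "layer k * layer k = layer k"
  by (simp_all add: layer_def diag_real_mult) (intro diag_real_cong, simp)

lemma layer_creation_carrier [simp]: "layer_creation k j \<in> carrier_mat d d"
  by (simp add: layer_creation_def)

lemma lin_comb_layer_creation: "lin_comb d l (layer_creation k) x = creation_field x * layer k"
proof -
  have "lin_comb d l (layer_creation k) x = kernel_mat (\<lambda>T S. \<Sum>j=1..l. x j * (if card S = k then creation j T S else 0))"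
    unfolding layer_creation_def by (rule lin_comb_kernel_mat)
  also have "\<dots> = creation_field x * layer k"
    by (intro eq_matI) (auto simp: layer_def creation_field_def index_mult_diag_real[OF kernel_mat_carrier] simp del: index_mult_mat(1))
  finally show ?thesis .
qed

text \<open>Creation raises the particle number by one.\<close>

lemma creation_field_layer: "creation_field x * layer k = layer (Suc k) * creation_field x"
proof (rule eq_matI)
  fix r c assume "r < dim_row (layer (Suc k) * creation_field x)" "c < dim_col (layer (Suc k) * creation_field x)"
  hence rc: "r < d" "c < d" using carrier_matD[OF layer(1)] carrier_matD[OF creation_field_carrier] by auto
  have f: "finite (e c)" using e_subset[OF rc(2)] finite_subset by blast
  have c: "creation j (e r) (e c) \<noteq> 0 \<Longrightarrow> card (e r) = Suc (card (e c))" for j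
    using f by (auto simp: creation_def split: if_splits)
  have "(\<Sum>j=1..l. x j * creation j (e r) (e c)) * (if card (e c) = k then 1 else 0) =
    (if card (e r) = Suc k then 1 else 0) * (\<Sum>j=1..l. x j * creation j (e r) (e c))"
    unfolding sum_distrib_left sum_distrib_right
    by (intro sum.cong refl) (use c in force)
  hence "complex_of_real (\<Sum>j=1..l. x j * creation j (e r) (e c)) * complex_of_real (if card (e c) = k then 1 else 0) =
    complex_of_real (if card (e r) = Suc k then 1 else 0) * complex_of_real (\<Sum>j=1..l. x j * creation j (e r) (e c))"
    unfolding of_real_mult[symmetric] by (rule arg_cong)
  thus "(creation_field x * layer k) $$ (r, c) = (layer (Suc k) * creation_field x) $$ (r, c)"
    unfolding layer_def index_mult_diag_real[OF creation_field_carrier rc] index_diag_real_mult[OF creation_field_carrier rc]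
    using rc by (simp only: creation_field_def kernel_mat_index)
qed (use carrier_matD[OF layer(1)] carrier_matD[OF creation_field_carrier] in auto)

text \<open>There are (l - 1) choose k sets of size k that avoid j. Distinct creation operators
  never send a basis vector to the same place, whence the orthogonality.\<close>

lemma hs_inner_layer_creation:
  assumes ij: "i \<in> {1..l}" "j \<in> {1..l}"
  shows "hs_inner (layer_creation k i) (layer_creation k j) = (if i = j then real ((l - 1) choose k) else 0)"
proof -
  have col: "(\<Sum>T\<in>Pow {1..l}. creation i T S * creation j T S) = (if i = j \<and> j \<notin> S then 1 else 0)" if S: "S \<subseteq> {1..l}" for S
  proof (cases "i = j")
    case True
    thus ?thesis using sum_creation_left_self[OF S ij(2), of S] by simp
  next
    case False
    thus ?thesis unfolding sum_creation_left[OF S ij(2)] by (auto simp: creation_def)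
  qed
  have "hs_inner (layer_creation k i) (layer_creation k j) =
    (\<Sum>T\<in>Pow {1..l}. \<Sum>S\<in>Pow {1..l}. if card S = k then creation i T S * creation j T S else 0)"
    unfolding layer_creation_def hs_inner_kernel_mat by (intro sum.cong refl) simp
  also have "\<dots> = (\<Sum>S\<in>Pow {1..l}. \<Sum>T\<in>Pow {1..l}. if card S = k then creation i T S * creation j T S else 0)"
    by (rule sum.swap)
  also have "\<dots> = (\<Sum>S\<in>Pow {1..l}. if i = j \<and> j \<notin> S \<and> card S = k then 1 else 0)"
  proof (intro sum.cong refl)
    fix S assume "S \<in> Pow {1..l}"
    hence S: "S \<subseteq> {1..l}" by simp
    show "(\<Sum>T\<in>Pow {1..l}. if card S = k then creation i T S * creation j T S else 0) = (if i = j \<and> j \<notin> S \<and> card S = k then 1 else 0)"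
      using col[OF S] by (cases "card S = k") simp_all
  qed
  also have "\<dots> = (if i = j then real (card {S \<in> Pow {1..l}. j \<notin> S \<and> card S = k}) else 0)"
    by (simp add: sum.If_cases Int_def)
  also have "{S \<in> Pow {1..l}. j \<notin> S \<and> card S = k} = {S. S \<subseteq> {1..l} - {j} \<and> card S = k}" by auto
  also have "card \<dots> = (l - 1) choose k" using ij by (subst n_subsets) auto
  finally show ?thesis .
qed

text \<open>A set of size k leaves l - k particles that can be added.\<close>

lemma sum_gram_layer_creation:
  "mat_sum d (\<lambda>j. mat_adjoint (layer_creation k j) * layer_creation k j) {1..l} =
    diag_real d (\<lambda>r. if card (e r) = k then real (l - k) else 0)"
proof -
  have "(\<Sum>j=1..l. \<Sum>U\<in>Pow {1..l}. (if card T = k then creation j U T else 0) * (if card S = k then creation j U S else 0)) =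
    (if T = S then (if card S = k then real (l - k) else 0) else 0)" (is "?a = _")
    if S: "S \<subseteq> {1..l}" and T: "T \<subseteq> {1..l}" for T S
  proof -
    have "?a = (\<Sum>j=1..l. if card T = k \<and> card S = k then (\<Sum>U\<in>Pow {1..l}. creation j U T * creation j U S) else 0)"
      by (intro sum.cong refl) simp
    also have "\<dots> = (\<Sum>j=1..l. if T = S \<and> card S = k \<and> j \<notin> S then 1 else 0)"
      by (intro sum.cong refl) (use sum_creation_left_self[OF S] in auto)
    also have "\<dots> = (if T = S \<and> card S = k then real (card ({1..l} - S)) else 0)"
    proof (cases "T = S \<and> card S = k")
      case True
      thus ?thesis by (simp add: sum.If_cases Diff_eq Compl_eq)
    next
      case False
      hence z: "(if T = S \<and> card S = k \<and> j \<notin> S then 1 else 0 :: real) = 0" for j by auto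
      show ?thesis unfolding z using False by auto
    qed
    also have "card ({1..l} - S) = l - card S" using S finite_subset[OF S] by (simp add: card_Diff_subset)
    finally show ?thesis by simp
  qed
  thus ?thesis
    unfolding layer_creation_def kernel_mat_adjoint kernel_mat_mult kernel_mat_sum[OF finite_atLeastAtMost]
      kernel_mat_diag[of "\<lambda>S. if card S = k then real (l - k) else 0", symmetric]
    by (intro kernel_mat_cong)
qed

text \<open>A set of size k + 1 arises by adding any one of its k + 1 elements to the
  others.\<close>

lemma sum_cogram_layer_creation:
  "mat_sum d (\<lambda>j. layer_creation k j * mat_adjoint (layer_creation k j)) {1..l} =
    diag_real d (\<lambda>r. if card (e r) = Suc k then real (Suc k) else 0)"
proof -
  have "(\<Sum>j=1..l. \<Sum>U\<in>Pow {1..l}. (if card U = k then creation j T U else 0) * (if card U = k then creation j S U else 0)) =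
    (if T = S then (if card S = Suc k then real (Suc k) else 0) else 0)" (is "?a = _")
    if S: "S \<subseteq> {1..l}" and T: "T \<subseteq> {1..l}" for T S
  proof -
    have "(\<Sum>U\<in>Pow {1..l}. (if card U = k then creation j T U else 0) * (if card U = k then creation j S U else 0)) =
      (if T = S \<and> card S = Suc k \<and> j \<in> S then 1 else 0)" (is "?b = _") for j
    proof -
      have "?b = (\<Sum>U\<in>Pow {1..l}. creation j T U * (if card U = k then creation j S U else 0))"
        by (intro sum.cong refl) simp
      also have "\<dots> = (if j \<in> T then fermion_sign j (T - {j}) * (if card (T - {j}) = k then creation j S (T - {j}) else 0) else 0)"
        by (rule sum_creation_right[OF T])
      also have "\<dots> = (if T = S \<and> card S = Suc k \<and> j \<in> S then 1 else 0)"
      proof (cases "j \<in> T")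
        case True
        hence "card T = Suc (card (T - {j}))" using finite_subset[OF T] by (intro card.remove) auto
        moreover have "creation j S (T - {j}) = (if T = S then fermion_sign j (T - {j}) else 0)"
          using True by (auto simp: creation_def insert_absorb)
        ultimately show ?thesis using True by auto
      qed auto
      finally show ?thesis .
    qed
    hence "?a = (\<Sum>j=1..l. if T = S \<and> card S = Suc k \<and> j \<in> S then 1 else 0)" by simp
    also have "\<dots> = (if T = S \<and> card S = Suc k then real (card ({1..l} \<inter> S)) else 0)"
    proof (cases "T = S \<and> card S = Suc k")
      case True
      thus ?thesis by (simp add: sum.If_cases)
    next
      case False
      hence z: "(if T = S \<and> card S = Suc k \<and> j \<in> S then 1 else 0 :: real) = 0" for j by auto
      show ?thesis unfolding z using False by auto
    qed
    also have "{1..l} \<inter> S = S" using S by auto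
    finally show ?thesis by simp
  qed
  thus ?thesis
    unfolding layer_creation_def kernel_mat_adjoint kernel_mat_mult kernel_mat_sum[OF finite_atLeastAtMost]
      kernel_mat_diag[of "\<lambda>S. if card S = Suc k then real (Suc k) else 0", symmetric]
    by (intro kernel_mat_cong)
qed

text \<open>
  By the canonical anticommutation relations, \<open>H = G\<^sup>* G\<close> satisfies \<open>H\<^sup>2 = |x|\<^sup>2 H\<close>, so that
  \<open>|G| = H / |x|\<close>: all nonzero singular values of \<open>G\<close> agree.
\<close>

lemma gram_creation_field_layer_square:
  fixes x :: "nat \<Rightarrow> real" and k :: nat
  defines "H \<equiv> mat_adjoint (creation_field x * layer k) * (creation_field x * layer k)"
  shows "H * H = complex_of_real (\<Sum>j=1..l. (x j)\<^sup>2) \<cdot>\<^sub>m H"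
proof -
  define A where "A = creation_field x"
  define A' where "A' = mat_adjoint (creation_field x)"
  define P where "P = layer k"
  define Q where "Q = layer (Suc k)"
  define s where "s = complex_of_real (\<Sum>j=1..l. (x j)\<^sup>2)"
  have c [simp]: "A \<in> carrier_mat d d" "A' \<in> carrier_mat d d" "P \<in> carrier_mat d d" "Q \<in> carrier_mat d d"
    by (simp_all add: A_def A'_def P_def Q_def)
  note assoc = assoc_mult_mat[of _ d d _ d _ d]
  have AP: "A * P = Q * A" unfolding A_def P_def Q_def by (rule creation_field_layer)
  have PA': "P * A' = A' * Q"
    using arg_cong[OF AP, of mat_adjoint]
    by (simp add: mat_adjoint_mult[of _ d d _ d] A_def A'_def P_def Q_def)
  have PP: "P * P = P" by (simp add: P_def)
  have AA: "A * A = 0\<^sub>m d d" unfolding A_def by (rule creation_field_square)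
  \<comment> \<open>Multiply the anticommutation relation by A; as A A = 0, only A A' A = s A
    remains.\<close>
  have "(A' * A + A * A') * A = s \<cdot>\<^sub>m A"
    unfolding A_def A'_def s_def creation_field_canonical
    by (intro eq_matI) (auto simp: index_diag_real_mult[OF creation_field_carrier] carrier_matD[OF creation_field_carrier] simp del: index_mult_mat(1))
  moreover have "(A' * A + A * A') * A = A * (A' * A)"
    using AA carrier_matD[OF c(2)] by (simp add: add_mult_distrib_mat[of _ d d _ _ d] assoc)
  ultimately have AA'A: "A * (A' * A) = s \<cdot>\<^sub>m A" by simp
  have H: "H = A' * A * P"
  proof -
    have "H = P * A' * (A * P)"
      unfolding H_def A_def[symmetric] P_def[symmetric] A'_def[symmetric]
      by (subst mat_adjoint_mult[of _ d d _ d]) (simp_all add: A'_def A_def P_def)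
    also have "\<dots> = A' * (Q * A) * P" unfolding PA' by (simp add: assoc)
    also have "\<dots> = A' * A * (P * P)" unfolding AP[symmetric] by (simp add: assoc)
    finally show ?thesis by (simp only: PP)
  qed
  \<comment> \<open>A raises the particle number by one and A' lowers it again.\<close>
  have comm: "P * (A' * A) = A' * A * P"
  proof -
    have "P * (A' * A) = P * A' * A" by (simp add: assoc)
    also have "\<dots> = A' * (Q * A)" unfolding PA' by (simp add: assoc)
    also have "\<dots> = A' * A * P" unfolding AP[symmetric] by (simp add: assoc)
    finally show ?thesis .
  qed
  have "H * H = A' * A * (P * (A' * A)) * P" unfolding H by (simp add: assoc)
  also have "\<dots> = A' * (A * (A' * A)) * (P * P)" unfolding comm by (simp add: assoc)
  also have "\<dots> = s \<cdot>\<^sub>m H"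
    unfolding AA'A PP H
    by (simp add: mult_smult_distrib[of A' d d A d] mult_smult_assoc_mat[of "A' * A" d d P d])
  finally show ?thesis by (simp add: s_def)
qed

text \<open>For nonzero x all nonzero singular values equal |x|, and their number is the binomial
  coefficient. So the trace norm is a fixed multiple of the Hilbert-Schmidt norm, whatever the
  coefficients are.\<close>

lemma trace_abs_layer_creation:
  "Re (mat_trace (mat_abs (lin_comb d l (layer_creation k) x))) =
    sqrt ((l - 1) choose k) * hs_norm (lin_comb d l (layer_creation k) x)"
proof -
  define G where "G = lin_comb d l (layer_creation k) x"
  have cr: "\<forall>j\<in>{1..l}. layer_creation k j \<in> carrier_mat d d" by simp
  have Gc: "G \<in> carrier_mat d d" unfolding G_def by (rule lin_comb_carrier[OF cr])
  define s where "s = sqrt (\<Sum>j=1..l. (x j)\<^sup>2)"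
  have s2: "s\<^sup>2 = (\<Sum>j=1..l. (x j)\<^sup>2)" by (simp add: s_def sum_nonneg)
  have "hs_inner G G = (\<Sum>i=1..l. \<Sum>j=1..l. if i = j then (x i)\<^sup>2 * real ((l - 1) choose k) else 0)"
    unfolding G_def hs_inner_lin_comb[OF cr]
    by (intro sum.cong refl) (simp add: hs_inner_layer_creation power2_eq_square del: atLeastAtMost_iff)
  also have "\<dots> = s\<^sup>2 * real ((l - 1) choose k)" by (simp add: s2 sum_distrib_right)
  finally have in_G: "hs_inner G G = s\<^sup>2 * real ((l - 1) choose k)" .
  hence norm_G: "hs_norm G = s * sqrt ((l - 1) choose k)" by (simp add: hs_norm_def real_sqrt_mult s_def sum_nonneg)
  show ?thesis
  proof (cases "s = 0")
    case True
    hence "G = 0\<^sub>m d d" using norm_G hs_norm_zero_iff[OF Gc] by simp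
    thus ?thesis
      using norm_G True by (simp add: G_def[symmetric] mat_abs_of_psd[OF psd_mat_zero] mat_trace_def)
  next
    case False
    hence s: "s > 0" by (simp add: s_def sum_nonneg order_less_le)
    have "mat_adjoint G * G * (mat_adjoint G * G) = complex_of_real (s\<^sup>2) \<cdot>\<^sub>m (mat_adjoint G * G)"
      unfolding G_def lin_comb_layer_creation s2 by (rule gram_creation_field_layer_square)
    from mat_abs_scaled_gram[OF Gc s this]
    have "Re (mat_trace (mat_abs G)) = 1 / s * hs_inner G G"
      using Gc by (simp add: hs_inner_def mat_trace_smult[of _ d])
    also have "\<dots> = sqrt ((l - 1) choose k) * hs_norm G"
      unfolding in_G norm_G using s by (simp add: power2_eq_square)
    finally show ?thesis by (simp only: G_def)
  qed
qed

end

text \<open>By Jensen's inequality the Gaussian norm is at most sqrt l tau, while testing against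
  \<open>B\<close> shows that the norm of the family is at least l tau / sqrt (k + 1). The quotient
  is the square root of (2 k + 1) / (k + 1), which tends to sqrt 2.\<close>

lemma (in gaussian_sequence) S1_l2_norm_constant_ge:
  assumes c: "\<And>d l C. \<forall>j\<in>{1..l}. C j \<in> carrier_mat d d \<Longrightarrow>
    S1_l2_norm d {1..l} C \<le> c * L1_S1_norm M (gauss_sum g d l C)"
  shows "sqrt 2 \<le> c"
proof -
  have ineq: "0 < c \<and> 2 * real k + 1 \<le> c\<^sup>2 * (real k + 1)" for k
  proof -
    \<comment> \<open>Then l - k = k + 1, so both Gram sums of the family are k + 1 times
      projections and the single factor 1 / \<open>m\<close> normalizes both in
      \<open>B\<close>.\<close>
    define l where "l = 2 * k + 1"
    define \<tau> where "\<tau> = real ((l - 1) choose k)"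
    have \<tau>: "\<tau> > 0" by (simp add: \<tau>_def l_def zero_less_binomial)
    have "card (Pow {1..l}) = 2 ^ l" by (simp add: card_Pow)
    then obtain e where "bij_betw e {0..<2 ^ l :: nat} (Pow {1..l})"
      using ex_bij_betw_nat_finite[of "Pow {1..l}"] by auto
    then interpret subset_enumeration l "2 ^ l" e
      by unfold_locales (simp add: lessThan_atLeast0)
    let ?d = "2 ^ l :: nat"
    define C where "C = layer_creation k"
    have C: "\<forall>j\<in>{1..l}. C j \<in> carrier_mat ?d ?d" by (simp add: C_def)
    have CC: "hs_inner (C j) (C j) = \<tau>" if "j \<in> {1..l}" for j
      using hs_inner_layer_creation[OF that that] by (simp add: C_def \<tau>_def)

    define L where "L = L1_S1_norm M (gauss_sum g ?d l C)"
    have L0: "L \<ge> 0" unfolding L_def by (rule L1_S1_norm_nonneg[OF C])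
    have "L = expectation (\<lambda>\<omega>. sqrt \<tau> * hs_norm (lin_comb ?d l C (\<lambda>j. g j \<omega>)))"
      unfolding L_def L1_S1_norm_gauss_sum(2)[OF C] unfolding C_def \<tau>_def trace_abs_layer_creation ..
    also have "\<dots> = sqrt \<tau> * expectation (\<lambda>\<omega>. hs_norm (lin_comb ?d l C (\<lambda>j. g j \<omega>)))" by simp
    also have "\<dots> \<le> sqrt \<tau> * sqrt (\<Sum>j=1..l. hs_inner (C j) (C j))"
      using expectation_hs_norm_le(2)[OF C] \<tau> by (intro mult_left_mono) auto
    also have "(\<Sum>j=1..l. hs_inner (C j) (C j)) = real l * \<tau>" by (simp add: CC del: atLeastAtMost_iff)
    also have "sqrt \<tau> * sqrt (real l * \<tau>) = sqrt (real l) * \<tau>"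
      using \<tau> by (simp add: real_sqrt_mult)
    finally have L: "L \<le> sqrt (real l) * \<tau>" .

    define m where "m = sqrt (real k + 1)"
    have m: "m > 0" "m * m = real k + 1" by (simp_all add: m_def)
    define B where "B j = complex_of_real (1 / m) \<cdot>\<^sub>m C j" for j
    have B: "\<forall>j\<in>{1..l}. B j \<in> carrier_mat ?d ?d" by (simp add: B_def C_def)
    have mm: "1 / m * (1 / m) = 1 / (real k + 1)" using m by simp
    have BB: "mat_adjoint (B j) * B j = complex_of_real (1 / (real k + 1)) \<cdot>\<^sub>m (mat_adjoint (C j) * C j)"
      "B j * mat_adjoint (B j) = complex_of_real (1 / (real k + 1)) \<cdot>\<^sub>m (C j * mat_adjoint (C j))" if "j \<in> {1..l}" for j
      using bspec[OF C that] unfolding mm[symmetric] of_real_mult B_def mat_adjoint_smult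
      by (simp_all add: mult_smult_distrib[of _ ?d ?d _ ?d] mult_smult_assoc_mat[of _ ?d ?d _ ?d] smult_smult_mat)
    have sB: "mat_sum ?d (\<lambda>j. mat_adjoint (B j) * B j) {1..l} = diag_real ?d (\<lambda>r. if card (e r) = k then 1 else 0)"
    proof -
      have "mat_sum ?d (\<lambda>j. mat_adjoint (B j) * B j) {1..l} =
        complex_of_real (1 / (real k + 1)) \<cdot>\<^sub>m mat_sum ?d (\<lambda>j. mat_adjoint (C j) * C j) {1..l}"
        using B C by (intro mat_sum_smult_cong BB) auto
      also have "\<dots> = diag_real ?d (\<lambda>r. if card (e r) = k then 1 else 0)"
        unfolding C_def sum_gram_layer_creation diag_real_smult
        by (intro diag_real_cong) (simp add: l_def)
      finally show ?thesis .
    qed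
    have sB': "mat_sum ?d (\<lambda>j. B j * mat_adjoint (B j)) {1..l} = diag_real ?d (\<lambda>r. if card (e r) = Suc k then 1 else 0)"
    proof -
      have "mat_sum ?d (\<lambda>j. B j * mat_adjoint (B j)) {1..l} =
        complex_of_real (1 / (real k + 1)) \<cdot>\<^sub>m mat_sum ?d (\<lambda>j. C j * mat_adjoint (C j)) {1..l}"
        using B C by (intro mat_sum_smult_cong BB) auto
      also have "\<dots> = diag_real ?d (\<lambda>r. if card (e r) = Suc k then 1 else 0)"
        unfolding C_def sum_cogram_layer_creation diag_real_smult
        by (intro diag_real_cong) simp
      finally show ?thesis .
    qed
    have "hs_inner (B j) (C j) = \<tau> / m" if "j \<in> {1..l}" for j
      using CC[OF that] bspec[OF C that] unfolding hs_inner_def B_def mat_adjoint_smult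
      by (simp add: mult_smult_assoc_mat[of _ ?d ?d _ ?d] mat_trace_smult[of _ ?d])
    hence "real l * \<tau> / m = (\<Sum>j\<in>{1..l}. hs_inner (B j) (C j))" by simp
    also have "\<dots> \<le> S1_l2_norm ?d {1..l} C"
      by (rule S1_l2_norm_ge_dual[OF finite_atLeastAtMost C B sB _ sB']) auto
    also have "\<dots> \<le> c * L" unfolding L_def by (rule c[OF C])
    finally have main: "real l * \<tau> / m \<le> c * L" .

    have l: "real l > 0" by (simp add: l_def)
    have "c * L > 0" using l \<tau> m by (intro less_le_trans[OF _ main]) simp
    hence c0: "c > 0" using L0 by (simp add: zero_less_mult_iff)
    have "real l * \<tau> / m \<le> c * (sqrt (real l) * \<tau>)"
      using main L c0 by (meson mult_left_mono less_imp_le order_trans)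
    hence "real l * \<tau> \<le> c * m * sqrt (real l) * \<tau>" using m by (simp add: divide_le_eq mult_ac)
    hence "sqrt (real l) * sqrt (real l) \<le> c * m * sqrt (real l)" using \<tau> l by simp
    hence "sqrt (real l) \<le> c * m" using l by (simp only: mult_le_cancel_right) auto
    hence "sqrt (real l) * sqrt (real l) \<le> (c * m) * (c * m)" using c0 m(1) by (intro mult_mono) auto
    also have "\<dots> = c\<^sup>2 * (m * m)" by (simp add: power2_eq_square mult_ac)
    finally show ?thesis using c0 l m(2) by (simp add: l_def)
  qed
  have "2 \<le> c\<^sup>2"
  proof (rule ccontr)
    assume "\<not> 2 \<le> c\<^sup>2"
    hence a: "2 - c\<^sup>2 > 0" by simp
    then obtain k :: nat where "c\<^sup>2 - 1 < real k * (2 - c\<^sup>2)" using reals_Archimedean3 by blast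
    thus False using ineq[of k] by (simp add: algebra_simps)
  qed
  thus "sqrt 2 \<le> c" using ineq[of 0] by (intro real_le_lsqrt) auto
qed

theorem corollary5p23:
  fixes M :: "'a measure" and g :: "nat \<Rightarrow> 'a \<Rightarrow> real"
  assumes "prob_space M"
    and "prob_space.indep_vars M (\<lambda>_. borel) g {1..}"
    and "\<And>j. j \<ge> 1 \<Longrightarrow> distributed M lborel (g j) std_normal_density"
  shows "(\<forall>(d::nat) (l::nat) (C :: nat \<Rightarrow> complex mat).
            (\<forall>j\<in>{1..l}. C j \<in> carrier_mat d d) \<longrightarrow>
              L1_S1_norm M (gauss_sum g d l C) \<le> S1_l2_norm d {1..l} C \<and>
              S1_l2_norm d {1..l} C \<le> sqrt 2 * L1_S1_norm M (gauss_sum g d l C))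
       \<and> (\<forall>c::real. c < sqrt 2 \<longrightarrow>
            \<not> (\<forall>(d::nat) (l::nat) (C :: nat \<Rightarrow> complex mat).
                 (\<forall>j\<in>{1..l}. C j \<in> carrier_mat d d) \<longrightarrow>
                   S1_l2_norm d {1..l} C \<le> c * L1_S1_norm M (gauss_sum g d l C)))"
proof -
  interpret prob_space M by (rule assms(1))
  interpret gaussian_sequence M g
    using assms by unfold_locales auto
  show ?thesis
  proof (intro conjI allI impI notI)
    fix d l :: nat and C :: "nat \<Rightarrow> complex mat"
    assume C: "\<forall>j\<in>{1..l}. C j \<in> carrier_mat d d"
    show "L1_S1_norm M (gauss_sum g d l C) \<le> S1_l2_norm d {1..l} C" by (rule L1_S1_norm_le_S1_l2_norm[OF C])
    show "S1_l2_norm d {1..l} C \<le> sqrt 2 * L1_S1_norm M (gauss_sum g d l C)" by (rule S1_l2_norm_le_L1_S1_norm[OF C])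
  next
    fix c :: real
    assume "c < sqrt 2" and "\<forall>(d::nat) (l::nat) (C :: nat \<Rightarrow> complex mat).
      (\<forall>j\<in>{1..l}. C j \<in> carrier_mat d d) \<longrightarrow> S1_l2_norm d {1..l} C \<le> c * L1_S1_norm M (gauss_sum g d l C)"
    thus False using S1_l2_norm_constant_ge[of c] by fastforce
  qed
qed

end
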